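(* Let $k\ge 0$ be an integer. The sequence of $\mathcal{S}_n$-modules $(L\mathcal{P}_k(n))_{n\ge 0}$, with connecting maps $L\varphi_{k,n}:L\mathcal{P}_k(n)\to L\mathcal{P}_k(n+1)$ induced by the inclusions $\{1,\dots,n\}\hookrightarrow\{1,\dots,n+1\}$, satisfies $$L\mathcal{P}_k(n)\cong V(0)_n\oplus V(1)_n\oplus\cdots\oplus V(k)_n\qquad\text{for } n\ge 2k,$$ and it is consistent, uniformly representation stable and monotonic.
   Context: All representations are over $\mathbb{Q}$. $\mathcal{P}_k(n)$ is the set of $k$-element subsets of $\{1,\dots,n\}$, on which the symmetric group $\mathcal{S}_n$ acts by $\pi\cdot A=\pi(A)$; $L\mathcal{P}_k(n)$ is the $\mathbb{Q}$-vector space with basis $\mathcal{P}_k(n)$, with the induced linear action. $V_\lambda$ is the irreducible $\mathcal{S}_n$-module corresponding to the partition $\lambda$ of $n$. For a partition $\mu=(\mu_1\ge\dots\ge\mu_s\ge 0)$ with $n-\sum\mu_i\ge\mu_1$, put $V(\mu)_n=V_{(n-\sum\mu_i,\mu_1,\dots,\mu_s)}$; thus $V(i)_n=V_{(n-i,i)}$ and $V(0)_n=V_{(n)}$. (If $n-\sum\mu_i<\mu_1$, the multiplicity of $V(\mu)_n$ is taken to be $0$.) Let $X_*=(X_0\xrightarrow{\varphi_0}X_1\xrightarrow{\varphi_1}\cdots)$ be a sequence where $X_n$ is an $\mathcal{S}_n$-module and the $\varphi_n$ are linear maps. For $Y\subseteq X_{n+1}$, $\mathcal{S}_{n+1}\cdot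 Y$ is the $\mathcal{S}_{n+1}$-submodule spanned by $Y$. - $X_*$ is consistent if each $\varphi_n$ is $\mathcal{S}_n$-equivariant ($\mathcal{S}_n\subset\mathcal{S}_{n+1}$ being the subgroup fixing $n+1$). - $X_*$ is injective if $\varphi_n$ is injective for all large $n$, and $\mathcal{S}_*$-surjective if $\mathcal{S}_{n+1}\cdot\mathrm{Im}(\varphi_n)=X_{n+1}$ for all large $n$. - $X_*$ is representation stable if it is consistent, injective, $\mathcal{S}_*$-surjective and for every $\mu$ the multiplicity $c_{\mu,n}$ of $V(\mu)_n$ in $X_n$ is eventually constant in $n$. - $X_*$ is uniformly representation stable if it is representation stable and there is $N$, independent of $\mu$, such that $c_{\mu,n}=c_{\mu,N}$ for all $\mu$ and all $n\ge N$. - A consistent $X_*$ is monotonic if for each $n$, each $\mu$ and each $\mathcal{S}_n$-submodule $U\cong c\cdot V(\mu)_n$ (direct sum of $c$ copies) of $X_n$, the $\mathcal{S}_{n+1}$-span of $\varphi_n(U)$ in $X_{n+1}$ contains a submodule isomorphic to $c\cdot V(\mu)_{n+1}$. *)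

theory Defs
  imports Complex_Main "HOL-Library.Poly_Mapping" "HOL-Combinatorics.Permutations"
begin

text \<open>
  The group \<open>S\<^sub>n\<close> is the set of all \<open>\<pi>\<close> with \<open>\<pi> permutes {1..n}\<close>. Such a \<open>\<pi>\<close> is a function on
  all natural numbers fixing everything outside \<open>{1..n}\<close>, so \<open>S\<^sub>n\<close> is literally the subgroup of
  \<open>S\<^bsub>n+1\<^esub>\<close> fixing \<open>n + 1\<close>.

  A representation is carried by a subspace of an ambient rational vector space;
  the action is only constrained on this subspace.
\<close>

record 'v rep =
  space :: "'v set"
  scale :: "rat \<Rightarrow> 'v \<Rightarrow> 'v"
  action :: "(nat \<Rightarrow> nat) \<Rightarrow> 'v \<Rightarrow> 'v"

definition linear_map :: "('v::ab_group_add) rep \<Rightarrow> ('w::ab_group_add) rep \<Rightarrow> ('v \<Rightarrow> 'w) \<Rightarrow> bool" where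
  "linear_map V W f \<longleftrightarrow>
     (\<forall>x\<in>space V. f x \<in> space W) \<and>
     (\<forall>x\<in>space V. \<forall>y\<in>space V. f (x + y) = f x + f y) \<and>
     (\<forall>c. \<forall>x\<in>space V. f (scale V c x) = scale W c (f x))"

definition Sn_module :: "nat \<Rightarrow> ('v::ab_group_add) rep \<Rightarrow> bool" where
  "Sn_module n V \<longleftrightarrow>
     vector_space (scale V) \<and> module.subspace (scale V) (space V) \<and>
     (\<forall>\<pi>. \<pi> permutes {1..n} \<longrightarrow> linear_map V V (action V \<pi>)) \<and>
     (\<forall>x\<in>space V. action V id x = x) \<and>
     (\<forall>\<pi> \<sigma>. \<pi> permutes {1..n} \<longrightarrow> \<sigma> permutes {1..n} \<longrightarrow>
        (\<forall>x\<in>space V. action V (\<pi> \<circ> \<sigma>) x = action V \<pi> (action V \<sigma> x)))"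

definition equivariant ::
    "nat \<Rightarrow> ('v::ab_group_add) rep \<Rightarrow> ('w::ab_group_add) rep \<Rightarrow> ('v \<Rightarrow> 'w) \<Rightarrow> bool" where
  "equivariant n V W f \<longleftrightarrow>
     (\<forall>\<pi>. \<pi> permutes {1..n} \<longrightarrow> (\<forall>x\<in>space V. f (action V \<pi> x) = action W \<pi> (f x)))"

definition isomorphic :: "nat \<Rightarrow> ('v::ab_group_add) rep \<Rightarrow> ('w::ab_group_add) rep \<Rightarrow> bool" where
  "isomorphic n V W \<longleftrightarrow>
     (\<exists>f. linear_map V W f \<and> equivariant n V W f \<and> bij_betw f (space V) (space W))"

definition submodule :: "nat \<Rightarrow> ('v::ab_group_add) rep \<Rightarrow> 'v set \<Rightarrow> bool" where
  "submodule n V U \<longleftrightarrow>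
     U \<subseteq> space V \<and> module.subspace (scale V) U \<and>
     (\<forall>\<pi>. \<pi> permutes {1..n} \<longrightarrow> (\<forall>x\<in>U. action V \<pi> x \<in> U))"

definition sub_rep :: "'v rep \<Rightarrow> 'v set \<Rightarrow> 'v rep" where
  "sub_rep V U = V\<lparr>space := U\<rparr>"

definition irreducible_module :: "nat \<Rightarrow> ('v::ab_group_add) rep \<Rightarrow> bool" where
  "irreducible_module n V \<longleftrightarrow>
     Sn_module n V \<and> space V \<noteq> {0} \<and> (\<forall>U. submodule n V U \<longrightarrow> U = {0} \<or> U = space V)"

definition orbit_span :: "nat \<Rightarrow> ('v::ab_group_add) rep \<Rightarrow> 'v set \<Rightarrow> 'v set" where
  "orbit_span n V Y = module.span (scale V) {action V \<pi> y | \<pi> y. \<pi> permutes {1..n} \<and> y \<in> Y}"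

definition direct_sum :: "'i set \<Rightarrow> ('i \<Rightarrow> ('v::ab_group_add) rep) \<Rightarrow> ('i \<Rightarrow>\<^sub>0 'v) rep" where
  "direct_sum I W =
     \<lparr> space = {f. Poly_Mapping.keys f \<subseteq> I \<and> (\<forall>i\<in>I. Poly_Mapping.lookup f i \<in> space (W i))},
       scale = (\<lambda>c. Poly_Mapping.mapp (\<lambda>i. scale (W i) c)),
       action = (\<lambda>\<pi>. Poly_Mapping.mapp (\<lambda>i. action (W i) \<pi>)) \<rparr>"

text \<open>
  The multiplicity of an irreducible module \<open>S\<close> in \<open>V\<close>: the number of summands isomorphic to \<open>S\<close> in
  a decomposition of \<open>V\<close> into finitely many irreducible modules. For finite-dimensional \<open>V\<close> such a
  decomposition exists (Maschke) and this number does not depend on it (Krull-Schmidt).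
\<close>

definition multiplicity ::
    "nat \<Rightarrow> ('v::ab_group_add) rep \<Rightarrow> ('w::ab_group_add) rep \<Rightarrow> nat" where
  "multiplicity n V S =
     (THE c. \<exists>(r::nat) U.
        (\<forall>i<r. submodule n V (U i) \<and> irreducible_module n (sub_rep V (U i))) \<and>
        isomorphic n V (direct_sum {..<r} (\<lambda>i. sub_rep V (U i))) \<and>
        c = card {i. i < r \<and> isomorphic n (sub_rep V (U i)) S})"

definition linearize :: "('a \<Rightarrow> 'b) \<Rightarrow> ('a \<Rightarrow>\<^sub>0 rat) \<Rightarrow> ('b \<Rightarrow>\<^sub>0 rat)" where
  "linearize g f =
     (\<Sum>a\<in>Poly_Mapping.keys f. Poly_Mapping.single (g a) (Poly_Mapping.lookup f a))"

definition free_rep :: "'a set \<Rightarrow> ((nat \<Rightarrow> nat) \<Rightarrow> 'a \<Rightarrow> 'a) \<Rightarrow> ('a \<Rightarrow>\<^sub>0 rat) rep" where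
  "free_rep B act =
     \<lparr> space = {f. Poly_Mapping.keys f \<subseteq> B},
       scale = (\<lambda>c. Poly_Mapping.map ((*) c)),
       action = (\<lambda>\<pi>. linearize (act \<pi>)) \<rparr>"

definition subsets_of_size :: "nat \<Rightarrow> nat \<Rightarrow> nat set set" where
  "subsets_of_size k n = {A. A \<subseteq> {1..n} \<and> card A = k}"

definition LP :: "nat \<Rightarrow> nat \<Rightarrow> (nat set \<Rightarrow>\<^sub>0 rat) rep" where
  "LP k n = free_rep (subsets_of_size k n) image"

text \<open>
  As a function on natural numbers, the inclusion of \<open>{1..n}\<close> into \<open>{1..n+1}\<close> is the identity;
  it sends a subset \<open>A\<close> to its image.
\<close>

definition LP_map :: "nat \<Rightarrow> nat \<Rightarrow> (nat set \<Rightarrow>\<^sub>0 rat) \<Rightarrow> (nat set \<Rightarrow>\<^sub>0 rat)" where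
  "LP_map k n = linearize (image (id :: nat \<Rightarrow> nat))"

text \<open>
  A partition is a weakly decreasing list; trailing zeros are allowed, and padding a
  partition with zeros changes its Specht module only up to isomorphism. The irreducible
  module attached to a partition is its Specht module, inside the permutation module on tabloids.
  In this convention \<open>(n)\<close> gives the trivial module. A tabloid is the list of the sets of entries
  of the rows of a tableau.
\<close>

definition partition :: "nat list \<Rightarrow> bool" where
  "partition p \<longleftrightarrow> sorted_wrt (\<ge>) p"

definition cells :: "nat list \<Rightarrow> (nat \<times> nat) set" where
  "cells p = {(i, j). i < length p \<and> j < p ! i}"

definition tableau :: "nat list \<Rightarrow> (nat \<times> nat \<Rightarrow> nat) \<Rightarrow> bool" where
  "tableau p t \<longleftrightarrow> bij_betw t (cells p) {1..sum_list p}"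

definition tabloid :: "nat list \<Rightarrow> (nat \<times> nat \<Rightarrow> nat) \<Rightarrow> nat set list" where
  "tabloid p t = map (\<lambda>i. t ` {c \<in> cells p. fst c = i}) [0..<length p]"

definition column_stabilizer :: "nat list \<Rightarrow> (nat \<times> nat \<Rightarrow> nat) \<Rightarrow> (nat \<Rightarrow> nat) set" where
  "column_stabilizer p t =
     {\<pi>. \<pi> permutes {1..sum_list p} \<and>
         (\<forall>j. \<pi> ` (t ` {c \<in> cells p. snd c = j}) = t ` {c \<in> cells p. snd c = j})}"

definition polytabloid :: "nat list \<Rightarrow> (nat \<times> nat \<Rightarrow> nat) \<Rightarrow> (nat set list \<Rightarrow>\<^sub>0 rat)" where
  "polytabloid p t =
     (\<Sum>\<pi>\<in>column_stabilizer p t. Poly_Mapping.single (tabloid p (\<pi> \<circ> t)) (of_int (sign \<pi>)))"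

definition tabloid_module :: "nat list \<Rightarrow> (nat set list \<Rightarrow>\<^sub>0 rat) rep" where
  "tabloid_module p = free_rep (tabloid p ` {t. tableau p t}) (\<lambda>\<pi>. map (image \<pi>))"

definition specht :: "nat list \<Rightarrow> (nat set list \<Rightarrow>\<^sub>0 rat) rep" where
  "specht p =
     sub_rep (tabloid_module p)
       (module.span (scale (tabloid_module p)) (polytabloid p ` {t. tableau p t}))"

text \<open>
  For a partition \<open>\<mu>\<close>, \<open>V_pad \<mu> n\<close> is the irreducible module of \<open>(n - |\<mu>|, \<mu>\<^sub>1, \<dots>, \<mu>\<^sub>s)\<close>. It is meaningful only
  if \<open>n - |\<mu>| \<ge> \<mu>\<^sub>1\<close>; this is \<open>admissible\<close>, stated without truncated subtraction and so as to cover the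
  empty \<open>\<mu>\<close>.
\<close>

definition admissible :: "nat list \<Rightarrow> nat \<Rightarrow> bool" where
  "admissible \<mu> n \<longleftrightarrow> sum_list \<mu> \<le> n \<and> (\<forall>m\<in>set \<mu>. sum_list \<mu> + m \<le> n)"

definition V_pad :: "nat list \<Rightarrow> nat \<Rightarrow> (nat set list \<Rightarrow>\<^sub>0 rat) rep" where
  "V_pad \<mu> n = specht ((n - sum_list \<mu>) # \<mu>)"

definition stable_multiplicity :: "(nat \<Rightarrow> ('v::ab_group_add) rep) \<Rightarrow> nat list \<Rightarrow> nat \<Rightarrow> nat" where
  "stable_multiplicity X \<mu> n = (if admissible \<mu> n then multiplicity n (X n) (V_pad \<mu> n) else 0)"

definition consistent ::
    "(nat \<Rightarrow> ('v::ab_group_add) rep) \<Rightarrow> (nat \<Rightarrow> 'v \<Rightarrow> 'v) \<Rightarrow> bool" where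
  "consistent X \<phi> \<longleftrightarrow>
     (\<forall>n. Sn_module n (X n)) \<and>
     (\<forall>n. linear_map (X n) (X (Suc n)) (\<phi> n)) \<and>
     (\<forall>n. equivariant n (X n) (X (Suc n)) (\<phi> n))"

definition eventually_injective ::
    "(nat \<Rightarrow> ('v::ab_group_add) rep) \<Rightarrow> (nat \<Rightarrow> 'v \<Rightarrow> 'v) \<Rightarrow> bool" where
  "eventually_injective X \<phi> \<longleftrightarrow> (\<exists>N. \<forall>n\<ge>N. inj_on (\<phi> n) (space (X n)))"

definition eventually_S_surjective ::
    "(nat \<Rightarrow> ('v::ab_group_add) rep) \<Rightarrow> (nat \<Rightarrow> 'v \<Rightarrow> 'v) \<Rightarrow> bool" where
  "eventually_S_surjective X \<phi> \<longleftrightarrow>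
     (\<exists>N. \<forall>n\<ge>N. orbit_span (Suc n) (X (Suc n)) (\<phi> n ` space (X n)) = space (X (Suc n)))"

definition representation_stable ::
    "(nat \<Rightarrow> ('v::ab_group_add) rep) \<Rightarrow> (nat \<Rightarrow> 'v \<Rightarrow> 'v) \<Rightarrow> bool" where
  "representation_stable X \<phi> \<longleftrightarrow>
     consistent X \<phi> \<and> eventually_injective X \<phi> \<and> eventually_S_surjective X \<phi> \<and>
     (\<forall>\<mu>. partition \<mu> \<longrightarrow>
        (\<exists>N. \<forall>n\<ge>N. stable_multiplicity X \<mu> n = stable_multiplicity X \<mu> N))"

definition uniformly_representation_stable ::
    "(nat \<Rightarrow> ('v::ab_group_add) rep) \<Rightarrow> (nat \<Rightarrow> 'v \<Rightarrow> 'v) \<Rightarrow> bool" where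
  "uniformly_representation_stable X \<phi> \<longleftrightarrow>
     representation_stable X \<phi> \<and>
     (\<exists>N. \<forall>\<mu>. partition \<mu> \<longrightarrow>
        (\<forall>n\<ge>N. stable_multiplicity X \<mu> n = stable_multiplicity X \<mu> N))"

definition monotonic ::
    "(nat \<Rightarrow> ('v::ab_group_add) rep) \<Rightarrow> (nat \<Rightarrow> 'v \<Rightarrow> 'v) \<Rightarrow> bool" where
  "monotonic X \<phi> \<longleftrightarrow>
     consistent X \<phi> \<and>
     (\<forall>n \<mu> (c::nat) U.
        partition \<mu> \<and> admissible \<mu> n \<and> submodule n (X n) U \<and>
        isomorphic n (sub_rep (X n) U) (direct_sum {..<c} (\<lambda>_. V_pad \<mu> n)) \<longrightarrow>
        (\<exists>W. submodule (Suc n) (X (Suc n)) W \<and>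
             W \<subseteq> orbit_span (Suc n) (X (Suc n)) (\<phi> n ` U) \<and>
             isomorphic (Suc n) (sub_rep (X (Suc n)) W)
               (direct_sum {..<c} (\<lambda>_. V_pad \<mu> (Suc n)))))"

end

theory Submission
  imports Defs
begin

text \<open>
  Fix \<open>a\<close> disjoint pairs \<open>{p j, q j}\<close>. A function on \<open>k\<close>-subsets that changes sign under every swap
  \<open>p j \<leftrightarrow> q j\<close> and is invariant under swaps of unmatched points is a multiple of
  \<open>A \<mapsto> (\<Prod>j<a. [q j \<in> A] - [p j \<in> A])\<close>. Let \<open>W a\<close> be the span of these matching vectors. In any nonzero submodule
  of \<open>LP k n\<close>, a nonzero vector alternating under as many pairs as possible is symmetric in the other
  points, so the submodule contains some \<open>W a\<close>. As the \<open>W a\<close> are mutually orthogonal for the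
  invariant inner product, they are irreducible and \<open>LP k n\<close> is their direct sum. A polytabloid
  of shape \<open>(n - a, a)\<close> has the same symmetries as a matching vector, which gives \<open>V(a) \<cong> W a\<close>
  and shows that every homomorphism \<open>V(a) \<rightarrow> LP k n\<close> sends it to a multiple of that vector. A shape
  with three rows has no nonzero homomorphism to \<open>LP k n\<close>, since among three points of a column two lie on the same
  side of any given set.
\<close>

text \<open>The obstacle is \<open>multiplicity\<close>, a definite description over all
  decompositions up to abstract isomorphism: besides exhibiting one decomposition, every other one
  must be shown to have the same summands. This succeeds because an irreducible submodule of
  \<open>LP k n\<close> is literally one of the \<open>W j\<close>, and because a homomorphism from
  a submodule into \<open>LP k n\<close> sends each matching vector to a multiple of itself; so an
  isomorphism can neither use a \<open>W j\<close> twice nor omit it. Orthogonality of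
  \<open>W a\<close> and \<open>W b\<close> for \<open>a < b\<close>: the matching vector on
  \<open>k\<close>-subsets comes from the one on \<open>a\<close>-subsets by summing over the
  \<open>a\<close>-subsets \<open>B\<close> of \<open>A\<close>. Such a \<open>B\<close> misses one
  of the \<open>b\<close> pairs, and swapping that pair cancels the coefficients over the supersets
  of \<open>B\<close>. The \<open>W a\<close> exhaust \<open>LP k n\<close> because the orthogonal
  complement of their sum is a submodule without nonzero matching vectors. For monotonicity the same
  pairs are kept while \<open>n\<close> grows: the matching vector of level \<open>n\<close>
  generates that of level \<open>n + 1\<close>.\<close>

abbreviation (input) lookup where "lookup \<equiv> Poly_Mapping.lookup"
abbreviation (input) keys where "keys \<equiv> Poly_Mapping.keys"
abbreviation (input) single where "single \<equiv> Poly_Mapping.single"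
abbreviation (input) smul :: "rat \<Rightarrow> ('a \<Rightarrow>\<^sub>0 rat) \<Rightarrow> ('a \<Rightarrow>\<^sub>0 rat)"
  where "smul \<equiv> \<lambda>c. Poly_Mapping.map ((*) c)"

lemma lookup_smul [simp]: "lookup (smul c f) a = c * lookup f a"
  by (simp add: Poly_Mapping.map.rep_eq when_def)

interpretation pm: vector_space "\<lambda>c. Poly_Mapping.map ((*) (c::rat)) :: ('a \<Rightarrow>\<^sub>0 rat) \<Rightarrow> _"
  by unfold_locales
     (auto intro!: poly_mapping_eqI simp: lookup_add algebra_simps)

section \<open>Linearization\<close>

text \<open>Vectors with different supports can thus be summed over one common index set, as
  additivity requires.\<close>

lemma linearize_eq_sum:
  assumes "finite K" "keys f \<subseteq> K"
  shows "linearize g f = (\<Sum>a\<in>K. single (g a) (lookup f a))"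
  unfolding linearize_def
  by (rule sum.mono_neutral_left) (use assms in \<open>auto simp: in_keys_iff\<close>)

lemma linearize_add: "linearize g (f + h) = linearize g f + linearize g h"
proof -
  let ?K = "keys f \<union> keys h"
  have "keys (f + h) \<subseteq> ?K" by (rule Poly_Mapping.keys_add)
  then show ?thesis
    by (simp add: linearize_eq_sum[where K = ?K] lookup_add single_add sum.distrib)
qed

lemma linearize_smul: "linearize g (smul c f) = smul c (linearize g f)"
proof -
  have "keys (smul c f) \<subseteq> keys f" by (auto simp: in_keys_iff)
  moreover have "smul c (\<Sum>a\<in>keys f. single (g a) (lookup f a)) =
      (\<Sum>a\<in>keys f. smul c (single (g a) (lookup f a)))"
    by (rule pm.scale_sum_right)
  ultimately show ?thesis
    by (simp add: linearize_eq_sum[where K = "keys f"])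
qed

lemma linearize_zero [simp]: "linearize g 0 = 0"
  by (simp add: linearize_def)

lemma linearize_single [simp]: "linearize g (single a c) = single (g a) c"
  by (simp add: linearize_eq_sum[where K = "{a}"])

lemma linearize_sum: "linearize g (sum F A) = (\<Sum>x\<in>A. linearize g (F x))"
  by (induction A rule: infinite_finite_induct) (simp_all add: linearize_add)

lemma sum_single_keys: "(\<Sum>a\<in>keys f. single a (lookup f a)) = f"
  by (rule poly_mapping_eqI)
     (auto simp: lookup_sum lookup_single when_def in_keys_iff sum.delta)

lemma linearize_id: "linearize id f = f" "linearize (\<lambda>x. x) f = f"
  by (simp_all add: linearize_def sum_single_keys)

lemma linearize_comp: "linearize g (linearize h f) = linearize (g \<circ> h) f"
  unfolding linearize_def[of h f] linearize_def[of "g \<circ> h" f] by (simp add: linearize_sum)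

lemma keys_sum_subset: "(\<And>x. x \<in> A \<Longrightarrow> keys (F x) \<subseteq> B) \<Longrightarrow> keys (sum F A) \<subseteq> B"
  by (induction A rule: infinite_finite_induct) (use Poly_Mapping.keys_add in fastforce)+

lemma keys_linearize: "keys (linearize g f) \<subseteq> g ` keys f"
  unfolding linearize_def by (rule keys_sum_subset) (auto split: if_splits)

text \<open>Injectivity is asked on a set \<open>B\<close> around the support only: the passage from
  a tabloid to its second row is injective on tabloids but not on all lists.\<close>

lemma lookup_linearize:
  assumes "inj_on g B" "keys f \<subseteq> B" "b \<in> B"
  shows "lookup (linearize g f) (g b) = lookup f b"
proof -
  have "lookup (linearize g f) (g b) = (\<Sum>a\<in>keys f. if a = b then lookup f a else 0)"
    unfolding linearize_def lookup_sum lookup_single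
    by (rule sum.cong) (use assms in \<open>auto simp: when_def dest: inj_onD\<close>)
  also have "\<dots> = lookup f b" by (simp add: sum.delta in_keys_iff)
  finally show ?thesis .
qed

lemma lookup_linearize_bij:
  assumes "bij g"
  shows "lookup (linearize g f) b = lookup f (inv g b)"
  using lookup_linearize[of g UNIV f "inv g b"] assms
  by (simp add: bij_is_inj surj_f_inv_f[OF bij_is_surj])

lemma bij_image: "bij f \<Longrightarrow> bij (image f)"
  by (rule o_bij[of "image (inv f)"])
     (auto simp: fun_eq_iff image_image bij_is_inj surj_f_inv_f[OF bij_is_surj])

lemma inv_image_eq: "bij f \<Longrightarrow> inv (image f) = image (inv f)"
  by (rule inv_equality) (auto simp: image_image bij_is_inj surj_f_inv_f[OF bij_is_surj])

lemma lookup_linearize_image: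
  "bij \<pi> \<Longrightarrow> lookup (linearize (image \<pi>) f) A = lookup f (inv \<pi> ` A)"
  by (simp add: lookup_linearize_bij bij_image inv_image_eq)

section \<open>Modules and homomorphisms\<close>

definition hom :: "nat \<Rightarrow> ('v::ab_group_add) rep \<Rightarrow> ('w::ab_group_add) rep \<Rightarrow> ('v \<Rightarrow> 'w) \<Rightarrow> bool" where
  "hom n V W f \<longleftrightarrow> linear_map V W f \<and> equivariant n V W f"

lemma homI:
  assumes "\<And>x. x \<in> space V \<Longrightarrow> f x \<in> space W"
    and "\<And>x y. x \<in> space V \<Longrightarrow> y \<in> space V \<Longrightarrow> f (x + y) = f x + f y"
    and "\<And>c x. x \<in> space V \<Longrightarrow> f (scale V c x) = scale W c (f x)"
    and "\<And>\<pi> x. \<pi> permutes {1..n} \<Longrightarrow> x \<in> space V \<Longrightarrow> f (action V \<pi> x) = action W \<pi> (f x)"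
  shows "hom n V W f"
  using assms by (simp add: hom_def linear_map_def equivariant_def)

lemma homD:
  assumes "hom n V W f"
  shows "x \<in> space V \<Longrightarrow> f x \<in> space W"
    and "x \<in> space V \<Longrightarrow> y \<in> space V \<Longrightarrow> f (x + y) = f x + f y"
    and "x \<in> space V \<Longrightarrow> f (scale V c x) = scale W c (f x)"
    and "\<pi> permutes {1..n} \<Longrightarrow> x \<in> space V \<Longrightarrow> f (action V \<pi> x) = action W \<pi> (f x)"
  using assms by (auto simp: hom_def linear_map_def equivariant_def)

lemma isomorphic_iff_hom: "isomorphic n V W \<longleftrightarrow> (\<exists>f. hom n V W f \<and> bij_betw f (space V) (space W))"
  by (auto simp: isomorphic_def hom_def)

lemma hom_comp: "hom n U V f \<Longrightarrow> hom n V W g \<Longrightarrow> hom n U W (g \<circ> f)"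
  by (rule homI) (simp_all add: homD)

lemma Sn_moduleD:
  assumes "Sn_module n V"
  shows "vector_space (scale V)"
    and "x \<in> space V \<Longrightarrow> y \<in> space V \<Longrightarrow> x + y \<in> space V"
    and "x \<in> space V \<Longrightarrow> scale V c x \<in> space V"
    and "0 \<in> space V"
    and "\<pi> permutes {1..n} \<Longrightarrow> x \<in> space V \<Longrightarrow> action V \<pi> x \<in> space V"
    and "\<pi> permutes {1..n} \<Longrightarrow> action V \<pi> 0 = 0"
    and "scale V c 0 = 0"
proof -
  interpret vector_space "scale V" using assms by (simp add: Sn_module_def)
  have sub: "subspace (space V)" using assms by (simp add: Sn_module_def)
  show "vector_space (scale V)" by unfold_locales
  show "x \<in> space V \<Longrightarrow> y \<in> space V \<Longrightarrow> x + y \<in> space V" by (rule subspace_add[OF sub])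
  show "x \<in> space V \<Longrightarrow> scale V c x \<in> space V" by (rule subspace_scale[OF sub])
  show 0: "0 \<in> space V" by (rule subspace_0[OF sub])
  show "\<pi> permutes {1..n} \<Longrightarrow> x \<in> space V \<Longrightarrow> action V \<pi> x \<in> space V"
    using assms by (simp add: Sn_module_def linear_map_def)
  show "action V \<pi> 0 = 0" if "\<pi> permutes {1..n}"
  proof -
    have "action V \<pi> (0 + 0) = action V \<pi> 0 + action V \<pi> 0"
      using assms that 0 unfolding Sn_module_def linear_map_def by blast
    then show ?thesis by simp
  qed
  show "scale V c 0 = 0" by (rule scale_zero_right)
qed

text \<open>Each identity is pulled back along \<open>f\<close> to one in \<open>V\<close>, so
  module axioms are used for \<open>V\<close> alone; \<open>W\<close> will often be a
  \<open>direct_sum\<close>, for which they are not established.\<close>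

lemma hom_inverse:
  assumes "Sn_module n V" "hom n V W f" "bij_betw f (space V) (space W)"
  shows "hom n W V (inv_into (space V) f)" (is "hom n W V ?g")
proof -
  have g: "?g y \<in> space V" "f (?g y) = y" if "y \<in> space W" for y
    using that assms(3) by (metis bij_betw_def inv_into_into, metis bij_betw_inv_into_right)
  have gf: "?g (f x) = x" if "x \<in> space V" for x
    using that assms(3) by (metis bij_betw_inv_into_left)
  show ?thesis
  proof (rule homI)
    fix x assume "x \<in> space W"
    then show "?g x \<in> space V" by (rule g)
  next
    fix x y assume x: "x \<in> space W" and y: "y \<in> space W"
    have "?g (f (?g x + ?g y)) = ?g x + ?g y"
      by (intro gf Sn_moduleD(2)[OF assms(1)] g x y)
    then show "?g (x + y) = ?g x + ?g y" by (simp add: homD[OF assms(2)] g x y)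
  next
    fix c x assume x: "x \<in> space W"
    have "?g (f (scale V c (?g x))) = scale V c (?g x)"
      by (intro gf Sn_moduleD(3)[OF assms(1)] g x)
    then show "?g (scale W c x) = scale V c (?g x)" by (simp add: homD[OF assms(2)] g x)
  next
    fix \<pi> x assume x: "x \<in> space W" and \<pi>: "\<pi> permutes {1..n}"
    have "?g (f (action V \<pi> (?g x))) = action V \<pi> (?g x)"
      by (intro gf Sn_moduleD(5)[OF assms(1)] g x \<pi>)
    then show "?g (action W \<pi> x) = action V \<pi> (?g x)" by (simp add: homD(4)[OF assms(2) \<pi>] g x)
  qed
qed

lemma isomorphic_sym: "Sn_module n V \<Longrightarrow> isomorphic n V W \<Longrightarrow> isomorphic n W V"
  unfolding isomorphic_iff_hom by (elim exE conjE) (intro exI conjI, rule hom_inverse, assumption+, rule bij_betw_inv_into)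

lemma hom_zero:
  assumes "Sn_module n V" "hom n V W f"
  shows "f 0 = 0"
  using homD(2)[OF assms(2), of 0 0] Sn_moduleD(4)[OF assms(1)] by simp

lemma sub_rep_simps [simp]:
  "space (sub_rep V U) = U" "scale (sub_rep V U) = scale V" "action (sub_rep V U) = action V"
  by (simp_all add: sub_rep_def)

lemma Sn_module_sub_rep:
  assumes "Sn_module n V" "submodule n V U"
  shows "Sn_module n (sub_rep V U)"
  using assms unfolding Sn_module_def submodule_def linear_map_def by (auto simp: subset_iff)

lemma hom_into_sub_rep: "hom n V (sub_rep W X) f \<Longrightarrow> X \<subseteq> space W \<Longrightarrow> hom n V W f"
  by (rule homI) (auto simp: subset_iff hom_def linear_map_def equivariant_def)

lemma hom_onto_sub_rep: "hom n V W f \<Longrightarrow> f ` space V \<subseteq> X \<Longrightarrow> hom n V (sub_rep W X) f"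
  by (rule homI) (auto simp: image_subset_iff hom_def linear_map_def equivariant_def)

lemma hom_from_sub_rep: "hom n V W f \<Longrightarrow> U \<subseteq> space V \<Longrightarrow> hom n (sub_rep V U) W f"
  by (rule homI) (auto simp: subset_iff hom_def linear_map_def equivariant_def)

section \<open>Direct sums\<close>

lemma direct_sum_simps:
  "space (direct_sum I S) = {f. keys f \<subseteq> I \<and> (\<forall>i\<in>I. lookup f i \<in> space (S i))}"
  "scale (direct_sum I S) c = Poly_Mapping.mapp (\<lambda>i. scale (S i) c)"
  "action (direct_sum I S) \<pi> = Poly_Mapping.mapp (\<lambda>i. action (S i) \<pi>)"
  by (simp_all add: direct_sum_def)

text \<open>Criterion for an internal direct sum. The summands enter through maps
  \<open>\<theta> i\<close> and may live in another type, so that both submodules of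
  \<open>LP k n\<close> and Specht modules can serve.\<close>

lemma isomorphic_direct_sumI:
  fixes V :: "('v::ab_group_add) rep" and S :: "'i \<Rightarrow> ('w::ab_group_add) rep"
  assumes I: "finite I" and V: "Sn_module n V" and S: "\<And>i. i \<in> I \<Longrightarrow> Sn_module n (S i)"
    and hom: "\<And>i. i \<in> I \<Longrightarrow> hom n (S i) V (\<theta> i)"
    and indep: "\<And>x i. (\<And>i. i \<in> I \<Longrightarrow> x i \<in> space (S i)) \<Longrightarrow> (\<Sum>i\<in>I. \<theta> i (x i)) = 0 \<Longrightarrow> i \<in> I \<Longrightarrow> x i = 0"
    and span: "\<And>v. v \<in> space V \<Longrightarrow> \<exists>x. (\<forall>i\<in>I. x i \<in> space (S i)) \<and> v = (\<Sum>i\<in>I. \<theta> i (x i))"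
  shows "isomorphic n V (direct_sum I S)"
proof -
  let ?D = "direct_sum I S"
  define F where "F x = (\<Sum>i\<in>I. \<theta> i (lookup x i))" for x
  have D: "lookup x i \<in> space (S i)" if "x \<in> space ?D" "i \<in> I" for x i
    using that by (simp add: direct_sum_simps)
  have D0: "lookup x i = 0" if "x \<in> space ?D" "i \<notin> I" for x i
    using that by (auto simp: direct_sum_simps in_keys_iff)
  \<comment> \<open>\<open>mapp\<close> applies the function on the support only; off the support
    the values agree because scaling (and likewise the action) fixes 0.\<close>
  have Dsc: "lookup (scale ?D c x) i = scale (S i) c (lookup x i)" if "i \<in> I" for c x i
    using Sn_moduleD(7)[OF S[OF that]] by (auto simp: direct_sum_simps lookup_mapp when_def in_keys_iff)
  have Dact: "lookup (action ?D \<pi> x) i = action (S i) \<pi> (lookup x i)" if "i \<in> I" "\<pi> permutes {1..n}" for \<pi> x i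
    using Sn_moduleD(6)[OF S[OF that(1)] that(2)]
    by (auto simp: direct_sum_simps lookup_mapp when_def in_keys_iff)
  have Dadd: "x + y \<in> space ?D" if "x \<in> space ?D" "y \<in> space ?D" for x y
    using that Poly_Mapping.keys_add[of x y] Sn_moduleD(2)[OF S]
    by (auto simp: direct_sum_simps lookup_add)
  have Dscale: "scale ?D c x \<in> space ?D" if "x \<in> space ?D" for c x
  proof -
    have "keys (scale ?D c x) \<subseteq> I"
      using that keys_mapp_subset[of "\<lambda>i. scale (S i) c" x] by (auto simp: direct_sum_simps)
    moreover have "\<forall>i\<in>I. lookup (scale ?D c x) i \<in> space (S i)"
      using Dsc D[OF that] Sn_moduleD(3)[OF S] by auto
    ultimately show ?thesis by (simp add: direct_sum_simps(1))
  qed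
  have Daction: "action ?D \<pi> x \<in> space ?D" if "x \<in> space ?D" "\<pi> permutes {1..n}" for \<pi> x
  proof -
    have "keys (action ?D \<pi> x) \<subseteq> I"
      using that keys_mapp_subset[of "\<lambda>i. action (S i) \<pi>" x] by (auto simp: direct_sum_simps)
    moreover have "\<forall>i\<in>I. lookup (action ?D \<pi> x) i \<in> space (S i)"
      using Dact D[OF that(1)] that(2) Sn_moduleD(5)[OF S] by auto
    ultimately show ?thesis by (simp add: direct_sum_simps(1))
  qed
  interpret V: vector_space "scale V" by (rule Sn_moduleD(1)[OF V])
  have Vsub: "V.subspace (space V)" using V by (simp add: Sn_module_def)
  have act_sum: "action V \<pi> (\<Sum>i\<in>J. g i) = (\<Sum>i\<in>J. action V \<pi> (g i))"
    if "\<pi> permutes {1..n}" "finite J" "\<And>i. i \<in> J \<Longrightarrow> g i \<in> space V" for \<pi> g J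
    using that(2,3)
  proof (induction J rule: finite_induct)
    case empty
    show ?case using Sn_moduleD(6)[OF V that(1)] by simp
  next
    case (insert i J)
    have "sum g J \<in> space V" using insert by (intro V.subspace_sum[OF Vsub]) auto
    moreover have "\<forall>x\<in>space V. \<forall>y\<in>space V. action V \<pi> (x + y) = action V \<pi> x + action V \<pi> y"
      using V that(1) by (simp add: Sn_module_def linear_map_def)
    ultimately show ?case using insert by simp
  qed
  have F: "hom n ?D V F"
  proof (rule homI)
    fix x assume x: "x \<in> space ?D"
    show "F x \<in> space V" unfolding F_def
      by (intro V.subspace_sum[OF Vsub] homD(1)[OF hom] D[OF x])
    show "F (scale ?D c x) = scale V c (F x)" for c
      by (simp add: F_def V.scale_sum_right Dsc homD(3)[OF hom] D[OF x])
    show "F (action ?D \<pi> x) = action V \<pi> (F x)" if \<pi>: "\<pi> permutes {1..n}" for \<pi>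
    proof -
      have "F (action ?D \<pi> x) = (\<Sum>i\<in>I. action V \<pi> (\<theta> i (lookup x i)))"
        unfolding F_def by (rule sum.cong) (simp_all add: Dact[OF _ \<pi>] homD(4)[OF hom \<pi> D[OF x]])
      also have "\<dots> = action V \<pi> (F x)"
        unfolding F_def by (rule act_sum[symmetric, OF \<pi> I homD(1)[OF hom D[OF x]]])
      finally show ?thesis .
    qed
  next
    fix x y assume "x \<in> space ?D" "y \<in> space ?D"
    then show "F (x + y) = F x + F y"
      by (simp add: F_def lookup_add homD(2)[OF hom] D sum.distrib)
  qed
  \<comment> \<open>\<open>hom\<close> speaks of sums and scalings only; differences are reached by
    reading a negative as scaling by -1.\<close>
  have neg: "- w = scale (S i) (-1) w" if "i \<in> I" for i w
  proof -
    interpret S: vector_space "scale (S i)" by (rule Sn_moduleD(1)[OF S[OF that]])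
    show ?thesis by simp
  qed
  have "bij_betw F (space ?D) (space V)"
    unfolding bij_betw_def
  proof
    show "inj_on F (space ?D)"
    proof (rule inj_onI)
      fix x y assume x: "x \<in> space ?D" and y: "y \<in> space ?D" and eq: "F x = F y"
      have min: "\<theta> i (lookup x i - lookup y i) = \<theta> i (lookup x i) - \<theta> i (lookup y i)"
        and sp: "lookup x i - lookup y i \<in> space (S i)" if "i \<in> I" for i
      proof -
        have sy: "- lookup y i \<in> space (S i)"
          unfolding neg[OF that] by (intro Sn_moduleD(3)[OF S] D y that)
        then show "lookup x i - lookup y i \<in> space (S i)"
          using Sn_moduleD(2)[OF S[OF that] D[OF x that]] by (metis diff_conv_add_uminus)
        have "\<theta> i (- lookup y i) = - \<theta> i (lookup y i)"
          unfolding neg[OF that] using homD(3)[OF hom[OF that] D[OF y that]] by simp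
        then show "\<theta> i (lookup x i - lookup y i) = \<theta> i (lookup x i) - \<theta> i (lookup y i)"
          using homD(2)[OF hom[OF that] D[OF x that] sy] by simp
      qed
      have "(\<Sum>i\<in>I. \<theta> i (lookup x i - lookup y i)) = 0"
        using eq by (simp add: min sum_subtractf F_def)
      then have "lookup x i = lookup y i" if "i \<in> I" for i
        using indep[of "\<lambda>i. lookup x i - lookup y i", OF sp _ that] by simp
      then show "x = y" using D0[OF x] D0[OF y] by (metis poly_mapping_eqI)
    qed
    show "F ` space ?D = space V"
    proof
      show "F ` space ?D \<subseteq> space V" using homD(1)[OF F] by auto
      show "space V \<subseteq> F ` space ?D"
      proof
        fix v assume "v \<in> space V"
        then obtain x where x: "\<And>i. i \<in> I \<Longrightarrow> x i \<in> space (S i)" "v = (\<Sum>i\<in>I. \<theta> i (x i))"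
          using span by blast
        define X where "X = (\<Sum>i\<in>I. single i (x i))"
        have lX: "lookup X i = (if i \<in> I then x i else 0)" for i
          using I by (simp add: X_def lookup_sum lookup_single when_def sum.delta')
        have "X \<in> space ?D"
          using x(1) by (auto simp: direct_sum_simps lX in_keys_iff split: if_splits)
        moreover have "F X = v" by (simp add: F_def x(2) lX)
        ultimately show "v \<in> F ` space ?D" by blast
      qed
    qed
  qed
  with F have inv: "hom n ?D V F" "bij_betw F (space ?D) (space V)" by auto
  \<comment> \<open>\<open>hom_inverse\<close> would ask for the module axioms of \<open>?D\<close>;
    the closure facts \<open>Dadd\<close>, \<open>Dscale\<close> and \<open>Daction\<close> take
    their place.\<close>
  let ?g = "inv_into (space ?D) F"
  have g: "?g y \<in> space ?D" "F (?g y) = y" if "y \<in> space V" for y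
    using that inv(2) by (metis bij_betw_def inv_into_into, metis bij_betw_inv_into_right)
  have gF: "?g (F x) = x" if "x \<in> space ?D" for x
    using that inv(2) by (metis bij_betw_inv_into_left)
  have "hom n V ?D ?g"
  proof (rule homI)
    fix x assume "x \<in> space V"
    then show "?g x \<in> space ?D" by (rule g)
  next
    fix x y assume x: "x \<in> space V" and y: "y \<in> space V"
    have "?g (F (?g x + ?g y)) = ?g x + ?g y" by (intro gF Dadd g x y)
    then show "?g (x + y) = ?g x + ?g y" by (simp add: homD[OF F] g x y)
  next
    fix c x assume x: "x \<in> space V"
    have "?g (F (scale ?D c (?g x))) = scale ?D c (?g x)" by (intro gF Dscale g x)
    then show "?g (scale V c x) = scale ?D c (?g x)" by (simp add: homD[OF F] g x)
  next
    fix \<pi> x assume x: "x \<in> space V" and \<pi>: "\<pi> permutes {1..n}"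
    have "?g (F (action ?D \<pi> (?g x))) = action ?D \<pi> (?g x)" by (intro gF Daction g x \<pi>)
    then show "?g (action V \<pi> x) = action ?D \<pi> (?g x)" by (simp add: homD(4)[OF F \<pi>] g x)
  qed
  then show ?thesis
    unfolding isomorphic_iff_hom using bij_betw_inv_into[OF inv(2)] by blast
qed

text \<open>This is \<open>g\<close> composed with the inclusion of the summand \<open>i\<close>;
  \<open>Z\<close> is needed because the other coordinates of \<open>single i x\<close> are
  0.\<close>

lemma hom_component:
  assumes S: "Sn_module n (S i)" and i: "i \<in> I" and Z: "\<And>j. j \<in> I \<Longrightarrow> 0 \<in> space (S j)"
    and g: "hom n (direct_sum I S) V g"
  shows "hom n (S i) V (\<lambda>x. g (single i x))"
proof -
  have sp: "single i x \<in> space (direct_sum I S)" if "x \<in> space (S i)" for x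
    using that i Z by (auto simp: direct_sum_simps lookup_single when_def split: if_splits)
  have sc: "single i (scale (S i) c x) = scale (direct_sum I S) c (single i x)" for c x
    using Sn_moduleD(7)[OF S]
    by (intro poly_mapping_eqI) (auto simp: direct_sum_simps lookup_mapp lookup_single when_def)
  have ac: "single i (action (S i) \<pi> x) = action (direct_sum I S) \<pi> (single i x)"
    if "\<pi> permutes {1..n}" for \<pi> x
    using Sn_moduleD(6)[OF S that]
    by (intro poly_mapping_eqI) (auto simp: direct_sum_simps lookup_mapp lookup_single when_def)
  show ?thesis
    by (rule homI) (simp_all add: homD(1-3)[OF g] homD(4)[OF g, symmetric] sp sc ac single_add)
qed

section \<open>Permutation modules\<close>

lemma free_rep_simps:
  "space (free_rep B act) = {f. keys f \<subseteq> B}"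
  "scale (free_rep B act) = smul"
  "action (free_rep B act) \<pi> = linearize (act \<pi>)"
  by (simp_all add: free_rep_def)

lemma Sn_module_free_rep:
  assumes "\<And>\<pi>. \<pi> permutes {1..n} \<Longrightarrow> act \<pi> ` B \<subseteq> B" "act id = id"
    "\<And>\<pi> \<sigma>. act (\<pi> \<circ> \<sigma>) = act \<pi> \<circ> act \<sigma>"
  shows "Sn_module n (free_rep B act)"
proof -
  have "keys (x + y) \<subseteq> B" if "keys x \<subseteq> B" "keys y \<subseteq> B" for x y :: "'a \<Rightarrow>\<^sub>0 rat"
    using that Poly_Mapping.keys_add[of x y] by blast
  moreover have "keys (smul c x) \<subseteq> B" if "keys x \<subseteq> B" for c and x :: "'a \<Rightarrow>\<^sub>0 rat"
    using that by (auto simp: in_keys_iff)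
  ultimately have sub: "pm.subspace {f. keys f \<subseteq> B}" by (auto simp: pm.subspace_def)
  have "keys (linearize (act \<pi>) x) \<subseteq> B" if "\<pi> permutes {1..n}" "keys x \<subseteq> B" for \<pi> x
    using keys_linearize[of "act \<pi>" x] assms(1)[OF that(1)] that(2) by blast
  then show ?thesis
    unfolding Sn_module_def linear_map_def free_rep_simps
    by (simp add: sub pm.vector_space_axioms linearize_add linearize_smul linearize_comp assms(2,3) linearize_id)
qed

lemma orbit_span_submodule:
  assumes V: "Sn_module n V" and Y: "Y \<subseteq> space V"
  shows "submodule n V (orbit_span n V Y)"
proof -
  interpret V: vector_space "scale V" by (rule Sn_moduleD(1)[OF V])
  have Vsub: "V.subspace (space V)" using V by (simp add: Sn_module_def)
  let ?G = "{action V \<pi> y | \<pi> y. \<pi> permutes {1..n} \<and> y \<in> Y}"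
  have G: "?G \<subseteq> space V" using Sn_moduleD(5)[OF V] Y by auto
  have sp: "V.span ?G \<subseteq> space V" by (rule V.span_minimal[OF G Vsub])
  \<comment> \<open>Membership in \<open>space V\<close> is carried through the induction because
    the action is additive there only.\<close>
  have "x \<in> space V \<and> action V \<pi> x \<in> V.span ?G"
    if \<pi>: "\<pi> permutes {1..n}" and x: "x \<in> V.span ?G" for \<pi> x
    using x
  proof (induction rule: V.span_induct_alt)
    case base
    show ?case by (simp add: Sn_moduleD(4)[OF V] Sn_moduleD(6)[OF V \<pi>] V.span_zero)
  next
    case (step c x y)
    then obtain \<sigma> z where z: "x = action V \<sigma> z" "\<sigma> permutes {1..n}" "z \<in> Y" by blast
    have "action V \<pi> x = action V (\<pi> \<circ> \<sigma>) z"
      using V \<pi> z Y unfolding Sn_module_def by (metis subsetD)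
    moreover have "\<pi> \<circ> \<sigma> permutes {1..n}" using permutes_compose \<pi> z by blast
    ultimately have "action V \<pi> x \<in> V.span ?G" using z(3) by (intro V.span_base) blast
    moreover have "action V \<pi> (scale V c x + y) = scale V c (action V \<pi> x) + action V \<pi> y"
    proof -
      have x: "x \<in> space V" using step G by blast
      moreover have "y \<in> space V" using step by blast
      moreover have "linear_map V V (action V \<pi>)" using V \<pi> by (simp add: Sn_module_def)
      ultimately show ?thesis
        using Sn_moduleD(3)[OF V x] by (simp add: linear_map_def)
    qed
    moreover have "scale V c x + y \<in> space V"
      using step G by (intro Sn_moduleD(2,3)[OF V]) auto
    ultimately show ?case using step by (simp add: V.span_add V.span_scale)
  qed
  then show ?thesis
    using sp unfolding submodule_def orbit_span_def by (auto simp: V.subspace_span)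
qed

section \<open>Matchings and their alternating vectors\<close>

text \<open>The \<open>a\<close> disjoint pairs \<open>{p j, q j}\<close> with \<open>j < a\<close>; only these values of \<open>p\<close> and \<open>q\<close> matter.\<close>

definition matching :: "nat \<Rightarrow> nat \<Rightarrow> (nat \<Rightarrow> nat) \<Rightarrow> (nat \<Rightarrow> nat) \<Rightarrow> bool" where
  "matching n a p q \<longleftrightarrow> inj_on p {..<a} \<and> inj_on q {..<a} \<and> p ` {..<a} \<inter> q ` {..<a} = {} \<and>
     p ` {..<a} \<union> q ` {..<a} \<subseteq> {1..n}"

definition singles :: "nat \<Rightarrow> nat \<Rightarrow> (nat \<Rightarrow> nat) \<Rightarrow> (nat \<Rightarrow> nat) \<Rightarrow> nat set" where
  "singles n a p q = {1..n} - (p ` {..<a} \<union> q ` {..<a})"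

text \<open>On \<open>a\<close>-subsets these are the coordinates of the polytabloid of shape
  \<open>(n - a, a)\<close> with columns \<open>p j\<close> over \<open>q j\<close>, a tabloid being
  read off by its second row.\<close>

definition matching_coeff :: "nat \<Rightarrow> (nat \<Rightarrow> nat) \<Rightarrow> (nat \<Rightarrow> nat) \<Rightarrow> nat set \<Rightarrow> rat" where
  "matching_coeff a p q A = (\<Prod>j<a. of_bool (q j \<in> A) - of_bool (p j \<in> A))"

definition matching_vector :: "nat \<Rightarrow> nat \<Rightarrow> nat \<Rightarrow> (nat \<Rightarrow> nat) \<Rightarrow> (nat \<Rightarrow> nat) \<Rightarrow> nat set \<Rightarrow>\<^sub>0 rat" where
  "matching_vector k n a p q = (\<Sum>A\<in>subsets_of_size k n. single A (matching_coeff a p q A))"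

text \<open>Formulated for an arbitrary module, so that homomorphisms can transport it from Specht
  modules to \<open>LP k n\<close>, where it cuts out at most a line.\<close>

definition matched :: "nat \<Rightarrow> ('v::ab_group_add) rep \<Rightarrow> nat \<Rightarrow> (nat \<Rightarrow> nat) \<Rightarrow> (nat \<Rightarrow> nat) \<Rightarrow> 'v \<Rightarrow> bool" where
  "matched n V a p q v \<longleftrightarrow> v \<in> space V \<and>
     (\<forall>j<a. action V (transpose (p j) (q j)) v = scale V (-1) v) \<and>
     (\<forall>x\<in>singles n a p q. \<forall>y\<in>singles n a p q. action V (transpose x y) v = v)"

lemma finite_subsets_of_size [simp]: "finite (subsets_of_size k n)"
  by (rule finite_subset[of _ "Pow {1..n}"]) (auto simp: subsets_of_size_def)

lemma subsets_of_size_finite: "A \<in> subsets_of_size k n \<Longrightarrow> finite A"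
  by (auto simp: subsets_of_size_def intro: finite_subset)

lemma image_subsets_of_size:
  assumes "\<pi> permutes {1..n}"
  shows "\<pi> ` A \<in> subsets_of_size k n \<longleftrightarrow> A \<in> subsets_of_size k n"
proof -
  have "\<pi> ` A \<subseteq> {1..n} \<longleftrightarrow> A \<subseteq> {1..n}"
    using permutes_in_image[OF assms] by (auto simp: image_subset_iff subset_iff)
  then show ?thesis
    using card_image[OF permutes_inj_on[OF assms, of A]] by (simp add: subsets_of_size_def)
qed

lemma bij_betw_image_subsets_of_size:
  assumes "\<pi> permutes {1..n}"
  shows "bij_betw (image \<pi>) (subsets_of_size k n) (subsets_of_size k n)"
proof (rule bij_betw_byWitness[where f' = "image (inv \<pi>)"])
  show "\<forall>A\<in>subsets_of_size k n. inv \<pi> ` \<pi> ` A = A" "\<forall>A\<in>subsets_of_size k n. \<pi> ` inv \<pi> ` A = A"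
    using permutes_inverses[OF assms] by (simp_all add: image_image)
  show "image \<pi> ` subsets_of_size k n \<subseteq> subsets_of_size k n"
    using image_subsets_of_size[OF assms] by auto
  show "image (inv \<pi>) ` subsets_of_size k n \<subseteq> subsets_of_size k n"
    using image_subsets_of_size[OF permutes_inv[OF assms]] by auto
qed

lemma LP_simps [simp]:
  "space (LP k n) = {f. keys f \<subseteq> subsets_of_size k n}"
  "scale (LP k n) = smul"
  "action (LP k n) \<pi> = linearize (image \<pi>)"
  by (simp_all add: LP_def free_rep_simps)

lemma Sn_module_LP: "Sn_module n (LP k n)"
  unfolding LP_def by (rule Sn_module_free_rep) (auto simp: image_subsets_of_size image_comp fun_eq_iff)

lemma matchingD:
  assumes "matching n a p q"
  shows "i < a \<Longrightarrow> j < a \<Longrightarrow> p i = p j \<longleftrightarrow> i = j"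
    and "i < a \<Longrightarrow> j < a \<Longrightarrow> q i = q j \<longleftrightarrow> i = j"
    and "i < a \<Longrightarrow> j < a \<Longrightarrow> p i \<noteq> q j" and "i < a \<Longrightarrow> j < a \<Longrightarrow> q i \<noteq> p j"
    and "i < a \<Longrightarrow> p i \<in> {1..n}" and "i < a \<Longrightarrow> q i \<in> {1..n}"
  using assms unfolding matching_def by (auto dest: inj_onD)

lemma singlesD:
  assumes "x \<in> singles n a p q"
  shows "x \<in> {1..n}" "i < a \<Longrightarrow> p i \<noteq> x" "i < a \<Longrightarrow> q i \<noteq> x" "i < a \<Longrightarrow> x \<noteq> p i" "i < a \<Longrightarrow> x \<noteq> q i"
  using assms unfolding singles_def by auto

section \<open>The action of the symmetric group on matchings\<close>

lemma matching_permute: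
  assumes "matching n a p q" "\<pi> permutes {1..n}"
  shows "matching n a (\<pi> \<circ> p) (\<pi> \<circ> q)"
proof -
  have inj: "inj \<pi>" by (rule permutes_inj[OF assms(2)])
  show ?thesis
    using assms(1) permutes_in_image[OF assms(2)] unfolding matching_def image_comp[symmetric]
    by (auto simp: comp_inj_on inj_on_subset[OF inj] inj_eq[OF inj])
qed

text \<open>The complements of the two images have equally many points, so any bijection between
  them completes the partial map to a permutation.\<close>

lemma permutation_transitive:
  assumes "finite S" "inj_on f I" "inj_on g I" "f ` I \<subseteq> S" "g ` I \<subseteq> S"
  shows "\<exists>\<pi>. \<pi> permutes S \<and> (\<forall>i\<in>I. \<pi> (f i) = g i)"
proof -
  have fin: "finite (f ` I)" "finite (g ` I)" using assms finite_subset by auto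
  have "card (f ` I) = card (g ` I)" using assms by (simp add: card_image)
  then have "card (S - f ` I) = card (S - g ` I)" using assms fin by (simp add: card_Diff_subset)
  then obtain h where h: "bij_betw h (S - f ` I) (S - g ` I)"
    using finite_same_card_bij[of "S - f ` I" "S - g ` I"] assms(1) by auto
  let ?\<phi> = "\<lambda>x. if x \<in> f ` I then g (inv_into I f x) else h x"
  have "bij_betw (g \<circ> inv_into I f) (f ` I) (g ` I)"
    using bij_betw_trans[OF bij_betw_inv_into[OF inj_on_imp_bij_betw[OF assms(2)]] inj_on_imp_bij_betw[OF assms(3)]] .
  then have "bij_betw (\<lambda>x. if x \<in> f ` I then (g \<circ> inv_into I f) x else h x)
      (f ` I \<union> (S - f ` I)) (g ` I \<union> (S - g ` I))"
    by (rule bij_betw_disjoint_Un[OF _ h]) auto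
  then have b: "bij_betw ?\<phi> S S"
    using assms by (simp only: Un_Diff_cancel Un_absorb1 comp_def)
  define \<pi> where "\<pi> x = (if x \<in> S then ?\<phi> x else x)" for x
  have "bij_betw \<pi> S S" using b by (rule bij_betw_cong[THEN iffD1, rotated]) (simp add: \<pi>_def)
  then have "\<pi> permutes S" by (rule bij_imp_permutes) (simp add: \<pi>_def)
  moreover have "\<pi> (f i) = g i" if "i \<in> I" for i
    using that assms by (auto simp: \<pi>_def)
  ultimately show ?thesis by blast
qed

text \<open>Indexing points by pair number and side turns each matching into a single injection, to
  which \<open>permutation_transitive\<close> applies.\<close>

lemma matching_transitive:
  assumes "matching n a p q" "matching n a p' q'"
  shows "\<exists>\<pi>. \<pi> permutes {1..n} \<and> (\<forall>j<a. \<pi> (p j) = p' j \<and> \<pi> (q j) = q' j)"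
proof -
  let ?I = "{..<a} \<times> (UNIV :: bool set)"
  let ?f = "\<lambda>p q (j, b). if b then p j else q j"
  have inj: "inj_on (?f p q) ?I" "?f p q ` ?I \<subseteq> {1..n}" if "matching n a p q" for p q :: "nat \<Rightarrow> nat"
    using matchingD[OF that] by (auto simp: inj_on_def)
  obtain \<pi> where \<pi>: "\<pi> permutes {1..n}" "\<And>i. i \<in> ?I \<Longrightarrow> \<pi> (?f p q i) = ?f p' q' i"
    using permutation_transitive[OF _ inj(1)[OF assms(1)] inj(1)[OF assms(2)] inj(2)[OF assms(1)] inj(2)[OF assms(2)]]
    by blast
  have "\<pi> (p j) = p' j \<and> \<pi> (q j) = q' j" if "j < a" for j
    using \<pi>(2)[of "(j, True)"] \<pi>(2)[of "(j, False)"] that by simp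
  then show ?thesis using \<pi>(1) by blast
qed

text \<open>One point of \<open>A\<close> chosen from each pair gives \<open>a\<close> distinct
  points. Read backwards, a set with fewer than \<open>a\<close> points misses a whole pair.\<close>

lemma matching_card_le:
  assumes m: "matching n a p q" and A: "finite A" "\<And>j. j < a \<Longrightarrow> p j \<in> A \<or> q j \<in> A"
  shows "a \<le> card A"
proof -
  let ?r = "\<lambda>j. if p j \<in> A then p j else q j"
  have "inj_on ?r {..<a}" "?r ` {..<a} \<subseteq> A"
    using matchingD(1-4)[OF m] A(2) by (fastforce simp: inj_on_def split: if_splits)+
  then show ?thesis using card_inj_on_le[of ?r "{..<a}" A] A(1) by simp
qed

section \<open>Supports and symmetries of matching vectors\<close>

definition transversal :: "nat \<Rightarrow> (nat \<Rightarrow> nat) \<Rightarrow> (nat \<Rightarrow> nat) \<Rightarrow> nat set \<Rightarrow> bool" where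
  "transversal a p q A \<longleftrightarrow> (\<forall>j<a. (p j \<in> A) \<noteq> (q j \<in> A))"

lemma matching_coeff_nz: "matching_coeff a p q A \<noteq> 0 \<longleftrightarrow> transversal a p q A"
  by (auto simp: matching_coeff_def transversal_def)

lemma matching_coeff_sq:
  assumes "transversal a p q A"
  shows "matching_coeff a p q A * matching_coeff a p q A = 1"
  unfolding matching_coeff_def prod.distrib[symmetric]
  by (rule prod.neutral) (use assms in \<open>auto simp: transversal_def\<close>)

lemma lookup_matching_vector:
  "lookup (matching_vector k n a p q) A = (if A \<in> subsets_of_size k n then matching_coeff a p q A else 0)"
  unfolding matching_vector_def by (simp add: lookup_sum lookup_single when_def sum.delta)

lemma matching_vector_in: "matching_vector k n a p q \<in> space (LP k n)"
  by (auto simp: in_keys_iff lookup_matching_vector split: if_splits)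

lemma matching_coeff_image: "bij \<pi> \<Longrightarrow> matching_coeff a (\<pi> \<circ> p) (\<pi> \<circ> q) (\<pi> ` A) = matching_coeff a p q A"
  by (simp add: matching_coeff_def inj_image_mem_iff bij_is_inj)

lemma action_matching_vector:
  assumes "\<pi> permutes {1..n}"
  shows "linearize (image \<pi>) (matching_vector k n a p q) = matching_vector k n a (\<pi> \<circ> p) (\<pi> \<circ> q)"
proof (rule poly_mapping_eqI)
  fix A
  have b: "bij \<pi>" by (rule permutes_bij[OF assms])
  have "matching_coeff a (\<pi> \<circ> p) (\<pi> \<circ> q) (\<pi> ` (inv \<pi> ` A)) = matching_coeff a p q (inv \<pi> ` A)"
    by (rule matching_coeff_image[OF b])
  moreover have "\<pi> ` (inv \<pi> ` A) = A"
    by (simp add: image_image permutes_inverses[OF assms])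
  moreover have "inv \<pi> ` A \<in> subsets_of_size k n \<longleftrightarrow> A \<in> subsets_of_size k n"
    by (rule image_subsets_of_size[OF permutes_inv[OF assms]])
  ultimately show "lookup (linearize (image \<pi>) (matching_vector k n a p q)) A =
      lookup (matching_vector k n a (\<pi> \<circ> p) (\<pi> \<circ> q)) A"
    by (simp add: lookup_linearize_image[OF b] lookup_matching_vector)
qed

text \<open>As the pairs are disjoint, only the factor of index \<open>j\<close> sees the swap, and
  its two terms trade places.\<close>

lemma matching_coeff_swap_pair:
  assumes m: "matching n a p q" and j: "j < a"
  shows "matching_coeff a p q (transpose (p j) (q j) ` A) = - matching_coeff a p q A"
proof -
  let ?t = "transpose (p j) (q j)"
  have mem: "x \<in> ?t ` A \<longleftrightarrow> ?t x \<in> A" for x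
    by (metis image_eqI imageE transpose_involutory)
  let ?c = "\<lambda>A i. of_bool (q i \<in> A) - of_bool (p i \<in> A) :: rat"
  have "?c (?t ` A) i = ?c A i" if "i < a" "i \<noteq> j" for i
    using that j matchingD[OF m] unfolding mem by simp
  then have "(\<Prod>i\<in>{..<a} - {j}. ?c (?t ` A) i) = (\<Prod>i\<in>{..<a} - {j}. ?c A i)"
    by (intro prod.cong) auto
  moreover have "?c (?t ` A) j = - ?c A j" unfolding mem by simp
  moreover have "matching_coeff a p q B = ?c B j * (\<Prod>i\<in>{..<a} - {j}. ?c B i)" for B
    unfolding matching_coeff_def using j by (intro prod.remove) auto
  ultimately show ?thesis by simp
qed

lemma matching_coeff_swap_singles:
  assumes "x \<in> singles n a p q" "y \<in> singles n a p q"
  shows "matching_coeff a p q (transpose x y ` A) = matching_coeff a p q A"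
proof -
  have mem: "z \<in> transpose x y ` A \<longleftrightarrow> transpose x y z \<in> A" for z
    by (metis image_eqI imageE transpose_involutory)
  show ?thesis
    unfolding matching_coeff_def mem by (rule prod.cong) (use singlesD[OF assms(1)] singlesD[OF assms(2)] in auto)
qed

lemma transpose_singles_permutes:
  "x \<in> singles n a p q \<Longrightarrow> y \<in> singles n a p q \<Longrightarrow> transpose x y permutes {1..n}"
  by (intro permutes_swap_id singlesD(1))

lemma transpose_pair_permutes: "matching n a p q \<Longrightarrow> j < a \<Longrightarrow> transpose (p j) (q j) permutes {1..n}"
  by (intro permutes_swap_id matchingD)

lemma lookup_linearize_transpose:
  "lookup (linearize (image (transpose x y)) f) A = lookup f (transpose x y ` A)"
  by (simp add: lookup_linearize_image)

lemma matched_matching_vector: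
  assumes m: "matching n a p q"
  shows "matched n (LP k n) a p q (matching_vector k n a p q)"
proof -
  have "linearize (image (transpose (p j) (q j))) (matching_vector k n a p q) = smul (-1) (matching_vector k n a p q)"
    if "j < a" for j
    by (rule poly_mapping_eqI)
       (simp add: lookup_linearize_transpose lookup_matching_vector matching_coeff_swap_pair[OF m that]
          image_subsets_of_size[OF transpose_pair_permutes[OF m that]])
  moreover have "linearize (image (transpose x y)) (matching_vector k n a p q) = matching_vector k n a p q"
    if "x \<in> singles n a p q" "y \<in> singles n a p q" for x y
    by (rule poly_mapping_eqI)
       (simp add: lookup_linearize_transpose lookup_matching_vector matching_coeff_swap_singles[OF that]
          image_subsets_of_size[OF transpose_singles_permutes[OF that]])
  ultimately show ?thesis
    using matching_vector_in[of k n a p q] by (simp add: matched_def)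
qed

text \<open>Together with \<open>matched_LP\<close> this does the work of Schur's lemma: a
  homomorphism into \<open>LP k n\<close> sends a matched vector into a known line.\<close>

lemma matched_hom:
  assumes f: "hom n V W f" and m: "matching n a p q" and v: "matched n V a p q v"
  shows "matched n W a p q (f v)"
proof -
  have "v \<in> space V" using v by (simp add: matched_def)
  note f = homD[OF f] and v' = this
  have "action W (transpose (p j) (q j)) (f v) = scale W (-1) (f v)" if "j < a" for j
    using f(3)[OF v', of "-1"] f(4)[OF transpose_pair_permutes[OF m that] v'] v that by (simp add: matched_def)
  moreover have "action W (transpose x y) (f v) = f v" if "x \<in> singles n a p q" "y \<in> singles n a p q" for x y
    using f(4)[OF transpose_singles_permutes[OF that] v'] v that by (simp add: matched_def)
  ultimately show ?thesis using f(1)[OF v'] by (simp add: matched_def)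
qed

text \<open>The function \<open>A \<mapsto> g A * matching_coeff a p q A\<close> is invariant under the swaps that fix \<open>g\<close> up to
  sign, and these swaps act transitively on transversal sets.\<close>

lemma matched_LP_const:
  assumes m: "matching n a p q" and g: "matched n (LP k n) a p q g"
    and A: "A \<in> subsets_of_size k n" "transversal a p q A"
    and B: "B \<in> subsets_of_size k n" "transversal a p q B"
  shows "lookup g A * matching_coeff a p q A = lookup g B * matching_coeff a p q B"
  using A
proof (induction "card (A - B)" arbitrary: A rule: less_induct)
  case less
  have gp: "lookup g (transpose (p j) (q j) ` C) = - lookup g C" if "j < a" for j C
    using g that lookup_linearize_transpose[of "p j" "q j" g C] by (simp add: matched_def)
  have gs: "lookup g (transpose x y ` C) = lookup g C" if "x \<in> singles n a p q" "y \<in> singles n a p q" for x y C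
    using g that lookup_linearize_transpose[of x y g C] by (simp add: matched_def)
  have fin: "finite A" "finite B" using subsets_of_size_finite less.prems(1) B(1) by auto
  have card: "card A = card B" and sub: "A \<subseteq> {1..n}" "B \<subseteq> {1..n}"
    using less.prems(1) B(1) by (auto simp: subsets_of_size_def)
  \<comment> \<open>Exchanging a point of \<open>A - B\<close> for one of \<open>B - A\<close>
    brings \<open>A\<close> closer to \<open>B\<close>; \<open>s\<close> is the common sign by which
    \<open>g\<close> and the coefficient change, and it cancels in the product.\<close>
  have step: "lookup g A * matching_coeff a p q A = lookup g B * matching_coeff a p q B"
    if x: "x \<in> A - B" and y: "y \<in> B - A"
      and s: "s * s = 1" "lookup g (transpose x y ` A) = s * lookup g A"
        "matching_coeff a p q (transpose x y ` A) = s * matching_coeff a p q A" for x y s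
  proof -
    have "transpose x y ` A = insert y (A - {x})"
      using x y by (auto simp: in_transpose_image_iff transpose_def split: if_splits)
    then have "transpose x y ` A - B \<subset> A - B" using x y by auto
    then have lt: "card (transpose x y ` A - B) < card (A - B)" by (rule psubset_card_mono[rotated]) (use fin in simp)
    have "transpose x y permutes {1..n}" using x y sub by (intro permutes_swap_id) auto
    then have "transpose x y ` A \<in> subsets_of_size k n"
      using less.prems(1) by (simp add: image_subsets_of_size)
    moreover have "transversal a p q (transpose x y ` A)"
      using less.prems(2) s(1,3) by (auto simp: matching_coeff_nz[symmetric])
    ultimately have "s * lookup g A * (s * matching_coeff a p q A) = lookup g B * matching_coeff a p q B"
      using less.hyps[OF lt] s by simp
    moreover have "s * lookup g A * (s * matching_coeff a p q A) = (s * s) * (lookup g A * matching_coeff a p q A)"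
      by (simp add: algebra_simps)
    ultimately show ?thesis by (simp add: s(1))
  qed
  show ?case
  proof (cases "\<exists>j<a. (p j \<in> A) \<noteq> (p j \<in> B)")
    case True
    then obtain j where j: "j < a" "(p j \<in> A) \<noteq> (p j \<in> B)" by blast
    have tr: "(p j \<in> A) \<noteq> (q j \<in> A)" "(p j \<in> B) \<noteq> (q j \<in> B)"
      using less.prems(2) B(2) j(1) by (auto simp: transversal_def)
    show ?thesis
    proof (cases "p j \<in> A")
      case True
      then show ?thesis
        using tr j by (intro step[of "p j" "q j" "-1"]) (auto simp: gp matching_coeff_swap_pair[OF m])
    next
      case False
      then show ?thesis
        using tr j
        by (intro step[of "q j" "p j" "-1"]) (auto simp: gp matching_coeff_swap_pair[OF m] transpose_commute[of "q j"])
    qed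
  next
    \<comment> \<open>Agreement on all \<open>p j\<close> implies agreement on all
      \<open>q j\<close> by transversality, so the sets now differ in unmatched points only.\<close>
    case agree: False
    show ?thesis
    proof (cases "A = B")
      case False
      then obtain x y where x: "x \<in> A - B" and y: "y \<in> B - A"
        using card fin by (metis Diff_eq_empty_iff card_subset_eq ex_in_conv)
      have single: "z \<in> singles n a p q" if "z \<in> {1..n}" "(z \<in> A) \<noteq> (z \<in> B)" for z
        using that agree less.prems(2) B(2) by (auto simp: singles_def transversal_def)
      have "x \<in> singles n a p q" "y \<in> singles n a p q" using x y sub by (auto intro!: single)
      then show ?thesis
        using x y by (intro step[of x y 1]) (auto simp: gs matching_coeff_swap_singles)
    qed simp
  qed
qed

lemma matched_LP:
  assumes m: "matching n a p q" and g: "matched n (LP k n) a p q g"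
  shows "\<exists>c. g = smul c (matching_vector k n a p q)"
proof -
  \<comment> \<open>If a pair lies on one side of \<open>A\<close>, its swap fixes \<open>A\<close>
    and yet changes the sign of the value.\<close>
  have zero: "lookup g A = 0" if "\<not> transversal a p q A" for A
  proof -
    obtain j where j: "j < a" "(p j \<in> A) = (q j \<in> A)" using \<open>\<not> transversal a p q A\<close> by (auto simp: transversal_def)
    have "lookup g (transpose (p j) (q j) ` A) = - lookup g A"
      using g j(1) lookup_linearize_transpose[of "p j" "q j" g A] by (simp add: matched_def)
    then show ?thesis using j(2) by simp
  qed
  have out: "lookup g A = 0" if "A \<notin> subsets_of_size k n" for A
    using g that by (auto simp: matched_def in_keys_iff)
  show ?thesis
  proof (cases "\<exists>A\<in>subsets_of_size k n. transversal a p q A")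
    case True
    then obtain B where B: "B \<in> subsets_of_size k n" "transversal a p q B" by blast
    \<comment> \<open>The factor is the value of \<open>g\<close> at \<open>B\<close> divided by the
      coefficient there, which is 1 or -1 and hence its own inverse.\<close>
    have "g = smul (lookup g B * matching_coeff a p q B) (matching_vector k n a p q)"
    proof (rule poly_mapping_eqI)
      fix A
      show "lookup g A = lookup (smul (lookup g B * matching_coeff a p q B) (matching_vector k n a p q)) A"
      proof (cases "A \<in> subsets_of_size k n \<and> transversal a p q A")
        case True
        then show ?thesis
          using matched_LP_const[OF m g _ _ B, of A] matching_coeff_sq[of a p q A]
          by (simp add: lookup_matching_vector) (metis mult.assoc mult.right_neutral)
      next
        case False
        then show ?thesis
          using zero out matching_coeff_nz[of a p q A] by (auto simp: lookup_matching_vector)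
      qed
    qed
    then show ?thesis by blast
  next
    case False
    then have "g = smul 0 (matching_vector k n a p q)"
      using zero out by (intro poly_mapping_eqI) auto
    then show ?thesis by blast
  qed
qed

text \<open>Besides the \<open>a\<close> points \<open>q j\<close>, a further \<open>k - a\<close>
  points are needed from the \<open>n - 2a\<close> unmatched ones; \<open>a + k \<le> n\<close> says
  that there are enough.\<close>

lemma ex_transversal:
  assumes m: "matching n a p q" and "a \<le> k" "a + k \<le> n"
  shows "\<exists>E. E \<subseteq> singles n a p q \<and> q ` {..<a} \<union> E \<in> subsets_of_size k n"
proof -
  have "card (p ` {..<a} \<union> q ` {..<a}) = a + a"
    using m by (subst card_Un_disjoint) (auto simp: matching_def card_image)
  then have "card (singles n a p q) = n - (a + a)"
    unfolding singles_def using m by (subst card_Diff_subset) (auto simp: matching_def)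
  then have "k - a \<le> card (singles n a p q)" using assms(2,3) by simp
  then obtain E where E: "E \<subseteq> singles n a p q" "card E = k - a" "finite E"
    by (rule obtain_subset_with_card_n)
  have "card (q ` {..<a} \<union> E) = k"
    using E m assms(2) by (subst card_Un_disjoint) (auto simp: matching_def card_image singles_def)
  then show ?thesis using E m by (auto simp: subsets_of_size_def singles_def matching_def)
qed

lemma transversal_union:
  "matching n a p q \<Longrightarrow> E \<subseteq> singles n a p q \<Longrightarrow> matching_coeff a p q (q ` {..<a} \<union> E) = 1"
  unfolding matching_coeff_def by (rule prod.neutral) (auto simp: matching_def singles_def)

lemma matching_vector_nz:
  assumes m: "matching n a p q" and "a \<le> k" "a + k \<le> n"
  shows "matching_vector k n a p q \<noteq> 0"
proof -
  obtain E where E: "E \<subseteq> singles n a p q" "q ` {..<a} \<union> E \<in> subsets_of_size k n"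
    using ex_transversal[OF assms] by blast
  have "lookup (matching_vector k n a p q) (q ` {..<a} \<union> E) = 1"
    using E transversal_union[OF m E(1)] by (simp add: lookup_matching_vector)
  then show ?thesis by auto
qed

text \<open>A set in the support and its complement in \<open>{1..n}\<close> both meet every pair,
  so each has at least \<open>a\<close> points.\<close>

lemma matching_vector_nzD:
  assumes m: "matching n a p q" and nz: "matching_vector k n a p q \<noteq> 0"
  shows "a \<le> k" "a + k \<le> n"
proof -
  obtain A where "lookup (matching_vector k n a p q) A \<noteq> 0"
    using nz by (metis lookup_zero poly_mapping_eqI)
  then have A: "A \<subseteq> {1..n}" "card A = k" "transversal a p q A"
    by (auto simp: lookup_matching_vector subsets_of_size_def matching_coeff_nz split: if_splits)
  have fin: "finite A" using A(1) finite_subset by blast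
  show "a \<le> k"
    using matching_card_le[OF m fin] A(2,3) by (auto simp: transversal_def)
  have "a \<le> card ({1..n} - A)"
    using matching_card_le[OF m, of "{1..n} - A"] A(3) matchingD(5,6)[OF m] by (auto simp: transversal_def)
  moreover have "card ({1..n} - A) = n - k" using A fin by (simp add: card_Diff_subset)
  moreover have "k \<le> n" using A card_mono[OF _ A(1)] by simp
  ultimately show "a + k \<le> n" by simp
qed

lemma ex_matching:
  assumes "2 * a \<le> n"
  shows "\<exists>p q. matching n a p q"
proof -
  have "matching n a (\<lambda>j. j + 1) (\<lambda>j. j + 1 + a)"
    using assms by (auto simp: matching_def inj_on_def)
  then show ?thesis by blast
qed

section \<open>The invariant inner product\<close>

definition ip :: "nat \<Rightarrow> nat \<Rightarrow> (nat set \<Rightarrow>\<^sub>0 rat) \<Rightarrow> (nat set \<Rightarrow>\<^sub>0 rat) \<Rightarrow> rat" where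
  "ip k n f g = (\<Sum>A\<in>subsets_of_size k n. lookup f A * lookup g A)"

lemma ip_simps:
  "ip k n (f + g) h = ip k n f h + ip k n g h" "ip k n h (f + g) = ip k n h f + ip k n h g"
  "ip k n (f - g) h = ip k n f h - ip k n g h" "ip k n h (f - g) = ip k n h f - ip k n h g"
  "ip k n (smul c f) g = c * ip k n f g" "ip k n f (smul c g) = c * ip k n f g"
  "ip k n 0 f = 0" "ip k n f 0 = 0"
  by (simp_all add: ip_def lookup_add lookup_minus algebra_simps sum.distrib sum_subtractf sum_distrib_left)

lemma ip_commute: "ip k n f g = ip k n g f"
  by (simp add: ip_def mult.commute)

lemma ip_self_eq_0:
  assumes "f \<in> space (LP k n)" "ip k n f f = 0"
  shows "f = 0"
proof (rule poly_mapping_eqI)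
  fix A
  have "\<forall>A\<in>subsets_of_size k n. lookup f A * lookup f A = 0"
    using assms(2) unfolding ip_def by (subst sum_nonneg_eq_0_iff[symmetric]) auto
  then show "lookup f A = lookup 0 A" using assms(1) by (auto simp: in_keys_iff)
qed

lemma ip_action:
  assumes "\<pi> permutes {1..n}"
  shows "ip k n (linearize (image \<pi>) f) (linearize (image \<pi>) g) = ip k n f g"
proof -
  have "ip k n f g = (\<Sum>A\<in>subsets_of_size k n. lookup f (inv \<pi> ` A) * lookup g (inv \<pi> ` A))"
    unfolding ip_def
    by (rule sum.reindex_bij_betw[OF bij_betw_image_subsets_of_size[OF permutes_inv[OF assms]], symmetric])
  then show ?thesis
    by (simp add: ip_def lookup_linearize_image[OF permutes_bij[OF assms]])
qed

lemma ip_span: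
  assumes "\<And>s. s \<in> S \<Longrightarrow> ip k n x s = 0" "y \<in> pm.span S"
  shows "ip k n x y = 0"
  using assms(2) by (induction rule: pm.span_induct_alt) (simp_all add: ip_simps assms(1))

lemma subspace_LP: "pm.subspace (space (LP k n))"
  using Sn_module_LP[of n k] by (simp add: Sn_module_def)

text \<open>Gram-Schmidt, one generator at a time. The induction hypothesis is applied to
  \<open>v\<close> and also to the new generator \<open>b\<close>, hence the generalization over
  \<open>v\<close>.\<close>

lemma orthogonal_projection_finite:
  assumes "finite S" "S \<subseteq> space (LP k n)"
  shows "\<exists>w\<in>pm.span S. \<forall>s\<in>S. ip k n (v - w) s = 0"
  using assms
proof (induction S arbitrary: v rule: finite_induct)
  case empty
  show ?case by (simp add: pm.span_zero)
next
  case (insert b S)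
  obtain b' where b': "b' \<in> pm.span S" "\<And>s. s \<in> S \<Longrightarrow> ip k n (b - b') s = 0"
    using insert by blast
  obtain w where w: "w \<in> pm.span S" "\<And>s. s \<in> S \<Longrightarrow> ip k n (v - w) s = 0"
    using insert by blast
  let ?r = "b - b'"
  \<comment> \<open>\<open>?r\<close> is the part of \<open>b\<close> orthogonal to
    \<open>S\<close>. If \<open>b\<close> already depends on \<open>S\<close>, then
    \<open>?r = 0\<close>, the quotient is 0 by convention, and \<open>w\<close> is kept; this
    degenerate case has to be covered when checking orthogonality to \<open>b\<close>.\<close>
  let ?w = "w + smul (ip k n (v - w) ?r / ip k n ?r ?r) ?r"
  have mono: "pm.span S \<subseteq> pm.span (insert b S)" by (rule pm.span_mono) auto
  have spS: "pm.span S \<subseteq> space (LP k n)"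
    using insert.prems by (intro pm.span_minimal subspace_LP) auto
  have "?r \<in> pm.span (insert b S)"
    using b' mono by (intro pm.span_diff) (auto intro: pm.span_base)
  then have "?w \<in> pm.span (insert b S)"
    using w mono by (intro pm.span_add pm.span_scale) auto
  moreover have S: "ip k n (v - ?w) s = 0" if "s \<in> S" for s
    using b'(2)[OF that] w(2)[OF that] by (simp add: ip_simps)
  moreover have "ip k n (v - ?w) b = 0"
  proof -
    have "b' \<in> space (LP k n)" using b'(1) spS by blast
    moreover have "b \<in> space (LP k n)" using insert.prems by blast
    ultimately have "?r \<in> space (LP k n)" by (intro pm.subspace_diff[OF subspace_LP])
    then have "ip k n (v - w) ?r = 0" if "ip k n ?r ?r = 0"
      using ip_self_eq_0[OF _ that] by (metis ip_simps(8))
    moreover have "ip k n (v - ?w) ?r = ip k n (v - w) ?r - ip k n (v - w) ?r / ip k n ?r ?r * ip k n ?r ?r"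
      unfolding diff_diff_eq[symmetric] ip_simps(3)[of k n "v - w"] ip_simps(5) ..
    ultimately have "ip k n (v - ?w) ?r = 0" by fastforce
    moreover have "ip k n (v - ?w) b' = 0" by (rule ip_span[OF S b'(1)])
    ultimately show ?thesis by (simp add: ip_simps(4))
  qed
  ultimately show ?case by blast
qed

text \<open>It suffices to project onto the span of a basis of \<open>T\<close>, which is finite
  because the finitely many \<open>k\<close>-subsets span \<open>LP k n\<close>.\<close>

lemma orthogonal_projection:
  assumes T: "pm.subspace T" "T \<subseteq> space (LP k n)"
  shows "\<exists>w\<in>T. \<forall>y\<in>T. ip k n (v - w) y = 0"
proof -
  obtain B where B: "B \<subseteq> T" "pm.independent B" "T \<subseteq> pm.span B"
    by (rule pm.maximal_independent_subset)
  let ?E = "(\<lambda>A. single A 1 :: nat set \<Rightarrow>\<^sub>0 rat) ` subsets_of_size k n"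
  have "f \<in> pm.span ?E" if "f \<in> space (LP k n)" for f
  proof -
    have "f = (\<Sum>A\<in>keys f. smul (lookup f A) (single A 1))"
      using sum_single_keys[of f] by simp
    also have "\<dots> \<in> pm.span ?E"
      using that by (intro pm.span_sum pm.span_scale pm.span_base) auto
    finally show ?thesis .
  qed
  then have "B \<subseteq> pm.span ?E" using B(1) T(2) by (meson subset_iff)
  then have "finite B" using pm.independent_span_bound[of ?E B] B(2) by simp
  then obtain w where w: "w \<in> pm.span B" "\<forall>s\<in>B. ip k n (v - w) s = 0"
    using orthogonal_projection_finite[of B k n v] B T by blast
  have "w \<in> T" using w(1) pm.span_minimal[OF B(1) T(1)] by blast
  moreover have "ip k n (v - w) y = 0" if "y \<in> T" for y
    by (rule ip_span[of B]) (use w B that in auto)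
  ultimately show ?thesis by blast
qed

section \<open>Submodules generated by matching vectors\<close>

text \<open>The submodule \<open>W a\<close> of the overview, inside \<open>LP k n\<close>. It is
  zero when \<open>a > k\<close> or \<open>a + k > n\<close>, since its generators then
  vanish.\<close>

definition matching_span :: "nat \<Rightarrow> nat \<Rightarrow> nat \<Rightarrow> (nat set \<Rightarrow>\<^sub>0 rat) set" where
  "matching_span k n a = pm.span {matching_vector k n a p q | p q. matching n a p q}"

lemma submodule_LP:
  "submodule n (LP k n) U \<longleftrightarrow> U \<subseteq> space (LP k n) \<and> pm.subspace U \<and>
     (\<forall>\<pi>. \<pi> permutes {1..n} \<longrightarrow> (\<forall>x\<in>U. linearize (image \<pi>) x \<in> U))"
  by (simp add: submodule_def)

lemma matching_vector_cong:
  assumes "\<And>j. j < a \<Longrightarrow> p j = p' j" "\<And>j. j < a \<Longrightarrow> q j = q' j"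
  shows "matching_vector k n a p q = matching_vector k n a p' q'"
  using assms by (simp add: matching_vector_def matching_coeff_def)

lemma linearize_span:
  assumes "\<And>s. s \<in> S \<Longrightarrow> linearize g s \<in> pm.span T" "x \<in> pm.span S"
  shows "linearize g x \<in> pm.span T"
  using assms(2)
  by (induction rule: pm.span_induct_alt)
     (auto simp: linearize_add linearize_smul pm.span_zero intro: pm.span_add pm.span_scale assms(1))

lemma submodule_matching_span: "submodule n (LP k n) (matching_span k n a)"
proof -
  have "matching_span k n a \<subseteq> space (LP k n)"
    unfolding matching_span_def using matching_vector_in by (intro pm.span_minimal subspace_LP) blast
  moreover have "linearize (image \<pi>) x \<in> matching_span k n a" if \<pi>: "\<pi> permutes {1..n}" and x: "x \<in> matching_span k n a" for \<pi> x
  proof -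
    have "linearize (image \<pi>) s \<in> matching_span k n a"
      if s: "s \<in> {matching_vector k n a p q | p q. matching n a p q}" for s
    proof -
      obtain p q where "s = matching_vector k n a p q" "matching n a p q" using s by blast
      then have "linearize (image \<pi>) s = matching_vector k n a (\<pi> \<circ> p) (\<pi> \<circ> q)" "matching n a (\<pi> \<circ> p) (\<pi> \<circ> q)"
        by (simp_all only: action_matching_vector[OF \<pi>] matching_permute[OF _ \<pi>])
      then show ?thesis unfolding matching_span_def by (metis (mono_tags, lifting) mem_Collect_eq pm.span_base)
    qed
    then show ?thesis using x unfolding matching_span_def by (rule linearize_span)
  qed
  ultimately show ?thesis by (simp add: submodule_LP matching_span_def)
qed

lemma matching_vector_in_span: "matching n a p q \<Longrightarrow> matching_vector k n a p q \<in> matching_span k n a"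
  unfolding matching_span_def by (intro pm.span_base) blast

text \<open>Permutations carry any matching to any other one of the same size, so a single matching
  vector generates the whole of \<open>W a\<close>.\<close>

lemma matching_span_subset:
  assumes U: "submodule n (LP k n) U" and m: "matching n a p q" and mem: "matching_vector k n a p q \<in> U"
  shows "matching_span k n a \<subseteq> U"
  unfolding matching_span_def
proof (rule pm.span_minimal)
  show "pm.subspace U" using U by (simp add: submodule_LP)
  show "{matching_vector k n a p q | p q. matching n a p q} \<subseteq> U"
  proof clarify
    fix p' q' assume "matching n a p' q'"
    then obtain \<pi> where \<pi>: "\<pi> permutes {1..n}" "\<And>j. j < a \<Longrightarrow> \<pi> (p j) = p' j \<and> \<pi> (q j) = q' j"
      using matching_transitive[OF m] by blast
    have "linearize (image \<pi>) (matching_vector k n a p q) = matching_vector k n a p' q'"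
      unfolding action_matching_vector[OF \<pi>(1)] by (rule matching_vector_cong) (simp_all add: \<pi>(2))
    then show "matching_vector k n a p' q' \<in> U"
      using U mem \<pi>(1) by (metis submodule_LP)
  qed
qed

lemma linearize_diff: "linearize g (f - h) = linearize g f - linearize g h"
  using linearize_add[of g "f - h" h] by simp

lemma transpose_image_commute:
  assumes "a \<noteq> c" "a \<noteq> d" "b \<noteq> c" "b \<noteq> d"
  shows "linearize (image (transpose a b)) (linearize (image (transpose c d)) f) =
    linearize (image (transpose c d)) (linearize (image (transpose a b)) f)"
proof -
  have "image (transpose a b) \<circ> image (transpose c d) = image (transpose c d) \<circ> image (transpose a b)"
    using swap_id_independent[OF assms] by (simp add: fun_eq_iff image_comp)
  then show ?thesis by (simp add: linearize_comp)
qed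

lemma matching_extend:
  assumes m: "matching n a p q" and x: "x \<in> singles n a p q" and y: "y \<in> singles n a p q" and "x \<noteq> y"
  shows "matching n (Suc a) (p(a := x)) (q(a := y))"
proof -
  have im: "(r(a := z)) ` {..<Suc a} = insert z (r ` {..<a})" for r :: "nat \<Rightarrow> nat" and z
    by (auto simp: lessThan_Suc)
  have inj: "inj_on (r(a := z)) {..<Suc a}" if "inj_on r {..<a}" "z \<notin> r ` {..<a}" for r :: "nat \<Rightarrow> nat" and z
    using that by (auto simp: inj_on_def less_Suc_eq)
  show ?thesis
    using m x y assms(4) unfolding matching_def singles_def im by (auto intro!: inj)
qed

text \<open>Take a nonzero vector alternating under as many disjoint pairs as possible: by maximality
  it is symmetric in the remaining points, hence a multiple of a matching vector.\<close>

lemma submodule_contains_matching_vector: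
  assumes U: "submodule n (LP k n) U" and nz: "U \<noteq> {0}"
  shows "\<exists>a p q. matching n a p q \<and> matching_vector k n a p q \<noteq> 0 \<and> matching_vector k n a p q \<in> U"
proof -
  let ?alt = "\<lambda>a p q v. \<forall>j<a. linearize (image (transpose (p j) (q j))) v = smul (-1) v"
  define Q where "Q a \<longleftrightarrow> (\<exists>p q v. matching n a p q \<and> v \<in> U \<and> v \<noteq> 0 \<and> ?alt a p q v)" for a
  have sub: "pm.subspace U" and sp: "U \<subseteq> space (LP k n)" using U by (auto simp: submodule_LP)
  have "0 \<in> U" by (rule pm.subspace_0[OF sub])
  then obtain v0 where "v0 \<in> U" "v0 \<noteq> 0" using nz by blast
  then have Q0: "Q 0" unfolding Q_def by (auto simp: matching_def)
  have bound: "a \<le> n" if Qa: "Q a" for a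
  proof -
    obtain p q where "matching n a p q" using Qa unfolding Q_def by blast
    then have "inj_on p {..<a}" "p ` {..<a} \<subseteq> {1..n}" by (auto simp: matching_def)
    from card_inj_on_le[OF this] show ?thesis by simp
  qed
  \<comment> \<open>The maximum exists: the empty matching satisfies \<open>Q 0\<close>, and at most
    \<open>n\<close> pairs fit into \<open>{1..n}\<close>.\<close>
  define a where "a = (GREATEST a. Q a)"
  have "Q a" unfolding a_def using Q0 bound by (rule GreatestI_nat)
  have max: "\<not> Q (Suc a)" using Greatest_le_nat[of Q "Suc a" n] bound unfolding a_def by auto
  obtain p q v where m: "matching n a p q" and v: "v \<in> U" "v \<noteq> 0" and alt: "?alt a p q v"
    using \<open>Q a\<close> unfolding Q_def by blast
  have "linearize (image (transpose x y)) v = v"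
    if x: "x \<in> singles n a p q" and y: "y \<in> singles n a p q" for x y
  proof (cases "x = y")
    case True
    then show ?thesis by (simp add: linearize_id)
  next
    case False
    let ?p = "p(a := x)" and ?q = "q(a := y)"
    let ?t = "\<lambda>x y. linearize (image (transpose x y)) :: (nat set \<Rightarrow>\<^sub>0 rat) \<Rightarrow> _"
    \<comment> \<open>\<open>w\<close> alternates under the extra swap by construction, and under
      the old ones because disjoint swaps commute. Maximality of \<open>a\<close> then forces
      \<open>w = 0\<close>, which is the wanted symmetry of \<open>v\<close>.\<close>
    define w where "w = v - ?t x y v"
    have "matching n (Suc a) ?p ?q"
      by (rule matching_extend[OF m x y False])
    moreover have "w \<in> U"
      using U v(1) transpose_singles_permutes[OF x y] pm.subspace_diff[OF sub] by (auto simp: submodule_LP w_def)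
    moreover have "?alt (Suc a) ?p ?q w"
    proof (intro allI impI)
      fix j assume "j < Suc a"
      show "?t (?p j) (?q j) w = smul (-1) w"
      proof (cases "j = a")
        case True
        have "?t x y (?t x y v) = v"
          by (rule poly_mapping_eqI) (simp add: lookup_linearize_transpose image_image)
        then show ?thesis using True by (simp add: w_def linearize_diff)
      next
        case False
        then have j: "j < a" using \<open>j < Suc a\<close> by simp
        have "?t (p j) (q j) (?t x y v) = ?t x y (?t (p j) (q j) v)"
          by (rule transpose_image_commute) (use singlesD[OF x] singlesD[OF y] j in auto)
        also have "\<dots> = smul (-1) (?t x y v)" using alt j by (simp add: linearize_smul del: pm.scale_minus_left)
        finally show ?thesis using False alt j by (simp add: w_def linearize_diff)
      qed
    qed
    ultimately have "w = 0" using max unfolding Q_def by blast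
    then show ?thesis by (simp add: w_def)
  qed
  then have "matched n (LP k n) a p q v" using v sp alt by (auto simp: matched_def)
  then obtain c where c: "v = smul c (matching_vector k n a p q)" using matched_LP[OF m] by blast
  then have "c \<noteq> 0" using v by auto
  then have "matching_vector k n a p q = smul (1 / c) v" by (simp add: c)
  moreover have "smul (1 / c) v \<in> U" by (rule pm.subspace_scale[OF sub v(1)])
  moreover have "matching_vector k n a p q \<noteq> 0" using c v(2) by auto
  ultimately show ?thesis using m by metis
qed

section \<open>Orthogonality\<close>

text \<open>The inclusion operator between \<open>a\<close>-subsets and \<open>k\<close>-subsets. It
  links \<open>W a\<close> inside \<open>LP k n\<close> with its copy at level \<open>k = a\<close>,
  where the polytabloids are found.\<close>

definition up :: "nat \<Rightarrow> nat \<Rightarrow> nat \<Rightarrow> (nat set \<Rightarrow>\<^sub>0 rat) \<Rightarrow> (nat set \<Rightarrow>\<^sub>0 rat)" where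
  "up a k n f = (\<Sum>A\<in>subsets_of_size k n. single A (\<Sum>B\<in>{B \<in> subsets_of_size a n. B \<subseteq> A}. lookup f B))"

lemma lookup_up:
  "lookup (up a k n f) A = (if A \<in> subsets_of_size k n then \<Sum>B\<in>{B \<in> subsets_of_size a n. B \<subseteq> A}. lookup f B else 0)"
  unfolding up_def by (simp add: lookup_sum lookup_single when_def sum.delta)

lemma hom_up: "hom n (LP a n) (LP k n) (up a k n)"
proof (rule homI)
  fix x y :: "nat set \<Rightarrow>\<^sub>0 rat"
  show "up a k n x \<in> space (LP k n)" by (auto simp: in_keys_iff lookup_up split: if_splits)
  show "up a k n (x + y) = up a k n x + up a k n y"
    by (rule poly_mapping_eqI) (simp add: lookup_up lookup_add sum.distrib)
  show "up a k n (scale (LP a n) c x) = scale (LP k n) c (up a k n x)" for c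
    by (rule poly_mapping_eqI) (simp add: lookup_up sum_distrib_left)
  show "up a k n (action (LP a n) \<pi> x) = action (LP k n) \<pi> (up a k n x)" if \<pi>: "\<pi> permutes {1..n}" for \<pi>
  proof (rule poly_mapping_eqI)
    fix A
    let ?i = "inv \<pi>"
    have b: "bij \<pi>" by (rule permutes_bij[OF \<pi>])
    have i: "?i permutes {1..n}" by (rule permutes_inv[OF \<pi>])
    have "bij_betw (image ?i) {B \<in> subsets_of_size a n. B \<subseteq> A} {B \<in> subsets_of_size a n. B \<subseteq> ?i ` A}"
    proof (rule bij_betw_byWitness[where f' = "image \<pi>"])
      show "image \<pi> ` {B \<in> subsets_of_size a n. B \<subseteq> ?i ` A} \<subseteq> {B \<in> subsets_of_size a n. B \<subseteq> A}"
        by (auto simp: image_subsets_of_size[OF \<pi>]) (metis (no_types, lifting) imageE permutes_inverses(1)[OF \<pi>] subsetD)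
    qed (auto simp: image_subsets_of_size[OF i] image_image permutes_inverses[OF \<pi>])
    then have "(\<Sum>B\<in>{B \<in> subsets_of_size a n. B \<subseteq> ?i ` A}. lookup x B) =
        (\<Sum>B\<in>{B \<in> subsets_of_size a n. B \<subseteq> A}. lookup x (?i ` B))"
      by (rule sum.reindex_bij_betw[symmetric])
    then show "lookup (up a k n (action (LP a n) \<pi> x)) A = lookup (action (LP k n) \<pi> (up a k n x)) A"
      by (simp add: lookup_up lookup_linearize_image[OF b] image_subsets_of_size[OF i])
  qed
qed

text \<open>Symmetry leaves only a factor \<open>c\<close> to be found. It is read off at the set of
  all \<open>q j\<close> enlarged by unmatched points \<open>E\<close>: the only transversal
  \<open>a\<close>-subset of it is the set of the \<open>q j\<close>, so a single term 1
  survives.\<close>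

lemma up_matching_vector:
  assumes m: "matching n a p q"
  shows "up a k n (matching_vector a n a p q) = matching_vector k n a p q"
proof -
  obtain c where c: "up a k n (matching_vector a n a p q) = smul c (matching_vector k n a p q)"
    using matched_LP[OF m matched_hom[OF hom_up m matched_matching_vector[OF m]]] by blast
  show ?thesis
  proof (cases "matching_vector k n a p q = 0")
    case True
    then show ?thesis using c by simp
  next
    case False
    then obtain E where E: "E \<subseteq> singles n a p q" "q ` {..<a} \<union> E \<in> subsets_of_size k n"
      using ex_transversal[OF m] matching_vector_nzD[OF m] by blast
    let ?A = "q ` {..<a} \<union> E"
    let ?S = "{B \<in> subsets_of_size a n. B \<subseteq> ?A}"
    have q: "q ` {..<a} \<in> ?S"
      using m by (auto simp: subsets_of_size_def matching_def card_image)
    have "matching_coeff a p q B = 0" if "B \<in> ?S" "B \<noteq> q ` {..<a}" for B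
    proof (rule ccontr)
      assume "matching_coeff a p q B \<noteq> 0"
      then have tr: "transversal a p q B" by (simp add: matching_coeff_nz)
      have "p j \<notin> B" if "j < a" for j
        using \<open>B \<in> ?S\<close> E(1) matchingD(3)[OF m that] that by (fastforce simp: singles_def)
      then have "q ` {..<a} \<subseteq> B" using tr by (auto simp: transversal_def)
      moreover have "card (q ` {..<a}) = card B" "finite B"
        using that(1) q subsets_of_size_finite[of B] by (auto simp: subsets_of_size_def)
      ultimately show False using that(2) card_subset_eq by metis
    qed
    then have "(\<Sum>B\<in>?S. matching_coeff a p q B) = (\<Sum>B\<in>?S. if B = q ` {..<a} then matching_coeff a p q B else 0)"
      by (intro sum.cong) auto
    also have "\<dots> = 1"
      using q transversal_union[OF m, of "{}"] by (simp add: sum.delta)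
    finally have "lookup (up a k n (matching_vector a n a p q)) ?A = 1"
      using E(2) by (simp add: lookup_up lookup_matching_vector)
    moreover have "lookup (matching_vector k n a p q) ?A = 1"
      using E(2) transversal_union[OF m E(1)] by (simp add: lookup_matching_vector)
    ultimately have "c = 1" using c by simp
    then show ?thesis using c by simp
  qed
qed

text \<open>A set of fewer than \<open>b\<close> points misses some pair. Swapping that pair
  permutes the supersets of \<open>B\<close> and reverses every coefficient, so the sum equals its
  own negative.\<close>

lemma sum_matching_coeff_supersets:
  assumes m: "matching n b p q" and B: "finite B" "card B < b"
  shows "(\<Sum>A\<in>{A \<in> subsets_of_size k n. B \<subseteq> A}. matching_coeff b p q A) = 0"
proof -
  obtain j where j: "j < b" "p j \<notin> B" "q j \<notin> B"
    using matching_card_le[OF m B(1)] B(2) by (meson not_le)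
  let ?t = "transpose (p j) (q j)" and ?S = "{A \<in> subsets_of_size k n. B \<subseteq> A}"
  have tB: "?t x = x" if "x \<in> B" for x using that j by (metis transpose_apply_other)
  have BA: "B \<subseteq> ?t ` A" if "B \<subseteq> A" for A
  proof
    fix x assume "x \<in> B"
    then have "x = ?t x" "x \<in> A" using tB that by auto
    then show "x \<in> ?t ` A" by (rule image_eqI)
  qed
  have "?t ` A \<in> ?S" if "A \<in> ?S" for A
    using that BA by (simp add: image_subsets_of_size[OF transpose_pair_permutes[OF m j(1)]])
  then have "image ?t ` ?S \<subseteq> ?S" by (rule image_subsetI)
  then have "bij_betw (image ?t) ?S ?S"
    by (intro bij_betw_byWitness[where f' = "image ?t"]) (simp_all add: image_image)
  then have "(\<Sum>A\<in>?S. matching_coeff b p q A) = (\<Sum>A\<in>?S. matching_coeff b p q (?t ` A))"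
    by (rule sum.reindex_bij_betw[symmetric])
  also have "\<dots> = - (\<Sum>A\<in>?S. matching_coeff b p q A)"
    by (simp add: matching_coeff_swap_pair[OF m j(1)] sum_negf)
  finally show ?thesis by simp
qed

text \<open>Writing the first vector as an image under \<open>up\<close> and exchanging the sums
  leaves, for each \<open>a\<close>-subset \<open>B\<close>, the coefficients of the second vector
  summed over the supersets of \<open>B\<close>; these cancel as \<open>a < b\<close>.\<close>

lemma ip_matching_vectors:
  assumes "matching n a p q" "matching n b p' q'" "a < b"
  shows "ip k n (matching_vector k n a p q) (matching_vector k n b p' q') = 0"
proof -
  let ?e = "matching_vector a n a p q" and ?P = "subsets_of_size k n"
  have "ip k n (up a k n ?e) (matching_vector k n b p' q') =
      (\<Sum>A\<in>?P. \<Sum>B | B \<in> subsets_of_size a n \<and> B \<subseteq> A. lookup ?e B * matching_coeff b p' q' A)"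
    unfolding ip_def by (rule sum.cong) (auto simp: lookup_up lookup_matching_vector[of k] sum_distrib_right)
  also have "\<dots> = (\<Sum>B\<in>subsets_of_size a n. \<Sum>A | A \<in> ?P \<and> B \<subseteq> A. lookup ?e B * matching_coeff b p' q' A)"
    by (rule sum.swap_restrict) simp_all
  also have "\<dots> = 0"
  proof (rule sum.neutral, rule ballI)
    fix B assume B: "B \<in> subsets_of_size a n"
    then have "finite B" "card B < b"
      using assms(3) by (simp_all only: subsets_of_size_finite) (simp add: subsets_of_size_def)
    then show "(\<Sum>A | A \<in> ?P \<and> B \<subseteq> A. lookup ?e B * matching_coeff b p' q' A) = 0"
      unfolding sum_distrib_left[symmetric] using sum_matching_coeff_supersets[OF assms(2), of B k] by simp
  qed
  finally show ?thesis by (simp add: up_matching_vector[OF assms(1)])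
qed

lemma ip_matching_span:
  assumes "a \<noteq> b" "x \<in> matching_span k n a" "y \<in> matching_span k n b"
  shows "ip k n x y = 0"
proof -
  have orth: "ip k n (matching_vector k n a p q) (matching_vector k n b p' q') = 0"
    if m: "matching n a p q" "matching n b p' q'" for p q p' q'
  proof (cases "a < b")
    case True
    then show ?thesis by (rule ip_matching_vectors[OF m])
  next
    case False
    then have "b < a" using assms(1) by simp
    then show ?thesis by (subst ip_commute) (rule ip_matching_vectors[OF m(2,1)])
  qed
  have "ip k n (matching_vector k n a p q) y = 0" if m: "matching n a p q" for p q
    using _ assms(3)[unfolded matching_span_def] by (rule ip_span) (use orth m in auto)
  then have "ip k n y s = 0" if "s \<in> {matching_vector k n a p q | p q. matching n a p q}" for s
    using that by (subst ip_commute) auto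
  then have "ip k n y x = 0" using assms(2)[unfolded matching_span_def] by (rule ip_span)
  then show ?thesis by (simp add: ip_commute)
qed

text \<open>For \<open>a \<noteq> b\<close> the vector would be orthogonal to itself.\<close>

lemma matching_vector_in_span_index:
  assumes m: "matching n a p q" and nz: "matching_vector k n a p q \<noteq> 0"
    and W: "matching_vector k n a p q \<in> matching_span k n b"
  shows "a = b"
  using ip_matching_span[OF _ matching_vector_in_span[OF m] W] ip_self_eq_0[OF matching_vector_in] nz by blast

text \<open>A nonzero \<open>U\<close> contains a nonzero matching vector; orthogonality forces its
  number of pairs to be \<open>a\<close>, and that one vector generates everything.\<close>

lemma submodule_of_matching_span:
  assumes U: "submodule n (LP k n) U" "U \<subseteq> matching_span k n a"
  shows "U = {0} \<or> U = matching_span k n a"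
proof (cases "U = {0}")
  case False
  then obtain b p q where b: "matching n b p q" "matching_vector k n b p q \<noteq> 0" "matching_vector k n b p q \<in> U"
    using submodule_contains_matching_vector[OF U(1)] by blast
  then have "b = a" using matching_vector_in_span_index U(2) by blast
  then show ?thesis using matching_span_subset[OF U(1) b(1,3)] U(2) by blast
qed simp

section \<open>Orthogonal decomposition of \<open>LP k n\<close>\<close>

lemma span_Union_subspaces:
  assumes "finite I" "\<And>i. i \<in> I \<Longrightarrow> pm.subspace (X i)" "v \<in> pm.span (\<Union>i\<in>I. X i)"
  shows "\<exists>x. (\<forall>i\<in>I. x i \<in> X i) \<and> v = (\<Sum>i\<in>I. x i)"
  using assms(3)
proof (induction rule: pm.span_induct_alt)
  case base
  then show ?case by (intro exI[of _ "\<lambda>_. 0"]) (simp add: assms(2) pm.subspace_0)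
next
  case (step c u v)
  then obtain x i where x: "\<forall>i\<in>I. x i \<in> X i" "v = (\<Sum>i\<in>I. x i)" and i: "i \<in> I" "u \<in> X i" by blast
  let ?x = "\<lambda>j. (if j = i then smul c u else 0) + x j"
  have "?x j \<in> X j" if "j \<in> I" for j
    using x(1) i that assms(2)[OF that] by (auto intro!: pm.subspace_add pm.subspace_scale)
  moreover have "smul c u + v = (\<Sum>j\<in>I. ?x j)"
    using i(1) assms(1) by (simp add: x(2) sum.distrib sum.delta)
  ultimately show ?case by (intro exI[of _ ?x]) blast
qed

text \<open>The orthogonal complement \<open>U\<close> of the sum \<open>T\<close> is a submodule. A
  nonzero matching vector has at most \<open>k\<close> pairs and so lies in \<open>T\<close>, hence
  never in \<open>U\<close>; thus \<open>U = {0}\<close>, and \<open>v\<close> equals its projection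
  to \<open>T\<close>.\<close>

lemma LP_eq_sum_matching_span:
  assumes "v \<in> space (LP k n)"
  shows "\<exists>x. (\<forall>i\<in>{0..k}. x i \<in> matching_span k n i) \<and> v = (\<Sum>i\<in>{0..k}. x i)"
proof -
  let ?G = "\<Union>i\<in>{0..k}. matching_span k n i"
  define T where "T = pm.span ?G"
  have sub: "pm.subspace T" unfolding T_def by (rule pm.subspace_span)
  have Wsub: "matching_span k n i \<subseteq> space (LP k n)" for i using submodule_matching_span[of n k i] by (simp only: submodule_LP)
  have Wact: "linearize (image \<pi>) x \<in> matching_span k n i" if "\<pi> permutes {1..n}" "x \<in> matching_span k n i" for \<pi> x i
    using submodule_matching_span[of n k i] that by (simp only: submodule_LP)
  have T: "T \<subseteq> space (LP k n)"
    unfolding T_def by (intro pm.span_minimal subspace_LP UN_least Wsub)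
  have actT: "linearize (image \<pi>) x \<in> T" if \<pi>: "\<pi> permutes {1..n}" and x: "x \<in> T" for \<pi> x
    using _ x unfolding T_def
  proof (rule linearize_span)
    fix s assume "s \<in> ?G"
    then obtain i where "i \<in> {0..k}" "s \<in> matching_span k n i" by blast
    then show "linearize (image \<pi>) s \<in> pm.span ?G" using Wact[OF \<pi>] by (intro pm.span_base) blast
  qed
  obtain w where w: "w \<in> T" "\<forall>y\<in>T. ip k n (v - w) y = 0" using orthogonal_projection[OF sub T] by blast
  define U where "U = {u \<in> space (LP k n). \<forall>y\<in>T. ip k n u y = 0}"
  have "linearize (image \<pi>) u \<in> U" if \<pi>: "\<pi> permutes {1..n}" and u: "u \<in> U" for \<pi> u
  proof -
    have "ip k n (linearize (image \<pi>) u) y = 0" if "y \<in> T" for y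
    proof -
      \<comment> \<open>By invariance of the inner product, \<open>\<pi>\<close> moves to the other
        argument as its inverse, under which \<open>T\<close> is stable.\<close>
      have "linearize (image \<pi>) (linearize (image (inv \<pi>)) y) = y"
        by (simp add: linearize_comp comp_def image_image permutes_inverses[OF \<pi>] linearize_id)
      then have "ip k n (linearize (image \<pi>) u) y = ip k n u (linearize (image (inv \<pi>)) y)"
        using ip_action[OF \<pi>] by metis
      then show ?thesis using u actT[OF permutes_inv[OF \<pi>] that] by (simp add: U_def)
    qed
    moreover have "linearize (image \<pi>) u \<in> space (LP k n)"
      using Sn_moduleD(5)[OF Sn_module_LP \<pi>, of u k] u by (simp add: U_def)
    ultimately show ?thesis by (simp add: U_def)
  qed
  moreover have "pm.subspace U"
    using subspace_LP[of k n] unfolding pm.subspace_def U_def by (simp add: ip_simps)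
  ultimately have "submodule n (LP k n) U" by (auto simp: submodule_LP U_def)
  moreover have "matching_vector k n a p q \<notin> U" if "matching n a p q" "matching_vector k n a p q \<noteq> 0" for a p q
  proof
    assume U: "matching_vector k n a p q \<in> U"
    have "a \<in> {0..k}" using matching_vector_nzD[OF that] by simp
    then have "matching_vector k n a p q \<in> T" unfolding T_def using matching_vector_in_span[OF that(1)] by (intro pm.span_base) blast
    then have "ip k n (matching_vector k n a p q) (matching_vector k n a p q) = 0" using U by (simp add: U_def)
    then show False using ip_self_eq_0[OF matching_vector_in] that(2) by blast
  qed
  ultimately have "U = {0}" using submodule_contains_matching_vector by blast
  moreover have "v - w \<in> U"
    using w T assms pm.subspace_diff[OF subspace_LP] unfolding U_def by blast
  ultimately have "v \<in> T" using w(1) by simp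
  moreover have "pm.subspace (matching_span k n i)" for i using submodule_matching_span by (simp add: submodule_LP)
  ultimately show ?thesis using span_Union_subspaces[of "{0..k}" "matching_span k n" v] unfolding T_def by blast
qed

text \<open>Pairing the vanishing sum with \<open>x i\<close> leaves only the square norm of
  \<open>x i\<close>.\<close>

lemma matching_span_independent:
  assumes x: "\<And>i. i \<in> I \<Longrightarrow> x i \<in> matching_span k n i" and "(\<Sum>i\<in>I. x i) = 0" "i \<in> I" "finite I"
  shows "x i = 0"
proof -
  have "ip k n (\<Sum>j\<in>I. x j) (x i) = (\<Sum>j\<in>I. ip k n (x j) (x i))"
    by (induction I rule: infinite_finite_induct) (simp_all add: ip_simps)
  also have "\<dots> = (\<Sum>j\<in>I. if j = i then ip k n (x i) (x i) else 0)"
    using ip_matching_span x assms(3) by (intro sum.cong) auto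
  finally have "ip k n (x i) (x i) = 0" using assms(2-4) by (simp add: ip_simps sum.delta)
  moreover have "x i \<in> space (LP k n)" using x[OF assms(3)] submodule_matching_span[of n k i] by (auto simp: submodule_def)
  ultimately show ?thesis by (rule ip_self_eq_0[rotated])
qed

section \<open>Polytabloids\<close>

abbreviation (input) row where "row p t i \<equiv> t ` {c \<in> cells p. fst c = i}"
abbreviation (input) col where "col p t j \<equiv> t ` {c \<in> cells p. snd c = j}"

lemma cells_eq_Sigma: "cells p = Sigma {..<length p} (\<lambda>i. {..<p ! i})"
  by (auto simp: cells_def)

lemma finite_cells: "finite (cells p)"
  by (simp add: cells_eq_Sigma)

lemma card_cells: "card (cells p) = sum_list p"
  by (simp add: cells_eq_Sigma sum_list_sum_nth atLeast0LessThan)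

lemma ex_tableau: "\<exists>t. tableau p t"
  unfolding tableau_def by (rule finite_same_card_bij) (simp_all add: finite_cells card_cells)

lemma tableau_permute:
  "tableau p t \<Longrightarrow> \<pi> permutes {1..sum_list p} \<Longrightarrow> tableau p (\<pi> \<circ> t)"
  unfolding tableau_def by (meson bij_betw_trans permutes_imp_bij)

lemma tabloid_permute: "tabloid p (\<pi> \<circ> t) = map (image \<pi>) (tabloid p t)"
  by (simp add: tabloid_def image_comp)

lemma length_tabloid [simp]: "length (tabloid p t) = length p"
  by (simp add: tabloid_def)

lemma nth_tabloid: "i < length p \<Longrightarrow> tabloid p t ! i = row p t i"
  by (simp add: tabloid_def)

lemma Sn_module_tabloid_module: "Sn_module (sum_list p) (tabloid_module p)"
  unfolding tabloid_module_def
proof (rule Sn_module_free_rep)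
  fix \<pi> :: "nat \<Rightarrow> nat" assume "\<pi> permutes {1..sum_list p}"
  then show "map (image \<pi>) ` tabloid p ` {t. tableau p t} \<subseteq> tabloid p ` {t. tableau p t}"
    by (auto simp: tabloid_permute[symmetric] tableau_permute)
qed (auto simp: fun_eq_iff image_comp)

lemma tabloid_module_simps:
  "space (tabloid_module p) = {f. keys f \<subseteq> tabloid p ` {t. tableau p t}}"
  "scale (tabloid_module p) = smul"
  "action (tabloid_module p) \<pi> = linearize (map (image \<pi>))"
  by (simp_all add: tabloid_module_def free_rep_simps)

lemma specht_simps [simp]:
  "space (specht p) = pm.span (polytabloid p ` {t. tableau p t})"
  "scale (specht p) = smul"
  "action (specht p) \<pi> = linearize (map (image \<pi>))"
  by (simp_all add: specht_def tabloid_module_simps)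

section \<open>Column stabilizers and the symmetries of polytabloids\<close>

lemma column_stabilizer_permutes: "\<sigma> \<in> column_stabilizer p t \<Longrightarrow> \<sigma> permutes {1..sum_list p}"
  by (simp add: column_stabilizer_def)

lemma finite_column_stabilizer: "finite (column_stabilizer p t)"
  by (rule finite_subset[OF _ finite_permutations[of "{1..sum_list p}"]]) (auto simp: column_stabilizer_def)

lemma column_stabilizer_comp:
  assumes "\<sigma> \<in> column_stabilizer p t" "\<tau> \<in> column_stabilizer p t"
  shows "\<sigma> \<circ> \<tau> \<in> column_stabilizer p t"
proof -
  have "(\<sigma> \<circ> \<tau>) ` col p t j = col p t j" for j
    by (simp only: image_comp[symmetric]) (use assms in \<open>simp add: column_stabilizer_def\<close>)
  moreover have "\<sigma> \<circ> \<tau> permutes {1..sum_list p}"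
    by (intro permutes_compose column_stabilizer_permutes[OF assms(1)] column_stabilizer_permutes[OF assms(2)])
  ultimately show ?thesis by (simp add: column_stabilizer_def del: image_comp)
qed

lemma column_stabilizer_inv:
  assumes "\<sigma> \<in> column_stabilizer p t"
  shows "inv \<sigma> \<in> column_stabilizer p t"
proof -
  have \<sigma>: "\<sigma> permutes {1..sum_list p}" by (rule column_stabilizer_permutes[OF assms])
  have "inv \<sigma> ` col p t j = col p t j" for j
  proof -
    have "inv \<sigma> ` (\<sigma> ` col p t j) = col p t j"
      by (simp only: image_comp permutes_inv_o[OF \<sigma>] image_id id_apply comp_assoc[symmetric]) (simp add: comp_def)
    then show ?thesis using assms by (simp add: column_stabilizer_def)
  qed
  then show ?thesis using permutes_inv[OF \<sigma>] by (simp add: column_stabilizer_def)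
qed

lemma sign_mult:
  assumes "\<sigma> permutes {1..n::nat}" "\<tau> permutes {1..n}"
  shows "sign (\<sigma> \<circ> \<tau>) = sign \<sigma> * sign \<tau>"
  using assms by (intro sign_compose) (auto intro: permutes_imp_permutation[of "{1..n}"])

text \<open>Left multiplication by \<open>\<sigma>\<close> permutes the column stabilizer and
  multiplies every sign by that of \<open>\<sigma>\<close>.\<close>

lemma polytabloid_column_stabilizer:
  assumes "\<sigma> \<in> column_stabilizer p t"
  shows "linearize (map (image \<sigma>)) (polytabloid p t) = smul (of_int (sign \<sigma>)) (polytabloid p t)"
proof -
  let ?C = "column_stabilizer p t"
  have \<sigma>: "\<sigma> permutes {1..sum_list p}" by (rule column_stabilizer_permutes[OF assms])
  have bij: "bij_betw (\<lambda>\<tau>. \<sigma> \<circ> \<tau>) ?C ?C"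
  proof (rule bij_betw_byWitness[where f' = "\<lambda>\<tau>. inv \<sigma> \<circ> \<tau>"])
    show "\<forall>\<tau>\<in>?C. inv \<sigma> \<circ> (\<sigma> \<circ> \<tau>) = \<tau>" "\<forall>\<tau>\<in>?C. \<sigma> \<circ> (inv \<sigma> \<circ> \<tau>) = \<tau>"
      by (simp_all add: comp_assoc[symmetric] permutes_inv_o[OF \<sigma>])
  qed (auto intro: column_stabilizer_comp column_stabilizer_inv assms)
  have sgn: "of_int (sign \<tau>) = (of_int (sign \<sigma>) * of_int (sign (\<sigma> \<circ> \<tau>)) :: rat)" if "\<tau> \<in> ?C" for \<tau>
  proof -
    have "sign \<sigma> * sign (\<sigma> \<circ> \<tau>) = sign \<tau>"
      by (simp add: sign_mult[OF \<sigma> column_stabilizer_permutes[OF that]])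
    then show ?thesis by (metis of_int_mult)
  qed
  have "linearize (map (image \<sigma>)) (polytabloid p t) =
      (\<Sum>\<tau>\<in>?C. single (tabloid p ((\<sigma> \<circ> \<tau>) \<circ> t)) (of_int (sign \<tau>)))"
    by (simp add: polytabloid_def linearize_sum tabloid_permute[symmetric] comp_assoc)
  also have "\<dots> = (\<Sum>\<tau>\<in>?C. smul (of_int (sign \<sigma>)) (single (tabloid p ((\<sigma> \<circ> \<tau>) \<circ> t)) (of_int (sign (\<sigma> \<circ> \<tau>)))))"
    by (rule sum.cong) (simp_all add: sgn)
  also have "\<dots> = (\<Sum>\<tau>\<in>?C. smul (of_int (sign \<sigma>)) (single (tabloid p (\<tau> \<circ> t)) (of_int (sign \<tau>))))"
    by (rule sum.reindex_bij_betw[OF bij])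
  also have "\<dots> = smul (of_int (sign \<sigma>)) (polytabloid p t)"
    unfolding polytabloid_def by (rule pm.scale_sum_right[symmetric])
  finally show ?thesis .
qed

text \<open>Conjugation by \<open>\<pi>\<close> is a sign-preserving bijection from the column
  stabilizer of \<open>t\<close> to that of \<open>\<pi> \<circ> t\<close>.\<close>

lemma polytabloid_permute:
  assumes \<pi>: "\<pi> permutes {1..sum_list p}"
  shows "linearize (map (image \<pi>)) (polytabloid p t) = polytabloid p (\<pi> \<circ> t)"
proof -
  have i: "inv \<pi> permutes {1..sum_list p}" by (rule permutes_inv[OF \<pi>])
  note io = permutes_inv_o[OF \<pi>]
  have conj: "\<rho> \<circ> \<sigma> \<circ> inv \<rho> \<in> column_stabilizer p (\<rho> \<circ> s)"
    if \<rho>: "\<rho> permutes {1..sum_list p}" and \<sigma>: "\<sigma> \<in> column_stabilizer p s" for \<rho> \<sigma> s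
  proof -
    have "\<rho> \<circ> \<sigma> \<circ> inv \<rho> permutes {1..sum_list p}"
      by (intro permutes_compose \<rho> permutes_inv column_stabilizer_permutes[OF \<sigma>])
    moreover have "(\<rho> \<circ> \<sigma> \<circ> inv \<rho>) ` (\<rho> \<circ> s) ` X = (\<rho> \<circ> s) ` X" if "\<sigma> ` s ` X = s ` X" for X
    proof -
      have "(\<rho> \<circ> \<sigma> \<circ> inv \<rho>) ` (\<rho> \<circ> s) ` X = \<rho> ` \<sigma> ` s ` X"
        by (simp add: image_image permutes_inverses[OF \<rho>])
      also have "\<dots> = \<rho> ` s ` X" using that by simp
      also have "\<dots> = (\<rho> \<circ> s) ` X" by (rule image_comp)
      finally show ?thesis .
    qed
    ultimately show ?thesis using \<sigma> by (simp add: column_stabilizer_def)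
  qed
  have bij: "bij_betw (\<lambda>\<sigma>. \<pi> \<circ> \<sigma> \<circ> inv \<pi>) (column_stabilizer p t) (column_stabilizer p (\<pi> \<circ> t))"
  proof (rule bij_betw_byWitness[where f' = "\<lambda>\<sigma>. inv \<pi> \<circ> \<sigma> \<circ> \<pi>"])
    show "\<forall>\<sigma>\<in>column_stabilizer p t. inv \<pi> \<circ> (\<pi> \<circ> \<sigma> \<circ> inv \<pi>) \<circ> \<pi> = \<sigma>"
      "\<forall>\<sigma>\<in>column_stabilizer p (\<pi> \<circ> t). \<pi> \<circ> (inv \<pi> \<circ> \<sigma> \<circ> \<pi>) \<circ> inv \<pi> = \<sigma>"
      by (simp_all add: fun_eq_iff permutes_inverses[OF \<pi>])
    show "(\<lambda>\<sigma>. \<pi> \<circ> \<sigma> \<circ> inv \<pi>) ` column_stabilizer p t \<subseteq> column_stabilizer p (\<pi> \<circ> t)"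
      using conj[OF \<pi>] by auto
    have "inv \<pi> \<circ> \<sigma> \<circ> \<pi> \<in> column_stabilizer p t" if "\<sigma> \<in> column_stabilizer p (\<pi> \<circ> t)" for \<sigma>
      using conj[OF i that] by (simp add: permutes_inv_inv[OF \<pi>] comp_assoc[symmetric] io)
    then show "(\<lambda>\<sigma>. inv \<pi> \<circ> \<sigma> \<circ> \<pi>) ` column_stabilizer p (\<pi> \<circ> t) \<subseteq> column_stabilizer p t" by auto
  qed
  have sgn: "sign (\<pi> \<circ> \<sigma> \<circ> inv \<pi>) = sign \<sigma>" if "\<sigma> \<in> column_stabilizer p t" for \<sigma>
  proof -
    have \<sigma>: "\<sigma> permutes {1..sum_list p}" by (rule column_stabilizer_permutes[OF that])
    have "sign (inv \<pi>) = sign \<pi>" by (intro sign_inverse permutes_imp_permutation[OF _ \<pi>]) simp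
    then show ?thesis
      by (simp add: sign_mult[OF permutes_compose[OF \<sigma> \<pi>] i] sign_mult[OF \<pi> \<sigma>] mult.commute)
  qed
  have "polytabloid p (\<pi> \<circ> t) =
      (\<Sum>\<sigma>\<in>column_stabilizer p t. single (tabloid p ((\<pi> \<circ> \<sigma> \<circ> inv \<pi>) \<circ> (\<pi> \<circ> t))) (of_int (sign (\<pi> \<circ> \<sigma> \<circ> inv \<pi>))))"
    unfolding polytabloid_def by (rule sum.reindex_bij_betw[OF bij, symmetric])
  also have "\<dots> = (\<Sum>\<sigma>\<in>column_stabilizer p t. single (map (image \<pi>) (tabloid p (\<sigma> \<circ> t))) (of_int (sign \<sigma>)))"
  proof (rule sum.cong)
    fix \<sigma> assume "\<sigma> \<in> column_stabilizer p t"
    moreover have "(\<pi> \<circ> \<sigma> \<circ> inv \<pi>) \<circ> (\<pi> \<circ> t) = \<pi> \<circ> (\<sigma> \<circ> t)"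
      by (simp add: fun_eq_iff permutes_inverses[OF \<pi>])
    ultimately show "single (tabloid p ((\<pi> \<circ> \<sigma> \<circ> inv \<pi>) \<circ> (\<pi> \<circ> t))) (of_int (sign (\<pi> \<circ> \<sigma> \<circ> inv \<pi>)) :: rat) =
        single (map (image \<pi>) (tabloid p (\<sigma> \<circ> t))) (of_int (sign \<sigma>))"
      by (simp only: sgn tabloid_permute[of p \<pi>])
  qed simp
  also have "\<dots> = linearize (map (image \<pi>)) (polytabloid p t)"
    by (simp add: polytabloid_def linearize_sum)
  finally show ?thesis ..
qed

text \<open>A permutation preserving both the rows and the columns of a tableau is the identity.\<close>

lemma lookup_polytabloid_self:
  assumes t: "tableau p t"
  shows "lookup (polytabloid p t) (tabloid p t) = 1"
proof -
  let ?C = "column_stabilizer p t"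
  have inj: "inj_on t (cells p)" and im: "t ` cells p = {1..sum_list p}"
    using t by (auto simp: tableau_def bij_betw_def)
  have eq_id: "\<sigma> = id" if \<sigma>: "\<sigma> \<in> ?C" and rows: "tabloid p (\<sigma> \<circ> t) = tabloid p t" for \<sigma>
  proof
    fix x
    show "\<sigma> x = id x"
    proof (cases "x \<in> {1..sum_list p}")
      case True
      then obtain i j where c: "(i, j) \<in> cells p" "x = t (i, j)" using im by force
      then have i: "i < length p" by (simp add: cells_def)
      have "(\<sigma> \<circ> t) ` {c \<in> cells p. fst c = i} = t ` {c \<in> cells p. fst c = i}"
        using rows nth_tabloid[OF i] by metis
      then have "\<sigma> x \<in> row p t i" using c by fastforce
      moreover have "\<sigma> ` col p t j = col p t j" using \<sigma> by (simp add: column_stabilizer_def)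
      then have "\<sigma> x \<in> col p t j" using c by fastforce
      ultimately obtain c1 c2 where "\<sigma> x = t c1" "\<sigma> x = t c2" "c1 \<in> cells p" "c2 \<in> cells p" "fst c1 = i" "snd c2 = j"
        by auto
      moreover from this have "c1 = c2" using inj by (metis inj_onD)
      ultimately show ?thesis using c by (metis id_apply prod.collapse)
    next
      case False
      then show ?thesis using permutes_not_in[OF column_stabilizer_permutes[OF \<sigma>]] by simp
    qed
  qed
  have "lookup (polytabloid p t) (tabloid p t) = (\<Sum>\<sigma>\<in>?C. if \<sigma> = id then 1 else 0)"
    unfolding polytabloid_def lookup_sum lookup_single
    by (rule sum.cong) (auto simp: when_def dest: eq_id)
  also have "\<dots> = 1"
    using finite_column_stabilizer[of p t] by (simp add: sum.delta column_stabilizer_def permutes_id)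
  finally show ?thesis .
qed

lemma submodule_specht: "submodule (sum_list p) (tabloid_module p) (space (specht p))"
proof -
  have "polytabloid p t \<in> space (tabloid_module p)" if "tableau p t" for t
    using that unfolding polytabloid_def tabloid_module_simps
    by (intro CollectI keys_sum_subset)
       (auto dest!: column_stabilizer_permutes intro: tableau_permute split: if_splits)
  moreover have "pm.subspace (space (tabloid_module p))"
    using Sn_module_tabloid_module[of p] by (simp add: Sn_module_def tabloid_module_simps(2))
  ultimately have "space (specht p) \<subseteq> space (tabloid_module p)"
    by (simp only: specht_simps) (intro pm.span_minimal, auto)
  moreover have "linearize (map (image \<pi>)) x \<in> space (specht p)"
    if \<pi>: "\<pi> permutes {1..sum_list p}" and x: "x \<in> space (specht p)" for \<pi> x
    using _ x unfolding specht_simps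
  proof (rule linearize_span)
    fix s assume "s \<in> polytabloid p ` {t. tableau p t}"
    then obtain t where "tableau p t" "s = polytabloid p t" by blast
    then show "linearize (map (image \<pi>)) s \<in> pm.span (polytabloid p ` {t. tableau p t})"
      using tableau_permute[OF _ \<pi>] by (simp only: polytabloid_permute[OF \<pi>]) (intro pm.span_base, blast)
  qed
  ultimately show ?thesis
    unfolding submodule_def tabloid_module_simps(2,3) by (simp only: specht_simps pm.subspace_span) blast
qed

lemma Sn_module_specht: "Sn_module (sum_list p) (specht p)"
proof -
  have "specht p = sub_rep (tabloid_module p) (space (specht p))"
    by (simp add: specht_def sub_rep_def)
  then show ?thesis using Sn_module_sub_rep[OF Sn_module_tabloid_module submodule_specht] by metis
qed

lemma polytabloid_in_specht: "tableau p t \<Longrightarrow> polytabloid p t \<in> space (specht p)"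
  by (auto intro: pm.span_base)

text \<open>The swap is an odd element of the column stabilizer.\<close>

lemma polytabloid_swap_column:
  assumes t: "tableau p t" and c: "(i, j) \<in> cells p" "(i', j) \<in> cells p" "i \<noteq> i'"
  shows "linearize (map (image (transpose (t (i, j)) (t (i', j))))) (polytabloid p t) = smul (-1) (polytabloid p t)"
proof -
  let ?t = "transpose (t (i, j)) (t (i', j))"
  have inj: "inj_on t (cells p)" and im: "t ` cells p = {1..sum_list p}"
    using t by (auto simp: tableau_def bij_betw_def)
  have neq: "t (i, j) \<noteq> t (i', j)" using inj c by (auto dest: inj_onD)
  have mem: "t (i, j) \<in> {1..sum_list p}" "t (i', j) \<in> {1..sum_list p}" using im c by auto
  have in_col: "t (r, j) \<in> col p t l \<longleftrightarrow> l = j" if "(r, j) \<in> cells p" for r l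
    using inj_on_image_mem_iff[OF inj that, of "{c \<in> cells p. snd c = l}"] that by auto
  have "?t ` col p t l = col p t l" for l
    by (rule transpose_image_eq) (simp only: in_col[OF c(1)] in_col[OF c(2)])
  then have "?t \<in> column_stabilizer p t"
    using permutes_swap_id[OF mem] by (simp add: column_stabilizer_def)
  from polytabloid_column_stabilizer[OF this] show ?thesis using neq by (simp add: sign_swap_id)
qed

text \<open>Any three points contain two on the same side of \<open>A\<close>, and swapping these fixes \<open>A\<close>.\<close>

lemma hom_specht_three_rows:
  assumes p: "sum_list p = n" and f: "hom n (specht p) (LP k n) f"
    and t: "tableau p t" and c: "{(0, 0), (1, 0), (2, 0)} \<subseteq> cells p"
  shows "f (polytabloid p t) = 0"
proof (rule poly_mapping_eqI)
  fix A
  let ?g = "f (polytabloid p t)"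
  have im: "t ` cells p = {1..n}" using t p by (auto simp: tableau_def bij_betw_def)
  have e: "polytabloid p t \<in> space (specht p)" by (rule polytabloid_in_specht[OF t])
  have swap: "lookup ?g (transpose (t (i, 0)) (t (i', 0)) ` A) = - lookup ?g A"
    if ii: "(i, 0) \<in> cells p" "(i', 0) \<in> cells p" "i \<noteq> i'" for i i'
  proof -
    let ?t = "transpose (t (i, 0)) (t (i', 0))"
    have \<pi>: "?t permutes {1..n}" using im ii by (intro permutes_swap_id) auto
    have "linearize (image ?t) ?g = f (linearize (map (image ?t)) (polytabloid p t))"
      using homD(4)[OF f \<pi> e] by simp
    also have "\<dots> = smul (-1) ?g"
      unfolding polytabloid_swap_column[OF t ii] using homD(3)[OF f e, of "-1"] by simp
    finally have "lookup (linearize (image ?t) ?g) A = - lookup ?g A" by simp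
    then show ?thesis by (simp add: lookup_linearize_transpose)
  qed
  have "lookup ?g A = 0"
    if "(i, 0) \<in> cells p" "(i', 0) \<in> cells p" "i \<noteq> i'" "t (i, 0) \<in> A \<longleftrightarrow> t (i', 0) \<in> A" for i i'
    using swap[OF that(1-3)] that(4) by simp
  from this[of 0 1] this[of 0 2] this[of 1 2] show "lookup ?g A = lookup 0 A" using c by auto
qed

section \<open>Specht modules of two-row shapes\<close>

text \<open>The shape is described by its cells because the list may carry trailing zeros or, for
  \<open>a = 0\<close>, have no second entry. \<open>p \<noteq> []\<close> keeps the head of a
  tabloid, its first row, meaningful even for \<open>n = 0\<close>.\<close>

definition two_row :: "nat list \<Rightarrow> nat \<Rightarrow> nat \<Rightarrow> bool" where
  "two_row p n a \<longleftrightarrow> p \<noteq> [] \<and> sum_list p = n \<and> 2 * a \<le> n \<and> cells p = {0} \<times> {..<n - a} \<union> {1} \<times> {..<a}"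

lemma two_rowD:
  assumes "two_row p n a"
  shows "p \<noteq> []" "sum_list p = n" "2 * a \<le> n" "cells p = {0} \<times> {..<n - a} \<union> {1} \<times> {..<a}"
  using assms by (simp_all add: two_row_def)

context
  fixes p :: "nat list" and n a :: nat and t :: "nat \<times> nat \<Rightarrow> nat"
  assumes p: "two_row p n a" and t: "tableau p t"
begin

lemmas two_row_facts = two_rowD[OF p]

lemma tableau_facts: "inj_on t (cells p)" "t ` cells p = {1..n}"
  using t two_row_facts(2) by (auto simp: tableau_def bij_betw_def)

lemma t_eq_iff: "c \<in> cells p \<Longrightarrow> d \<in> cells p \<Longrightarrow> t c = t d \<longleftrightarrow> c = d"
  using tableau_facts(1) by (auto dest: inj_onD)

lemma t_mem_iff: "c \<in> cells p \<Longrightarrow> t c \<in> t ` {d \<in> cells p. P d} \<longleftrightarrow> P c"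
  using inj_on_image_mem_iff[OF tableau_facts(1), of c "{d \<in> cells p. P d}"] by auto

text \<open>The pairs are the columns with two cells; the remaining entries stand alone in their
  columns and become the unmatched points.\<close>

lemma matching_tableau: "matching n a (\<lambda>j. t (0, j)) (\<lambda>j. t (1, j))"
proof -
  have c: "(0, j) \<in> cells p" "(1, j) \<in> cells p" if "j < a" for j
    using that two_row_facts(3,4) by auto
  have "t (0, j) \<in> {1..n}" "t (1, j) \<in> {1..n}" if "j < a" for j
    unfolding tableau_facts(2)[symmetric] using c[OF that] by auto
  then show ?thesis
    using t_eq_iff c by (auto simp: matching_def inj_on_def simp del: One_nat_def)
qed

lemma singles_tableau:
  assumes "x \<in> singles n a (\<lambda>j. t (0, j)) (\<lambda>j. t (1, j))"
  shows "\<exists>i. a \<le> i \<and> i < n - a \<and> x = t (0, i)"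
proof -
  have "x \<in> t ` cells p" using assms by (simp add: singles_def tableau_facts(2))
  then show ?thesis using assms unfolding two_row_facts(4) by (force simp: singles_def not_less[symmetric])
qed

text \<open>The swap stays within the first row, so the tabloid is unchanged, and it exchanges two
  one-cell columns, so the family of columns and with it the column stabilizer are unchanged. Hence
  \<open>t\<close> and the swapped tableau have the same polytabloid.\<close>

lemma polytabloid_swap_singles:
  assumes i: "a \<le> i" "i < n - a" and j: "a \<le> j" "j < n - a"
  shows "linearize (map (image (transpose (t (0, i)) (t (0, j))))) (polytabloid p t) = polytabloid p t"
proof -
  let ?x = "t (0, i)" and ?y = "t (0, j)"
  let ?t = "transpose ?x ?y"
  have c: "(0, i) \<in> cells p" "(0, j) \<in> cells p" using i j by (auto simp: two_row_facts(4))
  have \<pi>: "?t permutes {1..sum_list p}"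
    using tableau_facts(2) c by (intro permutes_swap_id) (auto simp: two_row_facts(2))
  have "?t ` row p t r = row p t r" for r
    by (rule transpose_image_eq) (simp only: t_mem_iff[OF c(1)] t_mem_iff[OF c(2)] fst_conv)
  then have tab: "tabloid p (?t \<circ> t) = tabloid p t"
    by (simp add: tabloid_permute) (simp add: tabloid_def)
  have single: "{c \<in> cells p. snd c = l} = {(0, l)}" if "a \<le> l" "l < n - a" for l
    using that by (auto simp: two_row_facts(4))
  \<comment> \<open>The swap acts on columns as \<open>transpose i j\<close> on their indices, which
    a quantifier over all columns does not notice.\<close>
  have col: "?t ` col p t l = col p t (transpose i j l)" for l
  proof (cases "l = i \<or> l = j")
    case True
    then show ?thesis
      by (elim disjE)
        (simp_all only: single[OF i] single[OF j] image_insert image_empty transpose_apply_first transpose_apply_second)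
  next
    case False
    then have "?t ` col p t l = col p t l"
      by (intro transpose_image_eq) (simp only: t_mem_iff[OF c(1)] t_mem_iff[OF c(2)] snd_conv, simp)
    then show ?thesis using False by simp
  qed
  have "(\<forall>l. \<sigma> ` (?t \<circ> t) ` {c \<in> cells p. snd c = l} = (?t \<circ> t) ` {c \<in> cells p. snd c = l}) \<longleftrightarrow>
      (\<forall>l. \<sigma> ` col p t l = col p t l)" for \<sigma>
  proof -
    let ?Q = "\<lambda>l. \<sigma> ` col p t l = col p t l"
    have "?Q l" if "\<forall>l. ?Q (transpose i j l)" for l
      using spec[OF that, of "transpose i j l"] by (simp only: transpose_involutory)
    then show ?thesis unfolding image_comp[symmetric] col by blast
  qed
  then have "column_stabilizer p (?t \<circ> t) = column_stabilizer p t"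
    by (simp only: column_stabilizer_def)
  moreover have "tabloid p (\<sigma> \<circ> (?t \<circ> t)) = tabloid p (\<sigma> \<circ> t)" for \<sigma>
    by (simp only: tabloid_permute[of p \<sigma>] tab)
  ultimately have "polytabloid p (?t \<circ> t) = polytabloid p t"
    by (simp only: polytabloid_def)
  then show ?thesis by (simp only: polytabloid_permute[OF \<pi>])
qed

lemma matched_polytabloid:
  "matched n (specht p) a (\<lambda>j. t (0, j)) (\<lambda>j. t (1, j)) (polytabloid p t)"
proof -
  have "linearize (map (image (transpose (t (0, j)) (t (1, j))))) (polytabloid p t) = smul (-1) (polytabloid p t)"
    if "j < a" for j
    using that two_row_facts(3) by (intro polytabloid_swap_column[OF t]) (auto simp: two_row_facts(4))
  moreover have "linearize (map (image (transpose x y))) (polytabloid p t) = polytabloid p t"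
    if "x \<in> singles n a (\<lambda>j. t (0, j)) (\<lambda>j. t (1, j))" "y \<in> singles n a (\<lambda>j. t (0, j)) (\<lambda>j. t (1, j))" for x y
    using singles_tableau[OF that(1)] singles_tableau[OF that(2)] polytabloid_swap_singles by auto
  ultimately show ?thesis using polytabloid_in_specht[OF t] by (simp add: matched_def)
qed

lemma hom_specht_polytabloid:
  assumes "hom n (specht p) (LP k n) f"
  shows "\<exists>c. f (polytabloid p t) = smul c (matching_vector k n a (\<lambda>j. t (0, j)) (\<lambda>j. t (1, j)))"
  by (rule matched_LP[OF matching_tableau matched_hom[OF assms matching_tableau matched_polytabloid]])

text \<open>The second row is expressed as a complement because the list of rows may have no second
  member.\<close>

lemma second_row: "{1..n} - hd (tabloid p t) = (\<lambda>j. t (1, j)) ` {..<a}"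
proof -
  have "hd (tabloid p t) = row p t 0"
    using two_row_facts(1) by (simp add: hd_conv_nth nth_tabloid tabloid_def)
  also have "\<dots> = t ` ({0} \<times> {..<n - a})"
    unfolding two_row_facts(4) by (rule arg_cong[where f = "image t"]) auto
  finally have hd: "hd (tabloid p t) = t ` ({0} \<times> {..<n - a})" .
  have "{1..n} = t ` ({0} \<times> {..<n - a}) \<union> t ` ({1} \<times> {..<a})"
    unfolding tableau_facts(2)[symmetric] two_row_facts(4) by (rule image_Un)
  moreover have "t ` ({0} \<times> {..<n - a}) \<inter> t ` ({1} \<times> {..<a}) = {}"
    using inj_on_image_Int[OF tableau_facts(1), of "{0} \<times> {..<n - a}" "{1} \<times> {..<a}"]
    unfolding two_row_facts(4) by auto
  ultimately have "{1..n} - hd (tabloid p t) = t ` ({1} \<times> {..<a})" unfolding hd by blast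
  also have "{1} \<times> {..<a} = (\<lambda>j. (1, j)) ` {..<a}" by auto
  finally show ?thesis by (simp only: image_image)
qed

text \<open>The first row determines the whole list, which is why the encoding by the second row is
  injective on tabloids.\<close>

lemma nth_tabloid_two_row:
  assumes "i < length p"
  shows "tabloid p t ! i = (if i = 0 then hd (tabloid p t) else if i = 1 then {1..n} - hd (tabloid p t) else {})"
proof -
  consider "i = 0" | "i = 1" | "i > 1" by linarith
  then show ?thesis
  proof cases
    case 1
    then show ?thesis using two_row_facts(1) by (simp add: hd_conv_nth tabloid_def)
  next
    case 2
    have "{c \<in> cells p. fst c = 1} = (\<lambda>j. (1, j)) ` {..<a}" unfolding two_row_facts(4) by auto
    then have "row p t 1 = (\<lambda>j. t (1, j)) ` {..<a}" by (simp only: image_image)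
    then show ?thesis using 2 nth_tabloid[OF assms, of t] second_row by simp
  next
    case 3
    then have "{c \<in> cells p. fst c = i} = {}" unfolding two_row_facts(4) by auto
    then show ?thesis using 3 nth_tabloid[OF assms, of t] by simp
  qed
qed

end

text \<open>Up to the encoding of a tabloid by its second row, the permutation module on two-row tabloids
  is \<open>LP a n\<close>.\<close>

definition second_row_map :: "nat \<Rightarrow> (nat set list \<Rightarrow>\<^sub>0 rat) \<Rightarrow> (nat set \<Rightarrow>\<^sub>0 rat)" where
  "second_row_map n = linearize (\<lambda>T. {1..n} - hd T)"

lemma inj_on_second_row:
  assumes p: "two_row p n a"
  shows "inj_on (\<lambda>T. {1..n} - hd T) (tabloid p ` {t. tableau p t})"
proof (rule inj_onI, clarify)
  fix t t' assume t: "tableau p t" "tableau p t'" and eq: "{1..n} - hd (tabloid p t) = {1..n} - hd (tabloid p t')"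
  have "hd (tabloid p s) \<subseteq> {1..n}" if s: "tableau p s" for s
  proof -
    have "hd (tabloid p s) = row p s 0"
      using two_rowD(1)[OF p] by (simp add: hd_conv_nth nth_tabloid tabloid_def)
    then show ?thesis using tableau_facts(2)[OF p s] by auto
  qed
  then have hd: "hd (tabloid p t) = hd (tabloid p t')" using eq t by (metis double_diff subset_refl)
  show "tabloid p t = tabloid p t'"
    by (rule nth_equalityI) (simp_all add: nth_tabloid_two_row[OF p t(1)] nth_tabloid_two_row[OF p t(2)] hd)
qed

lemma hom_second_row_map:
  assumes p: "two_row p n a"
  shows "hom n (tabloid_module p) (LP a n) (second_row_map n)"
proof (rule homI)
  fix x y assume x: "x \<in> space (tabloid_module p)"
  show "second_row_map n x \<in> space (LP a n)"
  proof -
    have "{1..n} - hd (tabloid p t) \<in> subsets_of_size a n" if t: "tableau p t" for t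
    proof -
      have "card ((\<lambda>j. t (1, j)) ` {..<a}) = a"
        using matching_tableau[OF p t] by (simp add: matching_def card_image)
      then show ?thesis unfolding second_row[OF p t, symmetric] by (simp add: subsets_of_size_def)
    qed
    moreover have "keys (second_row_map n x) \<subseteq> (\<lambda>T. {1..n} - hd T) ` tabloid p ` {t. tableau p t}"
      using x unfolding second_row_map_def tabloid_module_simps
      by (intro order_trans[OF keys_linearize] image_mono) simp
    ultimately show ?thesis by auto
  qed
  show "second_row_map n (scale (tabloid_module p) c x) = scale (LP a n) c (second_row_map n x)" for c
    by (simp add: second_row_map_def tabloid_module_simps linearize_smul)
  show "second_row_map n (action (tabloid_module p) \<pi> x) = action (LP a n) \<pi> (second_row_map n x)"
    if \<pi>: "\<pi> permutes {1..n}" for \<pi>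
  proof -
    \<comment> \<open>\<open>hd\<close> commutes with \<open>map\<close> only on nonempty lists,
      which is guaranteed on the support of \<open>x\<close>; so the two linearizations are compared
      term by term there.\<close>
    have "{1..n} - hd (map (image \<pi>) T) = \<pi> ` ({1..n} - hd T)" if "T \<in> keys x" for T
    proof -
      have "T \<noteq> []" using that x two_rowD(1)[OF p] by (auto simp: tabloid_module_simps tabloid_def)
      then show ?thesis
        using permutes_image[OF \<pi>] image_set_diff[OF permutes_inj[OF \<pi>], of "{1..n}" "hd T"] by (simp add: hd_map)
    qed
    then have "linearize ((\<lambda>T. {1..n} - hd T) \<circ> map (image \<pi>)) x = linearize (image \<pi> \<circ> (\<lambda>T. {1..n} - hd T)) x"
      unfolding linearize_def by (intro sum.cong) simp_all
    then show ?thesis by (simp add: second_row_map_def tabloid_module_simps linearize_comp)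
  qed
qed (simp add: second_row_map_def linearize_add)

text \<open>Both sides are matched for the same pairs and hence proportional; at the second row of
  \<open>t\<close> both have coefficient 1.\<close>

lemma second_row_map_polytabloid:
  assumes p: "two_row p n a" and t: "tableau p t"
  shows "second_row_map n (polytabloid p t) = matching_vector a n a (\<lambda>j. t (0, j)) (\<lambda>j. t (1, j))"
proof -
  let ?p = "\<lambda>j. t (0, j)" and ?q = "\<lambda>j. t (1, j)"
  have n: "sum_list p = n" by (rule two_rowD(2)[OF p])
  have sub: "space (specht p) \<subseteq> space (tabloid_module p)" using submodule_specht by (simp only: submodule_def)
  have e: "polytabloid p t \<in> space (tabloid_module p)" using sub polytabloid_in_specht[OF t] by blast
  have "specht p = sub_rep (tabloid_module p) (space (specht p))" by (simp add: specht_def sub_rep_def)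
  then have "hom n (specht p) (LP a n) (second_row_map n)"
    using hom_from_sub_rep[OF hom_second_row_map[OF p] sub] by metis
  then obtain c where c: "second_row_map n (polytabloid p t) = smul c (matching_vector a n a ?p ?q)"
    using hom_specht_polytabloid[OF p t] by blast
  have m: "matching n a ?p ?q" by (rule matching_tableau[OF p t])
  have "lookup (second_row_map n (polytabloid p t)) ({1..n} - hd (tabloid p t)) = 1"
    unfolding second_row_map_def using e t lookup_polytabloid_self[OF t]
    by (subst lookup_linearize[OF inj_on_second_row[OF p]]) (auto simp: tabloid_module_simps)
  moreover have "lookup (matching_vector a n a ?p ?q) (?q ` {..<a}) = 1"
  proof -
    have "?q ` {..<a} \<in> subsets_of_size a n"
      using m unfolding matching_def subsets_of_size_def by (simp add: card_image)
    then show ?thesis using transversal_union[OF m, of "{}"] by (simp add: lookup_matching_vector)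
  qed
  ultimately have "c = 1" unfolding second_row[OF p t] c by simp
  then show ?thesis using c by simp
qed

section \<open>Two-row Specht modules as spans of matching vectors\<close>

lemma inj_second_row_map:
  assumes p: "two_row p n a" and x: "x \<in> space (tabloid_module p)" and z: "second_row_map n x = 0"
  shows "x = 0"
proof (rule poly_mapping_eqI)
  fix T
  show "lookup x T = lookup 0 T"
  proof (cases "T \<in> tabloid p ` {t. tableau p t}")
    case True
    then show ?thesis
      using lookup_linearize[OF inj_on_second_row[OF p] _ True, of x] x z
      by (simp add: tabloid_module_simps second_row_map_def)
  next
    case False
    then show ?thesis using x by (auto simp: tabloid_module_simps in_keys_iff)
  qed
qed

lemma submodule_image:
  assumes V: "Sn_module n V" and f: "hom n V (LP k n) f"
  shows "submodule n (LP k n) (f ` space V)"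
proof -
  have "pm.subspace (f ` space V)"
    unfolding pm.subspace_def
  proof (intro conjI ballI allI)
    show "0 \<in> f ` space V" using hom_zero[OF V f] Sn_moduleD(4)[OF V] by (metis image_eqI)
    fix x y assume "x \<in> f ` space V" "y \<in> f ` space V"
    then show "x + y \<in> f ` space V"
      using Sn_moduleD(2)[OF V] homD(2)[OF f] by (metis (no_types, lifting) image_iff)
  next
    fix c x assume "x \<in> f ` space V"
    then obtain v where v: "v \<in> space V" "x = f v" by blast
    then have "smul c x = f (scale V c v)" using homD(3)[OF f v(1), of c] by simp
    then show "smul c x \<in> f ` space V" using Sn_moduleD(3)[OF V v(1)] by blast
  qed
  moreover have "linearize (image \<pi>) x \<in> f ` space V" if \<pi>: "\<pi> permutes {1..n}" and x: "x \<in> f ` space V" for \<pi> x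
  proof -
    obtain v where v: "v \<in> space V" "x = f v" using x by blast
    then have "linearize (image \<pi>) x = f (action V \<pi> v)" using homD(4)[OF f \<pi> v(1)] by simp
    then show ?thesis using Sn_moduleD(5)[OF V \<pi> v(1)] by blast
  qed
  moreover have "f ` space V \<subseteq> space (LP k n)" using homD(1)[OF f] by blast
  ultimately show ?thesis by (simp only: submodule_LP) blast
qed

text \<open>Schur's argument: the kernel inside \<open>W a\<close> is a submodule, hence zero or
  everything, and the bounds on \<open>a\<close> make the image of a matching vector
  nonzero.\<close>

lemma up_inj_on_matching_span:
  assumes "a \<le> k" "a + k \<le> n" and x: "x \<in> matching_span a n a" "up a k n x = 0"
  shows "x = 0"
proof -
  have W: "matching_span a n a \<subseteq> space (LP a n)" "pm.subspace (matching_span a n a)"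
    and Wact: "\<And>\<pi> x. \<pi> permutes {1..n} \<Longrightarrow> x \<in> matching_span a n a \<Longrightarrow> linearize (image \<pi>) x \<in> matching_span a n a"
    using submodule_matching_span[of n a a] by (simp_all only: submodule_LP)
  let ?K = "{x \<in> matching_span a n a. up a k n x = 0}"
  have up: "up a k n (x + y) = up a k n x + up a k n y" "up a k n (smul c x) = smul c (up a k n x)"
    if "x \<in> matching_span a n a" "y \<in> matching_span a n a" for c x y
    using homD(2)[OF hom_up, of x a n y k] homD(3)[OF hom_up, of x a n k c] that W(1) by auto
  have "pm.subspace ?K"
    unfolding pm.subspace_def
  proof (intro conjI ballI allI)
    show "0 \<in> ?K" using hom_zero[OF Sn_module_LP hom_up] pm.subspace_0[OF W(2)] by blast
  qed (use up pm.subspace_add[OF W(2)] pm.subspace_scale[OF W(2)] in auto)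
  moreover have "linearize (image \<pi>) y \<in> ?K" if \<pi>: "\<pi> permutes {1..n}" and y: "y \<in> ?K" for \<pi> y
  proof -
    have "y \<in> space (LP a n)" using y W(1) by blast
    from homD(4)[OF hom_up \<pi> this] have "up a k n (linearize (image \<pi>) y) = 0" using y by simp
    then show ?thesis using Wact[OF \<pi>] y by blast
  qed
  ultimately have "submodule n (LP a n) ?K" using W(1) by (simp only: submodule_LP) blast
  then have "?K = {0} \<or> ?K = matching_span a n a" by (rule submodule_of_matching_span) blast
  moreover have "?K \<noteq> matching_span a n a"
  proof -
    obtain p q where m: "matching n a p q" using ex_matching[of a n] assms by auto
    have "up a k n (matching_vector a n a p q) \<noteq> 0"
      using matching_vector_nz[OF m assms(1,2)] by (simp only: up_matching_vector[OF m]) simp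
    then show ?thesis using matching_vector_in_span[OF m, of a] by blast
  qed
  ultimately show ?thesis using x by blast
qed

text \<open>The map is \<open>up\<close> after the encoding by second rows: it sends polytabloids to
  matching vectors, and both factors are injective where needed. The second claim keeps the
  embedding into \<open>LP k n\<close> explicit, for assembling direct sums.\<close>

lemma isomorphic_specht_matching_span:
  assumes p: "two_row p n a" and ak: "a \<le> k" "a + k \<le> n"
  shows "isomorphic n (specht p) (sub_rep (LP k n) (matching_span k n a))"
    and "\<exists>f. hom n (specht p) (LP k n) f \<and> inj_on f (space (specht p)) \<and> f ` space (specht p) = matching_span k n a"
proof -
  have n: "sum_list p = n" by (rule two_rowD(2)[OF p])
  have M: "Sn_module n (specht p)" using Sn_module_specht[of p] n by simp
  have sub: "space (specht p) \<subseteq> space (tabloid_module p)" using submodule_specht by (simp only: submodule_def)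
  have "specht p = sub_rep (tabloid_module p) (space (specht p))" by (simp add: specht_def sub_rep_def)
  then have J: "hom n (specht p) (LP a n) (second_row_map n)"
    using hom_from_sub_rep[OF hom_second_row_map[OF p] sub] by metis
  let ?f = "up a k n \<circ> second_row_map n"
  have f: "hom n (specht p) (LP k n) ?f" by (rule hom_comp[OF J hom_up])
  have fe: "?f (polytabloid p t) = matching_vector k n a (\<lambda>j. t (0, j)) (\<lambda>j. t (1, j))" if "tableau p t" for t
    by (simp only: comp_apply second_row_map_polytabloid[OF p that] up_matching_vector[OF matching_tableau[OF p that]])
  have JW: "second_row_map n x \<in> matching_span a n a" if "x \<in> space (specht p)" for x
    using _ that unfolding specht_simps second_row_map_def matching_span_def
  proof (rule linearize_span)
    fix s assume "s \<in> polytabloid p ` {t. tableau p t}"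
    then obtain t where t: "tableau p t" "s = polytabloid p t" by blast
    show "linearize (\<lambda>T. {1..n} - hd T) s \<in> pm.span {matching_vector a n a p q |p q. matching n a p q}"
      using matching_vector_in_span[OF matching_tableau[OF p t(1)], of a] second_row_map_polytabloid[OF p t(1)] t(2)
      by (simp add: matching_span_def second_row_map_def)
  qed
  have inj0: "x = 0" if "x \<in> space (specht p)" "?f x = 0" for x
    using inj_second_row_map[OF p] up_inj_on_matching_span[OF ak JW[OF that(1)]] that sub by (metis comp_apply subsetD)
  have inj: "inj_on ?f (space (specht p))"
  proof (rule inj_onI)
    fix x y assume x: "x \<in> space (specht p)" and y: "y \<in> space (specht p)" and eq: "?f x = ?f y"
    have d: "x - y \<in> space (specht p)" using x y unfolding specht_simps by (rule pm.span_diff)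
    have "?f (x - y + y) = ?f (x - y) + ?f y" by (rule homD(2)[OF f d y])
    then show "x = y" using inj0[OF d] eq by simp
  qed
  have "?f ` space (specht p) = matching_span k n a"
  proof
    obtain t where t: "tableau p t" using ex_tableau by blast
    have "matching_vector k n a (\<lambda>j. t (0, j)) (\<lambda>j. t (1, j)) \<in> ?f ` space (specht p)"
      using fe[OF t] polytabloid_in_specht[OF t] by (metis image_eqI)
    then show "matching_span k n a \<subseteq> ?f ` space (specht p)"
      by (rule matching_span_subset[OF submodule_image[OF M f] matching_tableau[OF p t]])
  next
    have Wsub: "pm.subspace (matching_span k n a)" using submodule_matching_span[of n k a] by (simp only: submodule_LP)
    show "?f ` space (specht p) \<subseteq> matching_span k n a"
    proof clarify
      fix x assume "x \<in> space (specht p)"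
      then have "x \<in> space (specht p) \<and> ?f x \<in> matching_span k n a"
        unfolding specht_simps
      proof (induction rule: pm.span_induct_alt)
        case base
        then show ?case using hom_zero[OF M f] pm.subspace_0[OF Wsub] by (metis pm.span_zero)
      next
        case (step c s y)
        then obtain t where t: "tableau p t" "s = polytabloid p t" by blast
        have s: "s \<in> space (specht p)" using polytabloid_in_specht[OF t(1)] t(2) by metis
        have y: "y \<in> space (specht p)" using step by (simp only: specht_simps)
        have cs: "smul c s \<in> space (specht p)" using s unfolding specht_simps by (rule pm.span_scale)
        have "?f (smul c s + y) = smul c (?f s) + ?f y"
          using homD(2)[OF f cs y] homD(3)[OF f s, of c] by simp
        moreover have "?f s \<in> matching_span k n a"
          unfolding t(2) fe[OF t(1)] by (rule matching_vector_in_span[OF matching_tableau[OF p t(1)]])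
        ultimately have "?f (smul c s + y) \<in> matching_span k n a"
          using step pm.subspace_add[OF Wsub] pm.subspace_scale[OF Wsub] by metis
        moreover have "smul c s + y \<in> space (specht p)"
          using cs y unfolding specht_simps by (rule pm.span_add)
        ultimately show ?case by (simp only: specht_simps) 
      qed
      then show "?f x \<in> matching_span k n a" ..
    qed
  qed
  with f inj show ex: "\<exists>f. hom n (specht p) (LP k n) f \<and> inj_on f (space (specht p)) \<and> f ` space (specht p) = matching_span k n a"
    by blast
  then obtain g where g: "hom n (specht p) (LP k n) g" "inj_on g (space (specht p))" "g ` space (specht p) = matching_span k n a"
    by blast
  have "hom n (specht p) (sub_rep (LP k n) (matching_span k n a)) g"
    by (rule hom_onto_sub_rep[OF g(1) eq_refl[OF g(3)]])
  moreover have "bij_betw g (space (specht p)) (space (sub_rep (LP k n) (matching_span k n a)))"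
    using bij_betw_imageI[OF g(2,3)] by (simp only: sub_rep_simps)
  ultimately show "isomorphic n (specht p) (sub_rep (LP k n) (matching_span k n a))"
    unfolding isomorphic_iff_hom by blast
qed

section \<open>Multiplicities\<close>

text \<open>These are the \<open>\<mu>\<close> whose padded shape has at most two nonempty rows; the
  empty list and trailing zeros are included.\<close>

definition one_row :: "nat list \<Rightarrow> bool" where
  "one_row \<mu> \<longleftrightarrow> (\<forall>i. 1 \<le> i \<and> i < length \<mu> \<longrightarrow> \<mu> ! i = 0)"

lemma sum_list_one_row:
  assumes "one_row \<mu>"
  shows "sum_list \<mu> = (if \<mu> = [] then 0 else \<mu> ! 0)"
proof (cases \<mu>)
  case (Cons x xs)
  have "y = 0" if y: "y \<in> set xs" for y
  proof -
    obtain i where "i < length xs" "xs ! i = y" using y by (meson in_set_conv_nth)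
    then show ?thesis using assms Cons unfolding one_row_def by (metis Suc_less_eq length_Cons le_add1 nth_Cons_Suc plus_1_eq_Suc)
  qed
  then have "sum_list xs = 0" by (simp add: sum_list_eq_0_iff)
  then show ?thesis using Cons by simp
qed simp

lemma two_row_one_row:
  assumes "one_row \<mu>" "admissible \<mu> n"
  shows "two_row ((n - sum_list \<mu>) # \<mu>) n (sum_list \<mu>)"
proof -
  let ?a = "sum_list \<mu>"
  have s: "?a = (if \<mu> = [] then 0 else \<mu> ! 0)" by (rule sum_list_one_row[OF assms(1)])
  have "2 * ?a \<le> n"
  proof (cases "\<mu> = []")
    case False
    then have "?a \<in> set \<mu>" using s by simp
    then show ?thesis using assms(2) by (auto simp: admissible_def)
  qed simp
  moreover have "sum_list ((n - ?a) # \<mu>) = n" using assms(2) by (simp add: admissible_def)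
  moreover have "cells ((n - ?a) # \<mu>) = {0} \<times> {..<n - ?a} \<union> {1} \<times> {..<?a}"
  proof -
    have "(i, j) \<in> cells ((n - ?a) # \<mu>) \<longleftrightarrow> (i, j) \<in> {0} \<times> {..<n - ?a} \<union> {1} \<times> {..<?a}" for i j
    proof -
      consider "i = 0" | "i = 1" | l where "i = Suc (Suc l)" by (metis One_nat_def not0_implies_Suc)
      then show ?thesis
      proof cases
        case 3
        then show ?thesis using assms(1) by (auto simp: cells_def one_row_def)
      next
        case 2
        then show ?thesis using s by (cases "\<mu> = []") (auto simp: cells_def)
      qed (simp add: cells_def)
    qed
    then show ?thesis by auto
  qed
  ultimately show ?thesis by (simp add: two_row_def)
qed

text \<open>A nonzero entry after the first forces \<open>\<mu> ! 0\<close> and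
  \<open>\<mu> ! 1\<close> to be positive by monotonicity, and admissibility makes the padded row at
  least as long as \<open>\<mu> ! 0\<close>.\<close>

lemma three_cells:
  assumes "partition \<mu>" "admissible \<mu> n" "\<not> one_row \<mu>"
  shows "{(0, 0), (1, 0), (2, 0)} \<subseteq> cells ((n - sum_list \<mu>) # \<mu>)"
proof -
  obtain i where i: "1 \<le> i" "i < length \<mu>" "\<mu> ! i \<noteq> 0" using assms(3) by (auto simp: one_row_def)
  have sorted: "\<mu> ! l \<le> \<mu> ! m" if "m < l" "l < length \<mu>" for l m
    using assms(1) that by (auto simp: partition_def sorted_wrt_iff_nth_less)
  have 1: "\<mu> ! 1 > 0" using sorted[of 1 i] i by (cases "i = 1") auto
  have 0: "\<mu> ! 0 > 0" using sorted[of 0 1] 1 i by simp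
  have "\<mu> ! 0 \<in> set \<mu>" using i by (intro nth_mem) linarith
  then have "n - sum_list \<mu> > 0" using assms(2) 0 by (fastforce simp: admissible_def)
  then show ?thesis using 0 1 i by (auto simp: cells_def nth_Cons numeral_2_eq_2)
qed

section \<open>Embeddings of padded Specht modules into \<open>LP k n\<close>\<close>

lemma sum_list_pad: "admissible \<mu> n \<Longrightarrow> sum_list ((n - sum_list \<mu>) # \<mu>) = n"
  by (simp add: admissible_def)

lemma Sn_module_V_pad: "admissible \<mu> n \<Longrightarrow> Sn_module n (V_pad \<mu> n)"
  unfolding V_pad_def using Sn_module_specht sum_list_pad by metis

text \<open>The witness \<open>e\<close> is the polytabloid of one fixed tableau and the pairs are
  its columns. They are chosen before \<open>k\<close> and \<open>f\<close>, so two embeddings send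
  the same vector to multiples of the same matching vector; this is what excludes repeated
  summands.\<close>

lemma V_pad_embedding:
  assumes \<mu>: "partition \<mu>" "admissible \<mu> n"
  shows "\<exists>e p q. e \<in> space (V_pad \<mu> n) \<and> e \<noteq> 0 \<and>
    (\<forall>k f. hom n (V_pad \<mu> n) (LP k n) f \<longrightarrow> inj_on f (space (V_pad \<mu> n)) \<longrightarrow>
      one_row \<mu> \<and> matching n (sum_list \<mu>) p q \<and>
      (\<exists>c. c \<noteq> 0 \<and> f e = smul c (matching_vector k n (sum_list \<mu>) p q) \<and> matching_vector k n (sum_list \<mu>) p q \<noteq> 0))"
proof -
  let ?s = "(n - sum_list \<mu>) # \<mu>"
  obtain t where t: "tableau ?s t" using ex_tableau by blast
  let ?e = "polytabloid ?s t" and ?p = "\<lambda>j. t (0, j)" and ?q = "\<lambda>j. t (1, j)"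
  have e: "?e \<in> space (V_pad \<mu> n)" unfolding V_pad_def by (rule polytabloid_in_specht[OF t])
  have nz: "?e \<noteq> 0" using lookup_polytabloid_self[OF t] by auto
  have "one_row \<mu> \<and> matching n (sum_list \<mu>) ?p ?q \<and>
      (\<exists>c. c \<noteq> 0 \<and> f ?e = smul c (matching_vector k n (sum_list \<mu>) ?p ?q) \<and> matching_vector k n (sum_list \<mu>) ?p ?q \<noteq> 0)"
    if f: "hom n (V_pad \<mu> n) (LP k n) f" and inj: "inj_on f (space (V_pad \<mu> n))" for k f
  proof -
    have M: "Sn_module n (V_pad \<mu> n)" by (rule Sn_module_V_pad[OF \<mu>(2)])
    have fe: "f ?e \<noteq> 0"
      using inj_onD[OF inj, of ?e 0] hom_zero[OF M f] Sn_moduleD(4)[OF M] e nz by auto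
    have f': "hom n (specht ?s) (LP k n) f" using f by (simp add: V_pad_def)
    have one: "one_row \<mu>"
      using hom_specht_three_rows[OF sum_list_pad[OF \<mu>(2)] f' t] three_cells[OF \<mu>] fe by blast
    have tr: "two_row ?s n (sum_list \<mu>)" by (rule two_row_one_row[OF one \<mu>(2)])
    obtain c where c: "f ?e = smul c (matching_vector k n (sum_list \<mu>) ?p ?q)"
      using hom_specht_polytabloid[OF tr t f'] by blast
    moreover have "c \<noteq> 0" "matching_vector k n (sum_list \<mu>) ?p ?q \<noteq> 0" using c fe by auto
    ultimately show ?thesis using one matching_tableau[OF tr t] by blast
  qed
  then show ?thesis using e nz by blast
qed

text \<open>The inverse isomorphism embeds \<open>V_pad \<mu> n\<close> into \<open>LP k n\<close>,
  so its image \<open>W j\<close> contains a nonzero matching vector with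
  \<open>sum_list \<mu>\<close> pairs, and such a vector lies in only one of the spans.\<close>

lemma isomorphic_matching_span_V_padD:
  assumes \<mu>: "partition \<mu>" "admissible \<mu> n" and iso: "isomorphic n (sub_rep (LP k n) (matching_span k n j)) (V_pad \<mu> n)"
  shows "one_row \<mu>" "sum_list \<mu> = j"
proof -
  obtain e p q where e: "e \<in> space (V_pad \<mu> n)" and "e \<noteq> 0"
    and emb: "\<forall>k f. hom n (V_pad \<mu> n) (LP k n) f \<longrightarrow> inj_on f (space (V_pad \<mu> n)) \<longrightarrow>
      one_row \<mu> \<and> matching n (sum_list \<mu>) p q \<and>
      (\<exists>c. c \<noteq> 0 \<and> f e = smul c (matching_vector k n (sum_list \<mu>) p q) \<and> matching_vector k n (sum_list \<mu>) p q \<noteq> 0)"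
    using V_pad_embedding[OF \<mu>] by blast
  have WM: "Sn_module n (sub_rep (LP k n) (matching_span k n j))"
    by (rule Sn_module_sub_rep[OF Sn_module_LP submodule_matching_span])
  have W: "matching_span k n j \<subseteq> space (LP k n)" "pm.subspace (matching_span k n j)" using submodule_matching_span[of n k j] by (simp_all only: submodule_LP)
  obtain f where f: "hom n (V_pad \<mu> n) (sub_rep (LP k n) (matching_span k n j)) f"
    "bij_betw f (space (V_pad \<mu> n)) (space (sub_rep (LP k n) (matching_span k n j)))"
    using isomorphic_sym[OF WM iso] unfolding isomorphic_iff_hom by blast
  have "inj_on f (space (V_pad \<mu> n))" using f(2) by (simp add: bij_betw_def)
  with emb hom_into_sub_rep[OF f(1) W(1)] obtain c where
    one: "one_row \<mu>" and m: "matching n (sum_list \<mu>) p q" and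
    c: "c \<noteq> 0" "f e = smul c (matching_vector k n (sum_list \<mu>) p q)" "matching_vector k n (sum_list \<mu>) p q \<noteq> 0"
    by blast
  have "f e \<in> matching_span k n j" using homD(1)[OF f(1) e] by simp
  then have "smul (1 / c) (f e) \<in> matching_span k n j" by (rule pm.subspace_scale[OF W(2)])
  then have "matching_vector k n (sum_list \<mu>) p q \<in> matching_span k n j" using c(1,2) by simp
  then show "sum_list \<mu> = j" by (rule matching_vector_in_span_index[OF m c(3)])
  show "one_row \<mu>" by (rule one)
qed

lemma irreducible_matching_span:
  assumes "j \<le> k" "j + k \<le> n"
  shows "irreducible_module n (sub_rep (LP k n) (matching_span k n j))"
proof -
  obtain p q where m: "matching n j p q" using ex_matching[of j n] assms by auto
  have "matching_span k n j \<noteq> {0}" using matching_vector_in_span[OF m, of k] matching_vector_nz[OF m assms] by blast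
  moreover have "U = {0} \<or> U = matching_span k n j" if U: "submodule n (sub_rep (LP k n) (matching_span k n j)) U" for U
  proof (rule submodule_of_matching_span)
    show "U \<subseteq> matching_span k n j" using U by (simp add: submodule_def)
    then show "submodule n (LP k n) U" using U submodule_matching_span[of n k j] by (auto simp: submodule_def)
  qed
  ultimately show ?thesis
    using Sn_module_sub_rep[OF Sn_module_LP submodule_matching_span] by (simp add: irreducible_module_def)
qed

text \<open>Equality of sets, not just isomorphism: \<open>U\<close> contains a nonzero matching
  vector and so the span generated by it, which irreducibility makes all of
  \<open>U\<close>.\<close>

lemma irreducible_submodule_eq_matching_span:
  assumes U: "submodule n (LP k n) U" "irreducible_module n (sub_rep (LP k n) U)"
  shows "\<exists>j\<le>k. U = matching_span k n j"
proof -
  have "U \<noteq> {0}" using U(2) by (simp add: irreducible_module_def)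
  then obtain j p q where m: "matching n j p q" and nz: "matching_vector k n j p q \<noteq> 0" and mem: "matching_vector k n j p q \<in> U"
    using submodule_contains_matching_vector[OF U(1)] by blast
  have "submodule n (sub_rep (LP k n) U) (matching_span k n j)"
    using submodule_matching_span[of n k j] matching_span_subset[OF U(1) m mem] by (simp add: submodule_def)
  then have "matching_span k n j = {0} \<or> matching_span k n j = U" using U(2) by (simp add: irreducible_module_def)
  then have "matching_span k n j = U" using matching_vector_in_span[OF m, of k] nz by blast
  then show ?thesis using matching_vector_nzD[OF m nz] by blast
qed

text \<open>The index set \<open>{..<Suc k}\<close> has the form over which
  \<open>multiplicity\<close> quantifies.\<close>

lemma isomorphic_LP_sum_matching_span: "isomorphic n (LP k n) (direct_sum {..<Suc k} (\<lambda>i. sub_rep (LP k n) (matching_span k n i)))"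
proof (rule isomorphic_direct_sumI[where \<theta> = "\<lambda>_ x. x"])
  show "Sn_module n (LP k n)" by (rule Sn_module_LP)
  show "Sn_module n (sub_rep (LP k n) (matching_span k n i))" for i
    by (rule Sn_module_sub_rep[OF Sn_module_LP submodule_matching_span])
  show "hom n (sub_rep (LP k n) (matching_span k n i)) (LP k n) (\<lambda>x. x)" for i
    using submodule_matching_span[of n k i] by (intro homI) (auto simp: submodule_def)
  show "x i = 0" if "\<And>i. i \<in> {..<Suc k} \<Longrightarrow> x i \<in> space (sub_rep (LP k n) (matching_span k n i))"
    "(\<Sum>i\<in>{..<Suc k}. x i) = 0" "i \<in> {..<Suc k}" for x i
    using matching_span_independent[of "{..<Suc k}" x k n i] that by (simp only: sub_rep_simps) simp
  show "\<exists>x. (\<forall>i\<in>{..<Suc k}. x i \<in> space (sub_rep (LP k n) (matching_span k n i))) \<and> v = (\<Sum>i\<in>{..<Suc k}. x i)"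
    if "v \<in> space (LP k n)" for v
    using LP_eq_sum_matching_span[OF that] by (simp only: sub_rep_simps lessThan_Suc_atMost atLeast0AtMost)
qed simp

section \<open>Uniqueness of the decomposition and the multiplicities\<close>

lemma hom_projection:
  assumes S: "\<And>i. i \<in> I \<Longrightarrow> Sn_module n (S i)" and i: "i \<in> I"
  shows "hom n (direct_sum I S) (S i) (\<lambda>F. lookup F i)"
  using i Sn_moduleD(6)[OF S[OF i]] Sn_moduleD(7)[OF S[OF i]]
  by (intro homI) (auto simp: direct_sum_simps lookup_add lookup_mapp when_def in_keys_iff)

text \<open>The given isomorphism need not be addition of components, so the \<open>U i\<close> are
  not known to be independent subspaces. Its effect on matching vectors decides: two equal summands
  would both map the same vector into one line, against injectivity, and each \<open>v b\<close> has
  a nonzero component in some \<open>U i\<close>, which is a multiple of \<open>v b\<close>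
  itself.\<close>

lemma decomposition_of_LP:
  fixes r :: nat
  assumes kn: "2 * k \<le> n"
    and U: "\<And>i. i < r \<Longrightarrow> submodule n (LP k n) (U i) \<and> irreducible_module n (sub_rep (LP k n) (U i))"
    and iso: "isomorphic n (LP k n) (direct_sum {..<r} (\<lambda>i. sub_rep (LP k n) (U i)))" (is "isomorphic n ?V ?D")
  shows "\<exists>\<sigma>. bij_betw \<sigma> {..<r} {..k} \<and> (\<forall>i<r. U i = matching_span k n (\<sigma> i))"
proof -
  have "\<forall>i. \<exists>j. i < r \<longrightarrow> j \<le> k \<and> U i = matching_span k n j" using irreducible_submodule_eq_matching_span U by metis
  then obtain \<sigma> where \<sigma>: "\<And>i. i < r \<Longrightarrow> \<sigma> i \<le> k" "\<And>i. i < r \<Longrightarrow> U i = matching_span k n (\<sigma> i)" by metis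
  have "\<forall>j. \<exists>p q. j \<le> k \<longrightarrow> matching n j p q" using ex_matching kn by (metis le_trans mult_le_mono2)
  then obtain P Q where m: "\<And>j. j \<le> k \<Longrightarrow> matching n j (P j) (Q j)" by metis
  define v where "v j = matching_vector k n j (P j) (Q j)" for j
  have vnz: "v j \<noteq> 0" if "j \<le> k" for j
    unfolding v_def using kn that by (intro matching_vector_nz m) auto
  have vW: "v j \<in> matching_span k n j" if "j \<le> k" for j unfolding v_def by (rule matching_vector_in_span[OF m[OF that]])
  have vLP: "v j \<in> space (LP k n)" for j unfolding v_def by (rule matching_vector_in)
  have eigen: "\<exists>c. f (v j) = smul c (v j)" if j: "j \<le> k" and U: "v j \<in> U" and f: "hom n (sub_rep (LP k n) U) (LP k n) f" for f j U
  proof -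
    have "matched n (sub_rep (LP k n) U) j (P j) (Q j) (v j)"
      using matched_matching_vector[OF m[OF j], of k] U by (simp only: matched_def sub_rep_simps v_def) simp
    from matched_LP[OF m[OF j] matched_hom[OF f m[OF j] this]] show ?thesis unfolding v_def .
  qed
  have US: "Sn_module n (sub_rep (LP k n) (U i))" if "i < r" for i
    using U[OF that] by (simp add: irreducible_module_def)
  have Usub: "U i \<subseteq> space (LP k n)" "pm.subspace (U i)" if "i < r" for i
    using U[OF that] by (simp_all only: submodule_LP)
  obtain f where f: "hom n ?V ?D f" "bij_betw f (space ?V) (space ?D)" using iso unfolding isomorphic_iff_hom by blast
  define g where "g = inv_into (space ?V) f"
  have g: "hom n ?D ?V g" unfolding g_def by (rule hom_inverse[OF Sn_module_LP f])
  have "bij_betw g (space ?D) (space ?V)" unfolding g_def by (rule bij_betw_inv_into[OF f(2)])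
  then have ginj: "inj_on g (space ?D)" by (simp add: bij_betw_def)
  have Z: "0 \<in> space (sub_rep (LP k n) (U j))" if "j \<in> {..<r}" for j
    using pm.subspace_0[OF Usub(2)] that by simp
  have comp: "hom n (sub_rep (LP k n) (U i)) (LP k n) (\<lambda>x. g (single i x))" if "i < r" for i
    using that by (intro hom_component[OF US _ _ g] Z) auto
  have sp: "single i x \<in> space ?D" if "i < r" "x \<in> U i" for i x
    using that Z by (auto simp: direct_sum_simps lookup_single when_def split: if_splits)
  have "inj_on \<sigma> {..<r}"
  proof (rule inj_onI, rule ccontr)
    fix i j assume ij: "i \<in> {..<r}" "j \<in> {..<r}" "\<sigma> i = \<sigma> j" "i \<noteq> j"
    define s where "s = \<sigma> i"
    have s: "s \<le> k" "U i = matching_span k n s" "U j = matching_span k n s" using ij \<sigma> by (auto simp: s_def)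
    have vU: "v s \<in> U i" "v s \<in> U j" using vW s by auto
    obtain ci where ci: "g (single i (v s)) = smul ci (v s)" using eigen[OF s(1) vU(1) comp] ij by auto
    obtain cj where cj: "g (single j (v s)) = smul cj (v s)" using eigen[OF s(1) vU(2) comp] ij by auto
    have zero: "(0 :: nat \<Rightarrow>\<^sub>0 _) \<in> space ?D" using sp[of i 0] pm.subspace_0[OF Usub(2)] ij by (simp add: single_zero)
    have "ci \<noteq> 0"
    proof
      assume "ci = 0"
      then have "g (single i (v s)) = g 0" using ci hom_zero[OF US comp, of i] ij by simp
      then have "single i (v s) = (0 :: nat \<Rightarrow>\<^sub>0 _)"
        using inj_onD[OF ginj, of "single i (v s)" 0] sp[OF _ vU(1)] zero ij by simp
      then show False using vnz[OF s(1)] by (metis lookup_single_eq lookup_zero)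
    qed
    have sc: "smul c (v s) \<in> U i" "smul c (v s) \<in> U j" for c
      using vU pm.subspace_scale[OF Usub(2)] ij by auto
    \<comment> \<open>Cross-multiplying by the two eigenvalues makes the images equal, while the
      arguments sit in different coordinates.\<close>
    have "g (single i (smul cj (v s))) = smul cj (g (single i (v s)))"
      using homD(3)[OF comp, of i "v s" cj] vU ij by simp
    moreover have "g (single j (smul ci (v s))) = smul ci (g (single j (v s)))"
      using homD(3)[OF comp, of j "v s" ci] vU ij by simp
    ultimately have "g (single i (smul cj (v s))) = g (single j (smul ci (v s)))"
      by (simp add: ci cj mult.commute)
    then have "single i (smul cj (v s)) = single j (smul ci (v s))"
      using inj_onD[OF ginj] sp sc ij by blast
    then have "lookup (single i (smul cj (v s))) j = smul ci (v s)" by simp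
    then have "smul ci (v s) = 0" using ij(4) by (simp add: lookup_single_not_eq)
    then show False using \<open>ci \<noteq> 0\<close> vnz[OF s(1)] by simp
  qed
  moreover have "b \<in> \<sigma> ` {..<r}" if b: "b \<le> k" for b
  proof -
    have "f (v b) \<noteq> 0"
    proof
      assume "f (v b) = 0"
      then have "f (v b) = f 0" using hom_zero[OF Sn_module_LP f(1)] by simp
      moreover have "inj_on f (space ?V)" using f(2) by (simp add: bij_betw_def)
      ultimately have "v b = 0" using vLP Sn_moduleD(4)[OF Sn_module_LP] by (meson inj_onD)
      then show False using vnz[OF b] by simp
    qed
    then obtain i where i: "lookup (f (v b)) i \<noteq> 0" by (metis poly_mapping_eqI lookup_zero)
    have "f (v b) \<in> space ?D" by (rule homD(1)[OF f(1) vLP])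
    then have ir: "i < r" using i by (auto simp: direct_sum_simps in_keys_iff)
    \<comment> \<open>An endomorphism of \<open>LP k n\<close> with image in \<open>U i\<close>; it
      scales \<open>v b\<close> by a nonzero \<open>c\<close>, which puts \<open>v b\<close> into
      \<open>U i\<close>.\<close>
    let ?h = "(\<lambda>F. lookup F i) \<circ> f"
    have "hom n ?D (sub_rep (LP k n) (U i)) (\<lambda>F. lookup F i)"
      using hom_projection[of "{..<r}" n "\<lambda>i. sub_rep (LP k n) (U i)" i] US ir by simp
    then have h: "hom n (LP k n) (sub_rep (LP k n) (U i)) ?h" by (rule hom_comp[OF f(1)])
    have "hom n (LP k n) (LP k n) ?h" by (rule hom_into_sub_rep[OF h Usub(1)[OF ir]])
    then obtain c where c: "?h (v b) = smul c (v b)"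
      using matched_LP[OF m[OF b] matched_hom[OF _ m[OF b] matched_matching_vector[OF m[OF b]]]]
      unfolding v_def by blast
    have "c \<noteq> 0" using c i by auto
    have "?h (v b) \<in> U i" using homD(1)[OF h vLP] by simp
    then have "smul (1 / c) (?h (v b)) \<in> matching_span k n (\<sigma> i)"
      using pm.subspace_scale[OF Usub(2)[OF ir]] \<sigma>(2)[OF ir] by blast
    then have "v b \<in> matching_span k n (\<sigma> i)" using c \<open>c \<noteq> 0\<close> by simp
    then have "b = \<sigma> i" using matching_vector_in_span_index[OF m[OF b]] vnz[OF b] unfolding v_def by blast
    then show ?thesis using ir by blast
  qed
  ultimately have "bij_betw \<sigma> {..<r} {..k}"
    using \<sigma>(1) by (auto simp: bij_betw_def)
  then show ?thesis using \<sigma>(2) by blast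
qed

lemma multiplicity_LP:
  assumes kn: "2 * k \<le> n"
  shows "multiplicity n (LP k n) S = card {j. j \<le> k \<and> isomorphic n (sub_rep (LP k n) (matching_span k n j)) S}"
  unfolding multiplicity_def
proof (rule the_equality)
  have irr: "\<forall>i<Suc k. submodule n (LP k n) (matching_span k n i) \<and> irreducible_module n (sub_rep (LP k n) (matching_span k n i))"
    using submodule_matching_span irreducible_matching_span kn by auto
  show "\<exists>(r::nat) U. (\<forall>i<r. submodule n (LP k n) (U i) \<and> irreducible_module n (sub_rep (LP k n) (U i))) \<and>
      isomorphic n (LP k n) (direct_sum {..<r} (\<lambda>i. sub_rep (LP k n) (U i))) \<and>
      card {j. j \<le> k \<and> isomorphic n (sub_rep (LP k n) (matching_span k n j)) S} =
      card {i. i < r \<and> isomorphic n (sub_rep (LP k n) (U i)) S}"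
    by (rule exI[of _ "Suc k"], rule exI[of _ "matching_span k n"])
      (use irr isomorphic_LP_sum_matching_span in \<open>simp only: less_Suc_eq_le simp_thms\<close>)
next
  fix c
  assume "\<exists>(r::nat) U. (\<forall>i<r. submodule n (LP k n) (U i) \<and> irreducible_module n (sub_rep (LP k n) (U i))) \<and>
      isomorphic n (LP k n) (direct_sum {..<r} (\<lambda>i. sub_rep (LP k n) (U i))) \<and>
      c = card {i. i < r \<and> isomorphic n (sub_rep (LP k n) (U i)) S}"
  then obtain r :: nat and U where U: "\<And>i. i < r \<Longrightarrow> submodule n (LP k n) (U i) \<and> irreducible_module n (sub_rep (LP k n) (U i))"
    "isomorphic n (LP k n) (direct_sum {..<r} (\<lambda>i. sub_rep (LP k n) (U i)))"
    and c: "c = card {i. i < r \<and> isomorphic n (sub_rep (LP k n) (U i)) S}" by blast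
  obtain \<sigma> where \<sigma>: "bij_betw \<sigma> {..<r} {..k}" "\<forall>i<r. U i = matching_span k n (\<sigma> i)"
    using decomposition_of_LP[OF kn U] by blast
  let ?P = "\<lambda>U. isomorphic n (sub_rep (LP k n) U) S"
  have "{i. i < r \<and> ?P (U i)} = {i \<in> {..<r}. ?P (matching_span k n (\<sigma> i))}" using \<sigma>(2) by auto
  moreover have "\<sigma> ` {i \<in> {..<r}. ?P (matching_span k n (\<sigma> i))} = {j \<in> \<sigma> ` {..<r}. ?P (matching_span k n j)}" by blast
  moreover have "\<sigma> ` {..<r} = {..k}" using \<sigma>(1) by (rule bij_betw_imp_surj_on)
  ultimately have "\<sigma> ` {i. i < r \<and> ?P (U i)} = {j. j \<le> k \<and> ?P (matching_span k n j)}" by simp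
  then have "bij_betw \<sigma> {i. i < r \<and> ?P (U i)} {j. j \<le> k \<and> ?P (matching_span k n j)}"
    by (intro bij_betw_subset[OF \<sigma>(1)]) auto
  then show "c = card {j. j \<le> k \<and> isomorphic n (sub_rep (LP k n) (matching_span k n j)) S}"
    unfolding c by (rule bij_betw_same_card)
qed

text \<open>The value does not involve \<open>n\<close>, so \<open>2 * k\<close> is a stability
  bound for all \<open>\<mu>\<close> at once.\<close>

lemma stable_multiplicity_LP:
  assumes kn: "2 * k \<le> n" and \<mu>: "partition \<mu>"
  shows "stable_multiplicity (LP k) \<mu> n = (if one_row \<mu> \<and> sum_list \<mu> \<le> k then 1 else 0)"
proof (cases "one_row \<mu> \<and> sum_list \<mu> \<le> k")
  case True
  let ?a = "sum_list \<mu>"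
  have le: "m \<le> ?a" if "m \<in> set \<mu>" for m by (rule member_le_sum_list) (simp_all add: that)
  \<comment> \<open>Both \<open>?a\<close> and \<open>m\<close> are at most \<open>k\<close>, so
    admissibility holds automatically from \<open>2 * k\<close> on.\<close>
  have "?a + m \<le> n" if "m \<in> set \<mu>" for m using le[OF that] True kn by linarith
  then have adm: "admissible \<mu> n" using True kn by (simp add: admissible_def)
  have iso: "isomorphic n (sub_rep (LP k n) (matching_span k n ?a)) (V_pad \<mu> n)"
    unfolding V_pad_def
  proof (rule isomorphic_sym)
    show "Sn_module n (specht ((n - ?a) # \<mu>))" using Sn_module_V_pad[OF adm] by (simp only: V_pad_def)
    show "isomorphic n (specht ((n - ?a) # \<mu>)) (sub_rep (LP k n) (matching_span k n ?a))"
      using True kn by (intro isomorphic_specht_matching_span(1) two_row_one_row adm) auto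
  qed
  have "{j. j \<le> k \<and> isomorphic n (sub_rep (LP k n) (matching_span k n j)) (V_pad \<mu> n)} = {?a}"
    using iso True isomorphic_matching_span_V_padD(2)[OF \<mu> adm] by blast
  then have "multiplicity n (LP k n) (V_pad \<mu> n) = 1" by (simp only: multiplicity_LP[OF kn] card.empty card.insert) simp
  then show ?thesis using True adm by (simp add: stable_multiplicity_def)
next
  case False
  have "{j. j \<le> k \<and> isomorphic n (sub_rep (LP k n) (matching_span k n j)) (V_pad \<mu> n)} = {}" if "admissible \<mu> n"
    using False isomorphic_matching_span_V_padD[OF \<mu> that] by blast
  then have "multiplicity n (LP k n) (V_pad \<mu> n) = 0" if "admissible \<mu> n"
    using that by (simp only: multiplicity_LP[OF kn] card.empty)
  then show ?thesis using False by (auto simp: stable_multiplicity_def)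
qed

section \<open>Stability\<close>

lemma isomorphic_LP_V_pad:
  assumes kn: "2 * k \<le> n"
  shows "isomorphic n (LP k n) (direct_sum {0..k} (\<lambda>i. V_pad [i] n))"
proof -
  have adm: "admissible [i] n" if "i \<in> {0..k}" for i using kn that by (auto simp: admissible_def)
  have ex: "\<exists>f. hom n (V_pad [i] n) (LP k n) f \<and> inj_on f (space (V_pad [i] n)) \<and> f ` space (V_pad [i] n) = matching_span k n i"
    if i: "i \<in> {0..k}" for i
  proof -
    have "two_row ((n - i) # [i]) n i"
      using two_row_one_row[OF _ adm[OF i]] by (simp add: one_row_def)
    from isomorphic_specht_matching_span(2)[OF this, of k] show ?thesis
      using i kn by (simp only: V_pad_def sum_list.Cons sum_list.Nil add_0_right) auto
  qed
  then obtain \<theta> where \<theta>: "\<And>i. i \<in> {0..k} \<Longrightarrow> hom n (V_pad [i] n) (LP k n) (\<theta> i)"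
    "\<And>i. i \<in> {0..k} \<Longrightarrow> inj_on (\<theta> i) (space (V_pad [i] n))"
    "\<And>i. i \<in> {0..k} \<Longrightarrow> \<theta> i ` space (V_pad [i] n) = matching_span k n i"
    by metis
  have M: "Sn_module n (V_pad [i] n)" if "i \<in> {0..k}" for i by (rule Sn_module_V_pad[OF adm[OF that]])
  show ?thesis
  proof (rule isomorphic_direct_sumI[where \<theta> = \<theta>])
    fix x i
    assume x: "\<And>i. i \<in> {0..k} \<Longrightarrow> x i \<in> space (V_pad [i] n)" and sum: "(\<Sum>i\<in>{0..k}. \<theta> i (x i)) = 0" and i: "i \<in> {0..k}"
    have "\<theta> i (x i) = 0"
    proof (rule matching_span_independent[OF _ sum i])
      show "\<theta> j (x j) \<in> matching_span k n j" if "j \<in> {0..k}" for j using \<theta>(3)[OF that] x[OF that] by blast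
    qed simp
    then show "x i = 0"
      using inj_onD[OF \<theta>(2)[OF i], of "x i" 0] x[OF i] hom_zero[OF M[OF i] \<theta>(1)[OF i]] Sn_moduleD(4)[OF M[OF i]] by simp
  next
    fix v assume "v \<in> space (LP k n)"
    then obtain y where y: "\<forall>i\<in>{0..k}. y i \<in> matching_span k n i" "v = (\<Sum>i\<in>{0..k}. y i)" using LP_eq_sum_matching_span by blast
    then have "\<forall>i\<in>{0..k}. \<exists>x. x \<in> space (V_pad [i] n) \<and> y i = \<theta> i x" using \<theta>(3) by blast
    then obtain x where x: "\<forall>i\<in>{0..k}. x i \<in> space (V_pad [i] n) \<and> y i = \<theta> i (x i)" by (rule bchoice[THEN exE])
    then have "v = (\<Sum>i\<in>{0..k}. \<theta> i (x i))" unfolding y(2) by (intro sum.cong) auto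
    then show "\<exists>x. (\<forall>i\<in>{0..k}. x i \<in> space (V_pad [i] n)) \<and> v = (\<Sum>i\<in>{0..k}. \<theta> i (x i))" using x by blast
  qed (use Sn_module_LP M \<theta>(1) in simp_all)
qed

text \<open>All levels share one type of vectors, so the connecting maps are literal
  inclusions.\<close>

lemma LP_map_id: "LP_map k n f = f"
  by (simp add: LP_map_def linearize_id)

section \<open>Consistency, injectivity, surjectivity and uniform stability\<close>

lemma subsets_of_size_mono: "subsets_of_size k n \<subseteq> subsets_of_size k (Suc n)"
  by (auto simp: subsets_of_size_def)

lemma consistent_LP: "consistent (LP k) (LP_map k)"
  using Sn_module_LP subsets_of_size_mono
  by (force simp: consistent_def linear_map_def equivariant_def LP_map_id)

lemma eventually_injective_LP: "eventually_injective (LP k) (LP_map k)"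
  by (simp add: eventually_injective_def inj_on_def LP_map_id)

lemma LP_space_Suc: "space (LP k n) \<subseteq> space (LP k (Suc n))"
  using subsets_of_size_mono by auto

text \<open>The basis vector of \<open>{1..k}\<close>, available as soon as
  \<open>k \<le> n\<close>, has every basis vector of level \<open>n + 1\<close> in its
  orbit.\<close>

lemma eventually_S_surjective_LP: "eventually_S_surjective (LP k) (LP_map k)"
  unfolding eventually_S_surjective_def
proof (intro exI[of _ k] allI impI)
  fix n assume kn: "k \<le> n"
  have im: "LP_map k n ` space (LP k n) = space (LP k n)" by (simp add: LP_map_id)
  let ?O = "orbit_span (Suc n) (LP k (Suc n)) (space (LP k n))"
  have O: "submodule (Suc n) (LP k (Suc n)) ?O"
    by (rule orbit_span_submodule[OF Sn_module_LP LP_space_Suc])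
  then have sub: "?O \<subseteq> space (LP k (Suc n))" "pm.subspace ?O" by (simp_all only: submodule_LP)
  have gen: "single A 1 \<in> ?O" if A: "A \<in> subsets_of_size k (Suc n)" for A
  proof -
    have "finite A" by (rule subsets_of_size_finite[OF A])
    moreover have "card A = k" using A by (simp add: subsets_of_size_def)
    ultimately obtain h where h: "bij_betw h {1..k} A" using finite_same_card_bij[of "{1..k}" A] by auto
    have "inj_on h {1..k}" "h ` {1..k} = A" using h by (auto simp: bij_betw_def)
    moreover have "A \<subseteq> {1..Suc n}" using A by (simp add: subsets_of_size_def)
    ultimately obtain \<pi> where \<pi>: "\<pi> permutes {1..Suc n}" "\<forall>i\<in>{1..k}. \<pi> (id i) = h i"
      using permutation_transitive[of "{1..Suc n}" id "{1..k}" h] kn by auto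
    have "\<pi> ` {1..k} = A" using \<pi>(2) \<open>h ` {1..k} = A\<close> by (metis (no_types, lifting) id_apply image_cong)
    then have "single A 1 = action (LP k (Suc n)) \<pi> (single {1..k} 1)" by simp
    moreover have "single {1..k} 1 \<in> space (LP k n)" using kn by (simp add: subsets_of_size_def)
    ultimately show ?thesis
      unfolding orbit_span_def LP_simps(2) using \<pi>(1) by (intro pm.span_base) blast
  qed
  have "f \<in> ?O" if f: "f \<in> space (LP k (Suc n))" for f
  proof -
    have "f = (\<Sum>A\<in>keys f. smul (lookup f A) (single A 1))" using sum_single_keys[of f] by simp
    also have "\<dots> \<in> ?O" using f gen by (intro pm.subspace_sum[OF sub(2)] pm.subspace_scale[OF sub(2)]) auto
    finally show ?thesis .
  qed
  then show "orbit_span (Suc n) (LP k (Suc n)) (LP_map k n ` space (LP k n)) = space (LP k (Suc n))"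
    unfolding im using sub(1) by blast
qed

lemma uniformly_representation_stable_LP: "uniformly_representation_stable (LP k) (LP_map k)"
proof -
  have "stable_multiplicity (LP k) \<mu> n = stable_multiplicity (LP k) \<mu> (2 * k)" if "partition \<mu>" "2 * k \<le> n" for \<mu> n
    using stable_multiplicity_LP[OF that(2,1)] stable_multiplicity_LP[OF order_refl that(1)] by simp
  then show ?thesis
    unfolding uniformly_representation_stable_def representation_stable_def
    using consistent_LP eventually_injective_LP eventually_S_surjective_LP by blast
qed

text \<open>Symmetrizing the matching vector of level \<open>n\<close> over the unmatched points of level \<open>n + 1\<close>
  gives a positive multiple of the matching vector of level \<open>n + 1\<close>.\<close>

lemma matching_vector_Suc_in_submodule:
  assumes U: "submodule (Suc n) (LP k (Suc n)) U" and m: "matching n a p q"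
    and nz: "matching_vector k n a p q \<noteq> 0" and mem: "matching_vector k n a p q \<in> U"
  shows "matching_vector k (Suc n) a p q \<in> U"
proof -
  have m': "matching (Suc n) a p q" using m by (fastforce simp: matching_def)
  let ?Z = "singles (Suc n) a p q" and ?v = "matching_vector k n a p q"
  \<comment> \<open>The unmatched points of level \<open>n + 1\<close> are those of level
    \<open>n\<close> together with \<open>n + 1\<close>, so averaging over \<open>H\<close> restores
    the symmetry missing at \<open>n + 1\<close>. The elements of \<open>H\<close> fix all
    \<open>p j\<close> and \<open>q j\<close> and hence commute with the swaps of pairs.\<close>
  define H where "H = {\<pi>. \<pi> permutes ?Z}"
  define h where "h = (\<Sum>\<pi>\<in>H. linearize (image \<pi>) ?v)"
  have finZ: "finite ?Z" by (simp add: singles_def)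
  then have finH: "finite H" unfolding H_def by (rule finite_permutations)
  have H: "\<pi> permutes {1..Suc n}" if "\<pi> \<in> H" for \<pi>
    using that unfolding H_def by (auto intro: permutes_subset simp: singles_def)
  have Hfix: "\<pi> (p j) = p j" "\<pi> (q j) = q j" if "\<pi> \<in> H" "j < a" for \<pi> j
    using that unfolding H_def by (auto intro!: permutes_not_in[of \<pi> ?Z] simp: singles_def)
  have sub: "pm.subspace U" using U by (simp only: submodule_LP)
  have hU: "h \<in> U"
    unfolding h_def using U mem H by (intro pm.subspace_sum[OF sub]) (simp only: submodule_LP)
  have "linearize (image (transpose (p j) (q j))) h = smul (-1) h" if j: "j < a" for j
  proof -
    let ?t = "transpose (p j) (q j)"
    have comm: "?t \<circ> \<pi> = \<pi> \<circ> ?t" if "\<pi> \<in> H" for \<pi>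
    proof -
      have "inv \<pi> \<in> H" using that permutes_inv by (simp add: H_def)
      then show ?thesis
        using transpose_comp_eq[OF permutes_bij[OF H[OF that]], of "p j" "q j"] by (simp add: Hfix j)
    qed
    have "linearize (image ?t) ?v = smul (-1) ?v"
      using matched_matching_vector[OF m, of k] j by (simp add: matched_def)
    then have "linearize (image ?t) (linearize (image \<pi>) ?v) = smul (-1) (linearize (image \<pi>) ?v)" if "\<pi> \<in> H" for \<pi>
    proof -
      have "image ?t \<circ> image \<pi> = image \<pi> \<circ> image ?t"
        using comm[OF that] by (simp add: fun_eq_iff image_comp)
      then have "linearize (image ?t) (linearize (image \<pi>) ?v) = linearize (image \<pi>) (linearize (image ?t) ?v)"
        by (simp only: linearize_comp)
      then show ?thesis using \<open>linearize (image ?t) ?v = smul (-1) ?v\<close> by (simp only: linearize_smul)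
    qed
    then show ?thesis unfolding h_def linearize_sum pm.scale_sum_right by (intro sum.cong) auto
  qed
  moreover have "linearize (image (transpose x y)) h = h" if x: "x \<in> ?Z" and y: "y \<in> ?Z" for x y
  proof -
    let ?t = "transpose x y"
    have t: "?t permutes ?Z" by (rule permutes_swap_id[OF x y])
    have bij: "bij_betw (\<lambda>\<pi>. ?t \<circ> \<pi>) H H"
    proof (rule bij_betw_byWitness[where f' = "\<lambda>\<pi>. ?t \<circ> \<pi>"])
      show "\<forall>\<pi>\<in>H. ?t \<circ> (?t \<circ> \<pi>) = \<pi>" "\<forall>\<pi>\<in>H. ?t \<circ> (?t \<circ> \<pi>) = \<pi>"
        by (simp_all add: fun_eq_iff)
      show "(\<lambda>\<pi>. ?t \<circ> \<pi>) ` H \<subseteq> H" "(\<lambda>\<pi>. ?t \<circ> \<pi>) ` H \<subseteq> H"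
        unfolding H_def using t by (auto intro: permutes_compose)
    qed
    have "linearize (image ?t) h = (\<Sum>\<pi>\<in>H. linearize (image (?t \<circ> \<pi>)) ?v)"
      unfolding h_def linearize_sum linearize_comp by (intro sum.cong) (simp_all add: comp_def image_image)
    also have "\<dots> = h" unfolding h_def by (rule sum.reindex_bij_betw[OF bij])
    finally show ?thesis .
  qed
  moreover have "h \<in> space (LP k (Suc n))" using hU U by (auto simp: submodule_def)
  ultimately have "matched (Suc n) (LP k (Suc n)) a p q h" by (simp add: matched_def)
  then obtain c where c: "h = smul c (matching_vector k (Suc n) a p q)" using matched_LP[OF m'] by blast
  have "c \<noteq> 0"
  proof -
    obtain E where E: "E \<subseteq> singles n a p q" "q ` {..<a} \<union> E \<in> subsets_of_size k n"
      using ex_transversal[OF m matching_vector_nzD[OF m nz]] by blast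
    let ?A = "q ` {..<a} \<union> E"
    \<comment> \<open>No cancellation can occur at \<open>?A\<close>: its preimage still contains
      every \<open>q j\<close> and otherwise only unmatched points, so each term is 1, or 0 if the
      preimage contains \<open>n + 1\<close>. The identity contributes 1.\<close>
    have pos: "lookup (linearize (image \<pi>) ?v) ?A \<ge> 0" if \<pi>: "\<pi> \<in> H" for \<pi>
    proof -
      have i: "inv \<pi> permutes ?Z" using \<pi> permutes_inv by (simp add: H_def)
      then have iH: "inv \<pi> \<in> H" by (simp add: H_def)
      have "E \<subseteq> ?Z" using E(1) by (auto simp: singles_def)
      then have "inv \<pi> ` E \<subseteq> ?Z" using permutes_image[OF i] by blast
      moreover have "inv \<pi> ` ?A = q ` {..<a} \<union> inv \<pi> ` E"
        using Hfix(2)[OF iH] by (auto simp: image_Un image_image)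
      ultimately have "matching_coeff a p q (inv \<pi> ` ?A) = 1" using transversal_union[OF m'] by simp
      then show ?thesis
        by (simp add: lookup_linearize_image[OF permutes_bij[OF H[OF \<pi>]]] lookup_matching_vector)
    qed
    have "id \<in> H" by (simp add: H_def permutes_id)
    moreover have "lookup (linearize (image id) ?v) ?A = 1"
      using E(2) transversal_union[OF m E(1)] by (simp add: linearize_id lookup_matching_vector)
    ultimately have "0 < (\<Sum>\<pi>\<in>H. lookup (linearize (image \<pi>) ?v) ?A)"
      using finH pos by (intro sum_pos2[of H id]) auto
    then have "lookup h ?A \<noteq> 0" by (simp add: h_def lookup_sum)
    then show ?thesis using c by auto
  qed
  then have "matching_vector k (Suc n) a p q = smul (1 / c) h" by (simp add: c)
  then show ?thesis using pm.subspace_scale[OF sub hU] by metis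
qed

section \<open>Monotonicity\<close>

lemma submodule_zero: "submodule n (LP k n) {0}"
  by (simp add: submodule_LP pm.subspace_single_0)

lemma isomorphic_zero: "isomorphic n (sub_rep (LP k n) {0}) (direct_sum {..<0::nat} S)"
proof (rule isomorphic_direct_sumI[where \<theta> = "\<lambda>_ _. 0"])
  show "Sn_module n (sub_rep (LP k n) {0})" by (rule Sn_module_sub_rep[OF Sn_module_LP submodule_zero])
qed simp_all

text \<open>Only \<open>c = 0\<close> and \<open>c = 1\<close> occur. For \<open>c = 1\<close> the
  module \<open>U\<close> contains a matching vector; its span at level \<open>n + 1\<close>
  contains the matching vector of that level with the same pairs, and so a copy of
  \<open>V_pad \<mu> (Suc n)\<close>.\<close>

lemma monotonic_LP: "monotonic (LP k) (LP_map k)"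
  unfolding monotonic_def
proof (intro conjI allI impI)
  show "consistent (LP k) (LP_map k)" by (rule consistent_LP)
next
  fix n \<mu> and c :: nat and U
  assume "partition \<mu> \<and> admissible \<mu> n \<and> submodule n (LP k n) U \<and>
    isomorphic n (sub_rep (LP k n) U) (direct_sum {..<c} (\<lambda>_. V_pad \<mu> n))"
  then have \<mu>: "partition \<mu>" "admissible \<mu> n" and U: "submodule n (LP k n) U"
    and iso: "isomorphic n (sub_rep (LP k n) U) (direct_sum {..<c} (\<lambda>_. V_pad \<mu> n))" by auto
  let ?V = "V_pad \<mu> n" and ?D = "direct_sum {..<c} (\<lambda>_. V_pad \<mu> n)"
  let ?O = "orbit_span (Suc n) (LP k (Suc n)) (LP_map k n ` U)"
  have Usub: "U \<subseteq> space (LP k n)" "pm.subspace U" using U by (simp_all only: submodule_LP)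
  have im: "LP_map k n ` U = U" by (simp add: LP_map_id)
  have O: "submodule (Suc n) (LP k (Suc n)) ?O"
    unfolding im using Usub(1) LP_space_Suc by (intro orbit_span_submodule Sn_module_LP) blast
  then have Osub: "pm.subspace ?O" by (simp only: submodule_LP)
  have adm': "admissible \<mu> (Suc n)" using \<mu>(2) by (auto simp: admissible_def)
  show "\<exists>W. submodule (Suc n) (LP k (Suc n)) W \<and> W \<subseteq> ?O \<and>
      isomorphic (Suc n) (sub_rep (LP k (Suc n)) W) (direct_sum {..<c} (\<lambda>_. V_pad \<mu> (Suc n)))"
  proof (cases "c = 0")
    case True
    have "{0} \<subseteq> ?O" using pm.subspace_0[OF Osub] by simp
    then show ?thesis unfolding True using submodule_zero isomorphic_zero by blast
  next
    case False
    have VM: "Sn_module n ?V" by (rule Sn_module_V_pad[OF \<mu>(2)])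
    have UM: "Sn_module n (sub_rep (LP k n) U)" by (rule Sn_module_sub_rep[OF Sn_module_LP U])
    obtain f where f: "hom n (sub_rep (LP k n) U) ?D f" "bij_betw f (space (sub_rep (LP k n) U)) (space ?D)"
      using iso unfolding isomorphic_iff_hom by blast
    define g where "g = inv_into (space (sub_rep (LP k n) U)) f"
    have g: "hom n ?D (sub_rep (LP k n) U) g" unfolding g_def by (rule hom_inverse[OF UM f])
    have "bij_betw g (space ?D) (space (sub_rep (LP k n) U))" unfolding g_def by (rule bij_betw_inv_into[OF f(2)])
    then have ginj: "inj_on g (space ?D)" by (simp add: bij_betw_def)
    have sp: "single i x \<in> space ?D" if "i < c" "x \<in> space ?V" for i x
      using that Sn_moduleD(4)[OF VM] by (auto simp: direct_sum_simps lookup_single when_def split: if_splits)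
    have comp: "hom n ?V (sub_rep (LP k n) U) (\<lambda>x. g (single i x))" if "i < c" for i
      using that Sn_moduleD(4)[OF VM] by (intro hom_component[OF VM _ _ g]) auto
    have comp': "hom n ?V (LP k n) (\<lambda>x. g (single i x))" if "i < c" for i
      by (rule hom_into_sub_rep[OF comp[OF that] Usub(1)])
    have cinj: "inj_on (\<lambda>x. g (single i x)) (space ?V)" if "i < c" for i
      using inj_onD[OF ginj _ sp[OF that] sp[OF that]] by (intro inj_onI) (metis lookup_single_eq)
    obtain e p q where e: "e \<in> space ?V" "e \<noteq> 0"
      and emb: "\<forall>k f. hom n ?V (LP k n) f \<longrightarrow> inj_on f (space ?V) \<longrightarrow>
        one_row \<mu> \<and> matching n (sum_list \<mu>) p q \<and>
        (\<exists>c. c \<noteq> 0 \<and> f e = smul c (matching_vector k n (sum_list \<mu>) p q) \<and> matching_vector k n (sum_list \<mu>) p q \<noteq> 0)"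
      using V_pad_embedding[OF \<mu>] by blast
    let ?a = "sum_list \<mu>" and ?v = "matching_vector k n (sum_list \<mu>) p q"
    obtain d where one: "one_row \<mu>" and m: "matching n ?a p q" and nz: "?v \<noteq> 0"
      and d: "d \<noteq> 0" "g (single 0 e) = smul d ?v"
      using emb comp'[of 0] cinj[of 0] False by blast
    have scV: "scale ?V = smul" by (simp add: V_pad_def)
    \<comment> \<open>Two summands would send the same vector \<open>e\<close> to multiples
      \<open>d\<close> and \<open>d'\<close> of \<open>?v\<close>; cross-multiplying gives equal
      images of elements in different coordinates, which forces \<open>smul d e = 0\<close>.\<close>
    have "c = 1"
    proof (rule ccontr)
      assume "c \<noteq> 1"
      then have c: "0 < c" "1 < c" using False by auto
      obtain d' where d': "g (single 1 e) = smul d' ?v" using emb comp'[OF c(2)] cinj[OF c(2)] by blast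
      have "g (single 0 (smul d' e)) = smul d' (smul d ?v)"
        using homD(3)[OF comp'[OF c(1)] e(1), of d'] by (simp add: scV d)
      moreover have "g (single 1 (smul d e)) = smul d (smul d' ?v)"
        using homD(3)[OF comp'[OF c(2)] e(1), of d] by (simp add: scV d' del: One_nat_def)
      ultimately have "g (single 0 (smul d' e)) = g (single 1 (smul d e))" by (simp add: mult.commute)
      moreover have "smul x e \<in> space ?V" for x using Sn_moduleD(3)[OF VM e(1), of x] by (simp add: scV)
      ultimately have "single 0 (smul d' e) = (single 1 (smul d e) :: nat \<Rightarrow>\<^sub>0 _)"
        using inj_onD[OF ginj] sp c by blast
      then have "lookup (single (0::nat) (smul d' e)) 1 = smul d e" by (simp only: lookup_single_eq)
      then have "smul d e = 0" by (simp add: lookup_single_not_eq)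
      then show False using d(1) e(2) by simp
    qed
    have "g (single 0 e) \<in> U" using homD(1)[OF comp[of 0] e(1)] False by simp
    then have "smul (1 / d) (g (single 0 e)) \<in> U" by (rule pm.subspace_scale[OF Usub(2)])
    then have vU: "?v \<in> U" using d by simp
    have "?v \<in> ?O"
    proof -
      \<comment> \<open>The orbit span is generated by translates, so \<open>?v\<close> enters as
        its translate by the identity.\<close>
      have "?v = action (LP k (Suc n)) id ?v" by (simp add: linearize_id)
      then show ?thesis
        unfolding orbit_span_def LP_simps(2) im using vU permutes_id by (intro pm.span_base) blast
    qed
    then have "matching_vector k (Suc n) ?a p q \<in> ?O"
      by (rule matching_vector_Suc_in_submodule[OF O m nz])
    moreover have "matching (Suc n) ?a p q" using m by (fastforce simp: matching_def)
    ultimately have WO: "matching_span k (Suc n) ?a \<subseteq> ?O" by (intro matching_span_subset[OF O])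
    let ?V' = "V_pad \<mu> (Suc n)" and ?W = "matching_span k (Suc n) ?a"
    have VM': "Sn_module (Suc n) ?V'" by (rule Sn_module_V_pad[OF adm'])
    have WM: "Sn_module (Suc n) (sub_rep (LP k (Suc n)) ?W)" by (rule Sn_module_sub_rep[OF Sn_module_LP submodule_matching_span])
    have tr: "two_row ((Suc n - ?a) # \<mu>) (Suc n) ?a" by (rule two_row_one_row[OF one adm'])
    have ak: "?a \<le> k" "?a + k \<le> Suc n" using matching_vector_nzD[OF m nz] by auto
    obtain \<theta> where \<theta>: "hom (Suc n) ?V' (LP k (Suc n)) \<theta>" "inj_on \<theta> (space ?V')" "\<theta> ` space ?V' = ?W"
      using isomorphic_specht_matching_span(2)[OF tr ak] unfolding V_pad_def by blast
    have "isomorphic (Suc n) (sub_rep (LP k (Suc n)) ?W) (direct_sum {..<1::nat} (\<lambda>_. ?V'))"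
    proof (rule isomorphic_direct_sumI[where \<theta> = "\<lambda>_. \<theta>"])
      show "hom (Suc n) ?V' (sub_rep (LP k (Suc n)) ?W) \<theta>" by (rule hom_onto_sub_rep[OF \<theta>(1) eq_refl[OF \<theta>(3)]])
      show "x i = 0" if x: "\<And>i. i \<in> {..<1} \<Longrightarrow> x i \<in> space ?V'" and s: "(\<Sum>i\<in>{..<1}. \<theta> (x i)) = 0" and i: "i \<in> {..<1}"
        for x and i :: nat
      proof -
        have "\<theta> (x i) = \<theta> 0" using s i hom_zero[OF VM' \<theta>(1)] by simp
        then show ?thesis using inj_onD[OF \<theta>(2)] x[OF i] Sn_moduleD(4)[OF VM'] by blast
      qed
      show "\<exists>x. (\<forall>i\<in>{..<1}. x i \<in> space ?V') \<and> v = (\<Sum>i\<in>{..<1::nat}. \<theta> (x i))"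
        if v: "v \<in> space (sub_rep (LP k (Suc n)) ?W)" for v
      proof -
        obtain y where "y \<in> space ?V'" "v = \<theta> y" using v \<theta>(3) by auto
        then show ?thesis by (intro exI[of _ "\<lambda>_. y"]) simp
      qed
    qed (use WM VM' in simp_all)
    then show ?thesis unfolding \<open>c = 1\<close> using WO submodule_matching_span by blast
  qed
qed

theorem theoremA:
  fixes k :: nat
  shows "(\<forall>n\<ge>2 * k. isomorphic n (LP k n) (direct_sum {0..k} (\<lambda>i. V_pad [i] n))) \<and>
         consistent (LP k) (LP_map k) \<and>
         uniformly_representation_stable (LP k) (LP_map k) \<and>
         monotonic (LP k) (LP_map k)"
  using isomorphic_LP_V_pad consistent_LP uniformly_representation_stable_LP monotonic_LP by blast

end
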